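(* Let $H$ be a semisimple Hopf algebra over $k$ and let $\mathcal{C}=\mathrm{Rep}(H)$. There exists a unique Hopf subalgebra $K$ of $H$ which is contained in the center of $H$ and is maximal with respect to this property. Let $H_{ad}:=H/HK^+$ be the quotient of $H$ by $K$. Then $\mathcal{C}_{ad}=\mathrm{Rep}(H_{ad})$. Furthermore, $K=\mathrm{Fun}(U(\mathcal{C}))$.
   Context: $k$ is an algebraically closed field of characteristic $0$. $\mathrm{Rep}(H)$ is the fusion category of finite-dimensional representations of $H$. $K^+$ is the augmentation ideal of $K$ (the kernel of the counit restricted to $K$). $\mathrm{Rep}(H_{ad})$ is viewed as a full tensor subcategory of $\mathrm{Rep}(H)$ via the quotient map $H\to H_{ad}$. $\mathrm{Fun}(G)$ is the Hopf algebra of $k$-valued functions on a finite group $G$; the equality $K=\mathrm{Fun}(U(\mathcal{C}))$ is an identification of Hopf algebras. A fusion category is a $k$-linear semisimple rigid tensor category with finitely many isomorphism classes of simple objects, finite-dimensional morphism spaces, and simple unit object. For a fusion category $\mathcal{C}$, $\mathcal{C}_{ad}$ is the full tensor subcategory generated by all subobjects of $X\otimes X^*$, where $X$ runs through simple objects of $\mathcal{C}$. Universal grading group $U(\mathcal{C})$: let $R=K_0(\mathcal{C})$ be the Grothendieck ring with basis $B$ the isomorphism classes of simple objects, and let $R_{ad}=K_0(\mathcal{C}_{ad})$. A based $R_{ad}$-subbimodule of $R$ is the $\mathbb{Z}$-span of a subset of $B$ stable under left and right multiplication by $R_{ad}$. $R$ decomposes uniquely as a direct sum $R=\bigoplus_{a\in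 A}R_a$ of indecomposable based $R_{ad}$-subbimodules, and $A$ is a group with $ab=c$ if and only if $X_aX_b\in R_c$ for all $X_a\in R_a$, $X_b\in R_b$; its identity corresponds to the component $R_{ad}$. Then $U(\mathcal{C}):=A$. *)

theory Defs
  imports
    "Jordan_Normal_Form.Matrix"
    "HOL-Algebra.Free_Abelian_Groups"
    "HOL-Library.Set_Algebras"
    "HOL-Computational_Algebra.Polynomial"
begin

section \<open>Hopf algebras\<close>

text \<open>
  An element of the \<open>n\<close>-fold tensor power of a vector space is written as a formal sum (a multiset)
  of pure tensors \<open>x\<^sub>1 \<otimes> \<dots> \<otimes> x\<^sub>n\<close>, and a pure tensor is written as the list \<open>[x\<^sub>1, \<dots>, x\<^sub>n]\<close>.
  \<open>tensor_eq s\<close> is equality in the tensor power: the congruence on the free commutative monoid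
  generated by the defining relations of the tensor product over the field. (Negatives need no
  separate treatment: \<open>(- x) \<otimes> y\<close> is inverse to \<open>x \<otimes> y\<close>.)
\<close>

inductive tensor_eq ::
  "('k::field \<Rightarrow> 'h::ab_group_add \<Rightarrow> 'h) \<Rightarrow> 'h list multiset \<Rightarrow> 'h list multiset \<Rightarrow> bool"
  for s :: "'k \<Rightarrow> 'h \<Rightarrow> 'h" where
  refl: "tensor_eq s M M"
| sym: "tensor_eq s M N \<Longrightarrow> tensor_eq s N M"
| trans: "tensor_eq s M N \<Longrightarrow> tensor_eq s N P \<Longrightarrow> tensor_eq s M P"
| cong: "tensor_eq s M N \<Longrightarrow> tensor_eq s P Q \<Longrightarrow> tensor_eq s (M + P) (N + Q)"
| additive: "tensor_eq s {#us @ (x + y) # vs#} {#us @ x # vs, us @ y # vs#}"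
| zero: "tensor_eq s {#us @ 0 # vs#} {#}"
| balanced: "tensor_eq s {#us @ s c x # vs @ y # ws#} {#us @ x # vs @ s c y # ws#}"

abbreviation pure2 :: "('h \<times> 'h) multiset \<Rightarrow> 'h list multiset" where
  "pure2 M \<equiv> {#[a, b]. (a, b) \<in># M#}"

text \<open>
  The ring structure of the Hopf algebra is that of the type \<open>'h\<close>. The value \<open>comult H x\<close> is a
  Sweedler representative \<open>\<Sum> x\<^sub>1 \<otimes> x\<^sub>2\<close> of the comultiplication of \<open>x\<close>; all conditions on it are
  stated up to \<open>tensor_eq\<close>, so the choice of representative is immaterial.
\<close>

record ('k, 'h) hopf_structure =
  scale :: "'k \<Rightarrow> 'h \<Rightarrow> 'h"
  comult :: "'h \<Rightarrow> ('h \<times> 'h) multiset"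
  counit :: "'h \<Rightarrow> 'k"
  antipode :: "'h \<Rightarrow> 'h"

abbreviation teq :: "('k::field, 'h::ring_1) hopf_structure \<Rightarrow> 'h list multiset \<Rightarrow> 'h list multiset \<Rightarrow> bool" where
  "teq H \<equiv> tensor_eq (scale H)"

locale hopf_algebra = vector_space "scale H"
  for H :: "('k::field, 'h::ring_1) hopf_structure" +
  assumes scale_mult_left: "scale H c x * y = scale H c (x * y)"
    and scale_mult_right: "x * scale H c y = scale H c (x * y)"
    and comult_add: "teq H (pure2 (comult H (x + y))) (pure2 (comult H x) + pure2 (comult H y))"
    and comult_scale: "teq H (pure2 (comult H (scale H c x))) {#[scale H c a, b]. (a, b) \<in># comult H x#}"
    and comult_mult: "teq H (pure2 (comult H (x * y)))
          (\<Sum>(a, b)\<in>#comult H x. {#[a * a', b * b']. (a', b') \<in># comult H y#})"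
    and comult_one: "teq H (pure2 (comult H 1)) {#[1, 1]#}"
    and coassoc: "teq H (\<Sum>(a, b)\<in>#comult H x. {#[a\<^sub>1, a\<^sub>2, b]. (a\<^sub>1, a\<^sub>2) \<in># comult H a#})
                        (\<Sum>(a, b)\<in>#comult H x. {#[a, b\<^sub>1, b\<^sub>2]. (b\<^sub>1, b\<^sub>2) \<in># comult H b#})"
    and counit_linear: "Vector_Spaces.linear (scale H) (*) (counit H)"
    and counit_mult: "counit H (x * y) = counit H x * counit H y"
    and counit_one: "counit H 1 = 1"
    and counit_left: "(\<Sum>(a, b)\<in>#comult H x. scale H (counit H a) b) = x"
    and counit_right: "(\<Sum>(a, b)\<in>#comult H x. scale H (counit H b) a) = x"
    and antipode_linear: "Vector_Spaces.linear (scale H) (scale H) (antipode H)"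
    and antipode_left: "(\<Sum>(a, b)\<in>#comult H x. antipode H a * b) = scale H (counit H x) 1"
    and antipode_right: "(\<Sum>(a, b)\<in>#comult H x. a * antipode H b) = scale H (counit H x) 1"

definition left_ideal :: "('k::field, 'h::ring_1) hopf_structure \<Rightarrow> 'h set \<Rightarrow> bool" where
  "left_ideal H I \<longleftrightarrow> module.subspace (scale H) I \<and> (\<forall>h. \<forall>x\<in>I. h * x \<in> I)"

text \<open>
  Semisimplicity of the left regular module. Finite-dimensionality is not required: a semisimple
  Hopf algebra is automatically finite-dimensional.
\<close>

definition semisimple_algebra :: "('k::field, 'h::ring_1) hopf_structure \<Rightarrow> bool" where
  "semisimple_algebra H \<longleftrightarrow>
     (\<forall>I. left_ideal H I \<longrightarrow> (\<exists>J. left_ideal H J \<and> I \<inter> J = {0} \<and> I + J = UNIV))"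

definition hopf_subalgebra :: "('k::field, 'h::ring_1) hopf_structure \<Rightarrow> 'h set \<Rightarrow> bool" where
  "hopf_subalgebra H K \<longleftrightarrow>
     module.subspace (scale H) K \<and> 1 \<in> K \<and> (\<forall>x\<in>K. \<forall>y\<in>K. x * y \<in> K) \<and>
     (\<forall>x\<in>K. \<exists>M. set_mset M \<subseteq> K \<times> K \<and> teq H (pure2 (comult H x)) (pure2 M)) \<and>
     (\<forall>x\<in>K. antipode H x \<in> K)"

definition center :: "'h::ring_1 set" where
  "center = {z. \<forall>x. z * x = x * z}"

definition maximal_central_hopf_subalgebra ::
  "('k::field, 'h::ring_1) hopf_structure \<Rightarrow> 'h set \<Rightarrow> bool" where
  "maximal_central_hopf_subalgebra H K \<longleftrightarrow>
     hopf_subalgebra H K \<and> K \<subseteq> center \<and>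
     (\<forall>L. hopf_subalgebra H L \<and> L \<subseteq> center \<and> K \<subseteq> L \<longrightarrow> L = K)"

definition augmentation_ideal :: "('k::field, 'h::ring_1) hopf_structure \<Rightarrow> 'h set \<Rightarrow> 'h set" where
  "augmentation_ideal H K = {x \<in> K. counit H x = 0}"

text \<open>The ideal \<open>HK\<^sup>+\<close>.\<close>

definition quotient_ideal :: "('k::field, 'h::ring_1) hopf_structure \<Rightarrow> 'h set \<Rightarrow> 'h set" where
  "quotient_ideal H K = module.span (scale H) {h * x |h x. x \<in> augmentation_ideal H K}"


section \<open>The fusion category of finite-dimensional representations\<close>

text \<open>
  Finite-dimensional representations are taken in coordinates: the object \<open>(n, \<rho>)\<close> is the space
  \<open>k\<^sup>n\<close> with \<open>h\<close> acting by the matrix \<open>\<rho> h\<close>. Every finite-dimensional representation is isomorphic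
  to one of these, and unlike representations on varying carriers they form a single type that is
  closed under tensor products, duals and direct sums.
\<close>

type_synonym ('k, 'h) rep = "nat \<times> ('h \<Rightarrow> 'k mat)"

definition Rep :: "('k::field, 'h::ring_1) hopf_structure \<Rightarrow> ('k, 'h) rep set" where
  "Rep H = {(n, \<rho>). (\<forall>x. \<rho> x \<in> carrier_mat n n) \<and>
     (\<forall>x y. \<rho> (x + y) = \<rho> x + \<rho> y) \<and> (\<forall>c x. \<rho> (scale H c x) = c \<cdot>\<^sub>m \<rho> x) \<and>
     (\<forall>x y. \<rho> (x * y) = \<rho> x * \<rho> y) \<and> \<rho> 1 = 1\<^sub>m n}"

definition rep_hom :: "('k::field, 'h::ring_1) rep \<Rightarrow> ('k, 'h) rep \<Rightarrow> 'k mat set" where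
  "rep_hom V W = {T \<in> carrier_mat (fst W) (fst V). \<forall>h. T * snd V h = snd W h * T}"

definition rep_mono :: "('k::field, 'h::ring_1) rep \<Rightarrow> ('k, 'h) rep \<Rightarrow> 'k mat \<Rightarrow> bool" where
  "rep_mono V W T \<longleftrightarrow> T \<in> rep_hom V W \<and>
     (\<forall>v\<in>carrier_vec (fst V). T *\<^sub>v v = 0\<^sub>v (fst W) \<longrightarrow> v = 0\<^sub>v (fst V))"

definition rep_isomorphism :: "('k::field, 'h::ring_1) rep \<Rightarrow> ('k, 'h) rep \<Rightarrow> 'k mat \<Rightarrow> bool" where
  "rep_isomorphism V W T \<longleftrightarrow> T \<in> rep_hom V W \<and>
     (\<exists>T'\<in>rep_hom W V. T * T' = 1\<^sub>m (fst W) \<and> T' * T = 1\<^sub>m (fst V))"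

definition rep_iso :: "('k::field, 'h::ring_1) rep \<Rightarrow> ('k, 'h) rep \<Rightarrow> bool" where
  "rep_iso V W \<longleftrightarrow> (\<exists>T. rep_isomorphism V W T)"

definition subobject :: "('k::field, 'h::ring_1) rep \<Rightarrow> ('k, 'h) rep \<Rightarrow> bool" where
  "subobject V W \<longleftrightarrow> (\<exists>T. rep_mono V W T)"

definition simple_rep :: "('k::field, 'h::ring_1) hopf_structure \<Rightarrow> ('k, 'h) rep \<Rightarrow> bool" where
  "simple_rep H V \<longleftrightarrow> V \<in> Rep H \<and> fst V \<noteq> 0 \<and>
     (\<forall>W\<in>Rep H. \<forall>T. rep_mono W V T \<longrightarrow> fst W = 0 \<or> rep_isomorphism W V T)"

definition unit_rep :: "('k::field, 'h::ring_1) hopf_structure \<Rightarrow> ('k, 'h) rep" where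
  "unit_rep H = (1, \<lambda>h. mat 1 1 (\<lambda>_. counit H h))"

text \<open>Kronecker products: \<open>e\<^sub>i \<otimes> e\<^sub>j\<close> is the basis vector number \<open>i * dim W + j\<close>.\<close>

definition tensor_rep ::
  "('k::field, 'h::ring_1) hopf_structure \<Rightarrow> ('k, 'h) rep \<Rightarrow> ('k, 'h) rep \<Rightarrow> ('k, 'h) rep" where
  "tensor_rep H V W = (fst V * fst W, \<lambda>h. mat (fst V * fst W) (fst V * fst W)
     (\<lambda>(i, j). \<Sum>(a, b)\<in>#comult H h.
        snd V a $$ (i div fst W, j div fst W) * snd W b $$ (i mod fst W, j mod fst W)))"

definition dual_rep :: "('k::field, 'h::ring_1) hopf_structure \<Rightarrow> ('k, 'h) rep \<Rightarrow> ('k, 'h) rep" where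
  "dual_rep H V = (fst V, \<lambda>h. transpose_mat (snd V (antipode H h)))"

definition direct_sum_rep :: "('k::field, 'h::ring_1) rep list \<Rightarrow> ('k, 'h) rep" where
  "direct_sum_rep Vs = (sum_list (map fst Vs), \<lambda>h. diag_block_mat (map (\<lambda>V. snd V h) Vs))"

text \<open>
  A full subcategory is given by its set of objects. Closure under subobjects includes closure
  under isomorphism.
\<close>

definition full_tensor_subcategory ::
  "('k::field, 'h::ring_1) hopf_structure \<Rightarrow> ('k, 'h) rep set \<Rightarrow> bool" where
  "full_tensor_subcategory H D \<longleftrightarrow> D \<subseteq> Rep H \<and> unit_rep H \<in> D \<and>
     (\<forall>V\<in>D. \<forall>W\<in>D. tensor_rep H V W \<in> D) \<and> (\<forall>V\<in>D. dual_rep H V \<in> D) \<and>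
     (\<forall>Vs. set Vs \<subseteq> D \<longrightarrow> direct_sum_rep Vs \<in> D) \<and>
     (\<forall>V\<in>D. \<forall>W\<in>Rep H. subobject W V \<longrightarrow> W \<in> D)"

definition generated_subcategory ::
  "('k::field, 'h::ring_1) hopf_structure \<Rightarrow> ('k, 'h) rep set \<Rightarrow> ('k, 'h) rep set" where
  "generated_subcategory H G = \<Inter>{D. full_tensor_subcategory H D \<and> G \<subseteq> D}"

definition adjoint_subcategory ::
  "('k::field, 'h::ring_1) hopf_structure \<Rightarrow> ('k, 'h) rep set" where
  "adjoint_subcategory H = generated_subcategory H
     {Y \<in> Rep H. \<exists>X. simple_rep H X \<and> subobject Y (tensor_rep H X (dual_rep H X))}"

text \<open>
  Elements of \<open>H/I\<close> are the cosets \<open>x +o I\<close>, with operations computed on representatives, so a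
  function \<open>\<sigma>\<close> on cosets is a representation of \<open>H/I\<close> iff its pullback along the quotient map is
  one of \<open>H\<close>. The set of these pullbacks is the full subcategory \<open>Rep(H/I)\<close> of \<open>Rep(H)\<close>; as the
  quotient map is surjective, morphisms over \<open>H/I\<close> and over \<open>H\<close> coincide.
\<close>

definition quotient_map :: "'h::ring_1 set \<Rightarrow> 'h \<Rightarrow> 'h set" where
  "quotient_map I x = x +o I"

definition Rep_quotient ::
  "('k::field, 'h::ring_1) hopf_structure \<Rightarrow> 'h set \<Rightarrow> ('k, 'h) rep set" where
  "Rep_quotient H I = {(n, \<sigma> \<circ> quotient_map I) |n \<sigma>. (n, \<sigma> \<circ> quotient_map I) \<in> Rep H}"


section \<open>The Grothendieck ring and the universal grading group\<close>

definition iso_class ::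
  "('k::field, 'h::ring_1) hopf_structure \<Rightarrow> ('k, 'h) rep \<Rightarrow> ('k, 'h) rep set" where
  "iso_class H V = {W \<in> Rep H. rep_iso V W}"

definition Irr :: "('k::field, 'h::ring_1) hopf_structure \<Rightarrow> ('k, 'h) rep set set" where
  "Irr H = iso_class H ` {X. simple_rep H X}"

text \<open>Elements of the Grothendieck ring are integral combinations of isomorphism classes.\<close>

type_synonym ('k, 'h) k0 = "('k, 'h) rep set \<Rightarrow>\<^sub>0 int"

definition based_span :: "('k, 'h) rep set set \<Rightarrow> ('k, 'h) k0 set" where
  "based_span T = carrier (free_Abelian_group T)"

definition K0 :: "('k::field, 'h::ring_1) hopf_structure \<Rightarrow> ('k, 'h) k0 set" where
  "K0 H = based_span (Irr H)"

definition K0_class ::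
  "('k::field, 'h::ring_1) hopf_structure \<Rightarrow> ('k, 'h) rep \<Rightarrow> ('k, 'h) k0" where
  "K0_class H V = (THE r. \<exists>Xs. (\<forall>X\<in>set Xs. simple_rep H X) \<and> rep_iso V (direct_sum_rep Xs) \<and>
     r = (\<Sum>X\<leftarrow>Xs. frag_of (iso_class H X)))"

text \<open>The bilinear extension of \<open>[X] [Y] = [X \<otimes> Y]\<close>.\<close>

definition K0_mult ::
  "('k::field, 'h::ring_1) hopf_structure \<Rightarrow> ('k, 'h) k0 \<Rightarrow> ('k, 'h) k0 \<Rightarrow> ('k, 'h) k0" where
  "K0_mult H r s = frag_extend (\<lambda>b. frag_extend (\<lambda>c.
     K0_class H (tensor_rep H (SOME X. X \<in> b) (SOME Y. Y \<in> c))) s) r"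

definition K0_ad :: "('k::field, 'h::ring_1) hopf_structure \<Rightarrow> ('k, 'h) k0 set" where
  "K0_ad H = based_span (iso_class H ` {X \<in> adjoint_subcategory H. simple_rep H X})"

definition based_subbimodule ::
  "('k::field, 'h::ring_1) hopf_structure \<Rightarrow> ('k, 'h) k0 set \<Rightarrow> bool" where
  "based_subbimodule H M \<longleftrightarrow> (\<exists>T\<subseteq>Irr H. M = based_span T) \<and>
     (\<forall>a\<in>K0_ad H. \<forall>r\<in>M. K0_mult H a r \<in> M \<and> K0_mult H r a \<in> M)"

definition indecomposable_subbimodule ::
  "('k::field, 'h::ring_1) hopf_structure \<Rightarrow> ('k, 'h) k0 set \<Rightarrow> bool" where
  "indecomposable_subbimodule H M \<longleftrightarrow> based_subbimodule H M \<and> M \<noteq> {0} \<and>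
     \<not> (\<exists>M\<^sub>1 M\<^sub>2. based_subbimodule H M\<^sub>1 \<and> based_subbimodule H M\<^sub>2 \<and> M\<^sub>1 \<noteq> {0} \<and> M\<^sub>2 \<noteq> {0} \<and>
          M\<^sub>1 \<inter> M\<^sub>2 = {0} \<and> M = M\<^sub>1 + M\<^sub>2)"

definition internal_direct_sum :: "'a::ab_group_add set set \<Rightarrow> 'a set \<Rightarrow> bool" where
  "internal_direct_sum \<A> M \<longleftrightarrow> (\<forall>N\<in>\<A>. N \<subseteq> M) \<and>
     (\<forall>r\<in>M. \<exists>!f. f \<in> (\<Pi>\<^sub>E N\<in>\<A>. N) \<and> finite {N \<in> \<A>. f N \<noteq> 0} \<and> r = (\<Sum>N\<in>{N \<in> \<A>. f N \<noteq> 0}. f N))"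

definition grading_components ::
  "('k::field, 'h::ring_1) hopf_structure \<Rightarrow> ('k, 'h) k0 set set" where
  "grading_components H = (THE \<A>. (\<forall>M\<in>\<A>. indecomposable_subbimodule H M) \<and>
     internal_direct_sum \<A> (K0 H))"

text \<open>The index \<open>a\<close> of a component \<open>R\<^sub>a\<close> is taken to be the component itself.\<close>

definition universal_grading_group ::
  "('k::field, 'h::ring_1) hopf_structure \<Rightarrow> ('k, 'h) k0 set monoid" where
  "universal_grading_group H =
     \<lparr>carrier = grading_components H,
      monoid.mult = (\<lambda>A B. THE C. C \<in> grading_components H \<and> (\<forall>x\<in>A. \<forall>y\<in>B. K0_mult H x y \<in> C)),
      one = K0_ad H\<rparr>"


section \<open>The Hopf algebra of functions on a finite group\<close>

text \<open>
  Functions on the group are extensional functions on its carrier. The comultiplication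
  \<open>(\<Delta> f)(x, y) = f (x y)\<close> is expanded along the delta functions in the first variable:
  \<open>\<Delta> f = \<Sum>\<^sub>a \<delta>\<^sub>a \<otimes> (y \<mapsto> f (a y))\<close>.
\<close>

definition Fun :: "('g, 'm) monoid_scheme \<Rightarrow> ('g \<Rightarrow> 'k) set" where
  "Fun G = carrier G \<rightarrow>\<^sub>E UNIV"

definition Fun_comult ::
  "('g, 'm) monoid_scheme \<Rightarrow> ('g \<Rightarrow> 'k::field) \<Rightarrow> (('g \<Rightarrow> 'k) \<times> ('g \<Rightarrow> 'k)) multiset" where
  "Fun_comult G f = {#(\<lambda>x\<in>carrier G. if x = a then 1 else 0, \<lambda>y\<in>carrier G. f (a \<otimes>\<^bsub>G\<^esub> y)).
     a \<in># mset_set (carrier G)#}"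

lemma Fun_comult_eval:
  assumes "finite (carrier G)" "x \<in> carrier G" "y \<in> carrier G"
  shows "(\<Sum>(p, q)\<in>#Fun_comult G f. p x * q y) = f (x \<otimes>\<^bsub>G\<^esub> y)"
proof -
  have "(\<Sum>(p, q)\<in>#Fun_comult G f. p x * q y)
      = (\<Sum>a\<in>carrier G. (if x = a then 1 else 0) * f (a \<otimes>\<^bsub>G\<^esub> y))"
    using assms(2,3)
    by (simp add: Fun_comult_def sum_unfold_sum_mset multiset.map_comp comp_def)
  also have "\<dots> = (\<Sum>a\<in>carrier G. if x = a then f (a \<otimes>\<^bsub>G\<^esub> y) else 0)"
    by (rule sum.cong) auto
  also have "\<dots> = f (x \<otimes>\<^bsub>G\<^esub> y)"
    using assms by simp
  finally show ?thesis .
qed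

text \<open>Isomorphisms of Hopf algebras from \<open>Fun(G)\<close> onto the Hopf subalgebra \<open>K\<close> of \<open>H\<close>.\<close>

definition hopf_iso_Fun ::
  "('g, 'm) monoid_scheme \<Rightarrow> ('k::field, 'h::ring_1) hopf_structure \<Rightarrow> 'h set \<Rightarrow>
   (('g \<Rightarrow> 'k) \<Rightarrow> 'h) \<Rightarrow> bool" where
  "hopf_iso_Fun G H K \<Phi> \<longleftrightarrow> bij_betw \<Phi> (Fun G) K \<and>
     (\<forall>f\<in>Fun G. \<forall>g\<in>Fun G. \<Phi> (\<lambda>x\<in>carrier G. f x + g x) = \<Phi> f + \<Phi> g) \<and>
     (\<forall>c. \<forall>f\<in>Fun G. \<Phi> (\<lambda>x\<in>carrier G. c * f x) = scale H c (\<Phi> f)) \<and>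
     (\<forall>f\<in>Fun G. \<forall>g\<in>Fun G. \<Phi> (\<lambda>x\<in>carrier G. f x * g x) = \<Phi> f * \<Phi> g) \<and>
     \<Phi> (\<lambda>x\<in>carrier G. 1) = 1 \<and>
     (\<forall>f\<in>Fun G. teq H (pure2 (comult H (\<Phi> f))) {#[\<Phi> p, \<Phi> q]. (p, q) \<in># Fun_comult G f#}) \<and>
     (\<forall>f\<in>Fun G. counit H (\<Phi> f) = f \<one>\<^bsub>G\<^esub>) \<and>
     (\<forall>f\<in>Fun G. antipode H (\<Phi> f) = \<Phi> (\<lambda>x\<in>carrier G. f (inv\<^bsub>G\<^esub> x)))"

end

theory Submission
  imports Defs "Jordan_Normal_Form.Char_Poly"
begin

text \<open>
  A left integral \<open>t\<close> with \<open>\<epsilon>(t) = 1\<close> turns linear maps between representations into homomorphisms by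
  averaging over \<open>\<Sum> t\<^sub>1 \<otimes> S(t\<^sub>2)\<close>; this gives complete reducibility and a central idempotent \<open>e\<^sub>b\<close> for every
  isomorphism class \<open>b\<close> of simple objects, acting as \<open>1\<close> on \<open>b\<close> and as \<open>0\<close> on the other classes.
  The supports \<open>a \<circ> b\<close> of the products \<open>[a] [b]\<close> make the set of classes a polygroup (a group with
  set-valued product), the reversibility axioms being rigidity. The classes in the adjoint subcategory
  form the smallest subpolygroup \<open>N\<close> containing all \<open>x \<circ> x\<^sup>*\<close>; it is normal, the based subbimodules are
  spanned by unions of its cosets, and \<open>U(\<C>)\<close> is the quotient group.
  The elements of \<open>H\<close> that act on each simple object \<open>b\<close> by a scalar depending only on the coset of \<open>b\<close>
  are the linear combinations of the sums of \<open>e\<^sub>b\<close> over cosets. They form a central Hopf subalgebra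
  isomorphic to \<open>Fun(U(\<C>))\<close>. Conversely, a central Hopf subalgebra acts by scalars on simple objects and
  through the counit on each \<open>X \<otimes> X\<^sup>*\<close>, hence on the whole adjoint subcategory, so that its scalar on \<open>b\<close>
  depends only on the coset of \<open>b\<close>.
\<close>

section \<open>Sums over tensors, integrals and finite-dimensionality\<close>

text \<open>Comultiplications are formal sums known only up to the congruence
  \<open>tensor_eq\<close>, so single Sweedler components carry no information. Identities are
  extracted by evaluating balanced maps on both sides, and equalities in the tensor square are
  proved by testing against pairs of matrix coefficients of simple objects.

  Isomorphisms between iterated tensor products are avoided: associativity and unit laws are
  compared through characters. The trace of \<open>idem b\<close> on V is the multiplicity of b in V
  times the dimension of b; in characteristic 0 this determines the multiplicity as a natural
  number, so equal characters give equal multiplicities. Multiplicities are nonnegative, hence the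
  supports of products of basis elements are exact, whereas general elements of the Grothendieck
  ring have signs and their products may cancel.

  No involutivity of the antipode is available, so X and its double dual are not identified by a
  canonical map. They are compared by counting: X occurs in the dual of a constituent of X*, and
  dimensions leave no room for anything else (\<open>dual_class\<close>).\<close>

lemma tensor_eq_sum:
  fixes F :: "'h::ab_group_add list \<Rightarrow> 'a::ab_group_add"
  assumes "tensor_eq s M N"
    and add: "\<And>us x y vs. F (us @ (x + y) # vs) = F (us @ x # vs) + F (us @ y # vs)"
    and bal: "\<And>us c x vs y ws. F (us @ s c x # vs @ y # ws) = F (us @ x # vs @ s c y # ws)"
  shows "(\<Sum>l\<in>#M. F l) = (\<Sum>l\<in>#N. F l)"
  using assms(1)
proof (induction rule: tensor_eq.induct)
  case (zero us vs)
  have "F (us @ 0 # vs) = 0"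
    using add[of us 0 0 vs] by simp
  then show ?case by simp
qed (simp_all add: add bal)

text \<open>Balanced rather than bilinear: the target is only an abelian group, so a scalar is moved
  from one argument to the other instead of being pulled out. The same notion then serves maps into
  the field and into the Hopf algebra.\<close>

definition biadditive_balanced :: "('k \<Rightarrow> 'h \<Rightarrow> 'h) \<Rightarrow> ('h::ab_group_add \<Rightarrow> 'h \<Rightarrow> 'a::ab_group_add) \<Rightarrow> bool" where
  "biadditive_balanced s F \<longleftrightarrow> (\<forall>x y z. F (x + y) z = F x z + F y z) \<and>
     (\<forall>x y z. F x (y + z) = F x y + F x z) \<and> (\<forall>c x y. F (s c x) y = F x (s c y))"

text \<open>All three pairs of arguments are included because the relation \<open>balanced\<close>
  moves scalars between entries that need not be adjacent.\<close>

definition triadditive_balanced :: "('k \<Rightarrow> 'h \<Rightarrow> 'h) \<Rightarrow> ('h::ab_group_add \<Rightarrow> 'h \<Rightarrow> 'h \<Rightarrow> 'a::ab_group_add) \<Rightarrow> bool" where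
  "triadditive_balanced s F \<longleftrightarrow> (\<forall>x. biadditive_balanced s (F x)) \<and>
     (\<forall>y. biadditive_balanced s (\<lambda>x. F x y)) \<and> (\<forall>z. biadditive_balanced s (\<lambda>x y. F x y z))"

text \<open>The map is extended by 0 to lists of any other length. The generating relations preserve
  length, apart from deleting a list with entry 0, so the extension is again additive in each entry
  and balanced.\<close>

lemma tensor_eq_sum2:
  fixes G :: "'h::ab_group_add \<Rightarrow> 'h \<Rightarrow> 'a::ab_group_add"
  assumes "tensor_eq s M N" "biadditive_balanced s G"
  shows "(\<Sum>l\<in>#M. case l of [a, b] \<Rightarrow> G a b | _ \<Rightarrow> 0) = (\<Sum>l\<in>#N. case l of [a, b] \<Rightarrow> G a b | _ \<Rightarrow> 0)"
proof (rule tensor_eq_sum[OF assms(1)])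
  fix us vs :: "'h list" and x y
  \<comment> \<open>The length of the prefix is the position of the varied entry. From length 2 on
    the whole list has length at least 3, and all values are the default 0.\<close>
  consider "us = []" | u where "us = [u]" | u u' us' where "us = u # u' # us'"
    by (metis list.exhaust)
  then show "(case us @ (x + y) # vs of [a, b] \<Rightarrow> G a b | _ \<Rightarrow> 0) =
     (case us @ x # vs of [a, b] \<Rightarrow> G a b | _ \<Rightarrow> 0) + (case us @ y # vs of [a, b] \<Rightarrow> G a b | _ \<Rightarrow> 0)"
    using assms(2) by cases (auto simp: biadditive_balanced_def split: list.split)
next
  fix us vs ws :: "'h list" and c x y
  consider "us = []" | u where "us = [u]" | u u' us' where "us = u # u' # us'"
    by (metis list.exhaust)
  then show "(case us @ s c x # vs @ y # ws of [a, b] \<Rightarrow> G a b | _ \<Rightarrow> 0) =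
     (case us @ x # vs @ s c y # ws of [a, b] \<Rightarrow> G a b | _ \<Rightarrow> 0)"
    using assms(2) by cases (auto simp: biadditive_balanced_def append_eq_Cons_conv split: list.split)
qed

lemma tensor_eq_sum3:
  fixes G :: "'h::ab_group_add \<Rightarrow> 'h \<Rightarrow> 'h \<Rightarrow> 'a::ab_group_add"
  assumes "tensor_eq s M N" "triadditive_balanced s G"
  shows "(\<Sum>l\<in>#M. case l of [a, b, c] \<Rightarrow> G a b c | _ \<Rightarrow> 0) = (\<Sum>l\<in>#N. case l of [a, b, c] \<Rightarrow> G a b c | _ \<Rightarrow> 0)"
proof (rule tensor_eq_sum[OF assms(1)])
  fix us vs :: "'h list" and x y
  consider "us = []" | u where "us = [u]" | u u' where "us = [u, u']" | u u' u'' us' where "us = u # u' # u'' # us'"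
    by (metis list.exhaust)
  then show "(case us @ (x + y) # vs of [a, b, c] \<Rightarrow> G a b c | _ \<Rightarrow> 0) =
     (case us @ x # vs of [a, b, c] \<Rightarrow> G a b c | _ \<Rightarrow> 0) + (case us @ y # vs of [a, b, c] \<Rightarrow> G a b c | _ \<Rightarrow> 0)"
    using assms(2)
    by cases (auto simp: biadditive_balanced_def triadditive_balanced_def split: list.split)
next
  fix us vs ws :: "'h list" and c x y
  have b: "G (s c x) y z = G x (s c y) z" "G (s c x) z y = G x z (s c y)" "G z (s c x) y = G z x (s c y)" for z x y
    using assms(2) by (simp_all add: biadditive_balanced_def triadditive_balanced_def)
  consider "us = []" | u where "us = [u]" | u u' where "us = [u, u']" | u u' u'' us' where "us = u # u' # u'' # us'"
    by (metis list.exhaust)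
  then show "(case us @ s c x # vs @ y # ws of [a, b, c] \<Rightarrow> G a b c | _ \<Rightarrow> 0) =
     (case us @ x # vs @ s c y # ws of [a, b, c] \<Rightarrow> G a b c | _ \<Rightarrow> 0)"
    by cases (auto simp: b append_eq_Cons_conv split: list.split)
qed

lemma pure2_sum [simp]: "(\<Sum>l\<in>#pure2 M. case l of [a, b] \<Rightarrow> G a b | _ \<Rightarrow> 0) = (\<Sum>(a, b)\<in>#M. G a b)"
  by (simp add: multiset.map_comp comp_def case_prod_unfold)

lemma sum_mset_sum_mset_image:
  "(\<Sum>x\<in>#(\<Sum>y\<in>#M. g y). f x) = (\<Sum>y\<in>#M. \<Sum>x\<in>#g y. f x)"
  by (induction M) auto

lemma sum_mset_sum_swap: "(\<Sum>x\<in>#M. \<Sum>c\<in>C. f x c) = (\<Sum>c\<in>C. \<Sum>x\<in>#M. f x c)"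
  by (induction M) (simp_all add: sum.distrib)

section \<open>Sweedler calculus and the antipode\<close>

context hopf_algebra
begin

lemma comult_sum_add:
  assumes "biadditive_balanced (scale H) F"
  shows "(\<Sum>(a, b)\<in>#comult H (x + y). F a b) = (\<Sum>(a, b)\<in>#comult H x. F a b) + (\<Sum>(a, b)\<in>#comult H y. F a b)"
  using tensor_eq_sum2[OF comult_add assms, of x y] by simp

lemma comult_sum_scale:
  assumes "biadditive_balanced (scale H) F"
  shows "(\<Sum>(a, b)\<in>#comult H (scale H c x). F a b) = (\<Sum>(a, b)\<in>#comult H x. F (scale H c a) b)"
  using tensor_eq_sum2[OF comult_scale assms, of c x]
  by (simp add: multiset.map_comp comp_def case_prod_unfold)

lemma comult_sum_one:
  assumes "biadditive_balanced (scale H) F"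
  shows "(\<Sum>(a, b)\<in>#comult H 1. F a b) = F 1 1"
  using tensor_eq_sum2[OF comult_one assms] by simp

lemma comult_sum_mult:
  assumes "biadditive_balanced (scale H) F"
  shows "(\<Sum>(a, b)\<in>#comult H (x * y). F a b) =
    (\<Sum>(a, b)\<in>#comult H x. \<Sum>(a', b')\<in>#comult H y. F (a * a') (b * b'))"
  using tensor_eq_sum2[OF comult_mult assms, of x y]
  by (simp add: multiset.map_comp comp_def case_prod_unfold sum_mset_sum_mset_image)

lemma comult_sum_coassoc:
  assumes "triadditive_balanced (scale H) F"
  shows "(\<Sum>(a, b)\<in>#comult H x. \<Sum>(a1, a2)\<in>#comult H a. F a1 a2 b) =
    (\<Sum>(a, b)\<in>#comult H x. \<Sum>(b1, b2)\<in>#comult H b. F a b1 b2)"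
  using tensor_eq_sum3[OF coassoc assms, of x]
  by (simp add: multiset.map_comp comp_def case_prod_unfold sum_mset_sum_mset_image)

lemma antipode_add: "antipode H (x + y) = antipode H x + antipode H y"
  using antipode_linear by (simp add: Vector_Spaces.linear_iff)

lemma antipode_scale: "antipode H (scale H c x) = scale H c (antipode H x)"
  using antipode_linear by (simp add: Vector_Spaces.linear_iff)

lemma counit_add: "counit H (x + y) = counit H x + counit H y"
  using counit_linear by (simp add: Vector_Spaces.linear_iff)

lemma counit_scale: "counit H (scale H c x) = c * counit H x"
  using counit_linear by (simp add: Vector_Spaces.linear_iff)

lemma counit_0 [simp]: "counit H 0 = 0"
  using counit_scale[of 0 0] by simp

lemma antipode_0 [simp]: "antipode H 0 = 0"
  using antipode_add[of 0 0] by simp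

lemma counit_sum_mset: "counit H (\<Sum>x\<in>#M. f x) = (\<Sum>x\<in>#M. counit H (f x))"
  by (induction M) (auto simp: counit_add)

lemma antipode_sum_mset: "antipode H (\<Sum>x\<in>#M. f x) = (\<Sum>x\<in>#M. antipode H (f x))"
  by (induction M) (auto simp: antipode_add)

lemmas bilin_simps = biadditive_balanced_def triadditive_balanced_def antipode_add antipode_scale
  counit_add counit_scale algebra_simps scale_mult_left scale_mult_right scale_right_distrib scale_left_distrib scale_scale

lemma antipode_one: "antipode H 1 = 1"
proof -
  have "biadditive_balanced (scale H) (\<lambda>a b. antipode H a * b)"
    by (simp add: bilin_simps)
  from comult_sum_one[OF this] antipode_left[of 1] show ?thesis
    by (simp add: counit_one)
qed

lemma counit_antipode: "counit H (antipode H x) = counit H x"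
proof -
  have "counit H x = counit H (\<Sum>(a, b)\<in>#comult H x. antipode H a * b)"
    by (simp add: antipode_left counit_scale counit_one)
  also have "\<dots> = counit H (antipode H (\<Sum>(a, b)\<in>#comult H x. scale H (counit H b) a))"
    by (simp add: counit_sum_mset antipode_sum_mset counit_mult counit_scale antipode_scale case_prod_unfold mult.commute)
  also have "\<dots> = counit H (antipode H x)"
    by (simp add: counit_right)
  finally show ?thesis by simp
qed

text \<open>In Sweedler notation, f(x_1) v x_2 S(x_3) = f(x) v: coassociativity groups x_2 S(x_3),
  which the antipode axiom turns into a counit. Read from right to left it inserts factors into a
  product; f stays an arbitrary linear map so that it can contain an antipode.\<close>

lemma sum_antipode_right:
  assumes f: "\<And>a b. f (a + b) = f a + f b" "\<And>c a. f (scale H c a) = scale H c (f a)"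
  shows "(\<Sum>(a, b)\<in>#comult H x. \<Sum>(a1, a2)\<in>#comult H a. f a1 * v * a2 * antipode H b) = f x * v"
proof -
  have tri: "triadditive_balanced (scale H) (\<lambda>a b c. f a * v * b * antipode H c)"
    by (simp add: bilin_simps f)
  have fsum: "f (\<Sum>x\<in>#M. g x) = (\<Sum>x\<in>#M. f (g x))" for g and M :: "('h \<times> 'h) multiset"
    using f(2)[of 0 0] by (induction M) (auto simp: f)
  have "(\<Sum>(a, b)\<in>#comult H x. \<Sum>(a1, a2)\<in>#comult H a. f a1 * v * a2 * antipode H b) =
    (\<Sum>(a, b)\<in>#comult H x. \<Sum>(b1, b2)\<in>#comult H b. f a * v * b1 * antipode H b2)"
    by (rule comult_sum_coassoc[OF tri])
  also have "\<dots> = (\<Sum>(a, b)\<in>#comult H x. f a * v * (\<Sum>(b1, b2)\<in>#comult H b. b1 * antipode H b2))"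
    by (simp add: sum_mset_distrib_left case_prod_unfold mult.assoc multiset.map_comp comp_def)
  also have "\<dots> = f (\<Sum>(a, b)\<in>#comult H x. scale H (counit H b) a) * v"
    by (simp only: antipode_right) (simp add: fsum f(2) scale_mult_right scale_mult_left case_prod_unfold
        sum_mset_distrib_right multiset.map_comp comp_def)
  finally show ?thesis by (simp add: counit_right)
qed

lemma sum_mset_swap_pairs:
  fixes F :: "'b \<Rightarrow> 'c \<Rightarrow> 'd \<Rightarrow> 'e \<Rightarrow> 'z::comm_monoid_add"
  shows "(\<Sum>(a, b)\<in>#M. \<Sum>(c, d)\<in>#N. F a b c d) = (\<Sum>(c, d)\<in>#N. \<Sum>(a, b)\<in>#M. F a b c d)"
  by (simp add: case_prod_unfold) (rule sum_mset.swap)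

text \<open>Both sides are convolution inverses of the multiplication map. Written out: S(xy) =
  S(x_1 y_1) x_2 y_2 S(y_3) S(x_3), by inserting first for x and then for y, and S(x_1 y_1) x_2 y_2
  collapses to a counit by the antipode axiom for the product.\<close>

lemma antipode_mult: "antipode H (x * y) = antipode H y * antipode H x"
proof -
  have bi: "biadditive_balanced (scale H) (\<lambda>a b. antipode H a * b)"
    by (simp add: bilin_simps)
  have "antipode H (x * y) = antipode H (x * y) * 1" by simp
  also have "\<dots> = (\<Sum>(a, b)\<in>#comult H x. (\<Sum>(a1, a2)\<in>#comult H a. antipode H (a1 * y) * a2) * antipode H b)"
    by (subst sum_antipode_right[where f = "\<lambda>z. antipode H (z * y)" and v = 1, symmetric])
      (simp_all add: bilin_simps sum_mset_distrib_right case_prod_unfold)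
  also have "\<dots> = (\<Sum>(a, b)\<in>#comult H x. (\<Sum>(a1, a2)\<in>#comult H a.
      \<Sum>(c, d)\<in>#comult H y. \<Sum>(c1, c2)\<in>#comult H c. antipode H (a1 * c1) * a2 * c2 * antipode H d) * antipode H b)"
    by (subst sum_antipode_right[where f = "\<lambda>z. antipode H (_ * z)"])
      (simp_all add: bilin_simps)
  also have "\<dots> = (\<Sum>(a, b)\<in>#comult H x. (\<Sum>(c, d)\<in>#comult H y. (\<Sum>(a1, a2)\<in>#comult H a.
       \<Sum>(c1, c2)\<in>#comult H c. antipode H (a1 * c1) * (a2 * c2)) * antipode H d) * antipode H b)"
    by (subst sum_mset_swap_pairs) (simp add: sum_mset_distrib_right case_prod_unfold multiset.map_comp comp_def mult.assoc)
  also have "\<dots> = (\<Sum>(a, b)\<in>#comult H x. (\<Sum>(c, d)\<in>#comult H y. scale H (counit H (a * c)) 1 * antipode H d) * antipode H b)"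
    by (simp add: comult_sum_mult[OF bi, symmetric] antipode_left)
  also have "\<dots> = antipode H (\<Sum>(c, d)\<in>#comult H y. scale H (counit H c) d) *
      antipode H (\<Sum>(a, b)\<in>#comult H x. scale H (counit H a) b)"
    by (simp add: antipode_sum_mset case_prod_unfold sum_mset_distrib_left sum_mset_distrib_right
        counit_mult antipode_scale scale_mult_left scale_mult_right multiset.map_comp comp_def mult.commute)
  finally show ?thesis by (simp add: counit_left)
qed

text \<open>The element t_1 \<otimes> S(t_2) satisfies h t_1 \<otimes> S(t_2) = t_1 \<otimes> S(t_2)
  h. The chain is h t_1 \<otimes> S(t_2) = h_1 t_1 \<otimes> S(t_2) S(h_2) h_3 = (h_1 t)_1 \<otimes>
  S((h_1 t)_2) h_2, and the integral property replaces h_1 t by \<epsilon>(h_1) t.\<close>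

lemma casimir:
  assumes t: "\<And>h. h * t = scale H (counit H h) t"
    and F: "biadditive_balanced (scale H) F"
  shows "(\<Sum>(a, b)\<in>#comult H t. F (h * a) (antipode H b)) = (\<Sum>(a, b)\<in>#comult H t. F a (antipode H b * h))"
proof -
  have Fadd: "F (x + y) z = F x z + F y z" "F x (y + z) = F x y + F x z" "F (scale H c x) y = F x (scale H c y)" for x y z c
    using F by (simp_all add: biadditive_balanced_def)
  have F0: "F 0 z = 0" "F z 0 = 0" for z
    using Fadd(1)[of 0 0 z] Fadd(2)[of z 0 0] by simp_all
  have Fsum: "F (\<Sum>x\<in>#M. g x) z = (\<Sum>x\<in>#M. F (g x) z)" "F z (\<Sum>x\<in>#M. g x) = (\<Sum>x\<in>#M. F z (g x))"
    for M :: "('h \<times> 'h) multiset" and g z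
    by (induction M) (auto simp: Fadd F0)
  have bi: "biadditive_balanced (scale H) (\<lambda>u v. F u (antipode H v * y))" for y
    by (simp add: bilin_simps Fadd)
  have tri: "triadditive_balanced (scale H) (\<lambda>u v w. F (u * a) (antipode H (v * b) * w))" for a b
    by (simp add: bilin_simps Fadd)
  have "(\<Sum>(a, b)\<in>#comult H t. F (h * a) (antipode H b)) =
    (\<Sum>(a, b)\<in>#comult H t. F ((\<Sum>(x, y)\<in>#comult H h. scale H (counit H y) x) * a) (antipode H b))"
    by (simp add: counit_right)
  also have "\<dots> = (\<Sum>(a, b)\<in>#comult H t. \<Sum>(x, y)\<in>#comult H h.
       F (x * a) (antipode H b * (\<Sum>(y1, y2)\<in>#comult H y. antipode H y1 * y2)))"
    by (simp only: antipode_left) (simp add: Fsum sum_mset_distrib_right case_prod_unfold scale_mult_left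
        scale_mult_right Fadd multiset.map_comp comp_def)
  also have "\<dots> = (\<Sum>(a, b)\<in>#comult H t. \<Sum>(x, y)\<in>#comult H h.
      \<Sum>(y1, y2)\<in>#comult H y. F (x * a) (antipode H (y1 * b) * y2))"
    by (simp add: Fsum sum_mset_distrib_left case_prod_unfold antipode_mult mult.assoc multiset.map_comp comp_def)
  also have "\<dots> = (\<Sum>(a, b)\<in>#comult H t. \<Sum>(x, y)\<in>#comult H h.
      \<Sum>(x1, x2)\<in>#comult H x. F (x1 * a) (antipode H (x2 * b) * y))"
    by (simp only: comult_sum_coassoc[OF tri])
  also have "\<dots> = (\<Sum>(x, y)\<in>#comult H h. \<Sum>(a, b)\<in>#comult H t.
      \<Sum>(x1, x2)\<in>#comult H x. F (x1 * a) (antipode H (x2 * b) * y))"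
    by (rule sum_mset_swap_pairs)
  also have "\<dots> = (\<Sum>(x, y)\<in>#comult H h. \<Sum>(x1, x2)\<in>#comult H x. \<Sum>(a, b)\<in>#comult H t.
      F (x1 * a) (antipode H (x2 * b) * y))"
    by (simp only: sum_mset_swap_pairs[of _ "comult H t"])
  also have "\<dots> = (\<Sum>(x, y)\<in>#comult H h. \<Sum>(a, b)\<in>#comult H (scale H (counit H x) t). F a (antipode H b * y))"
    by (simp only: comult_sum_mult[OF bi, symmetric] t)
  also have "\<dots> = (\<Sum>(x, y)\<in>#comult H h. \<Sum>(a, b)\<in>#comult H t. F a (antipode H b * scale H (counit H x) y))"
    by (simp only: comult_sum_scale[OF bi]) (simp add: Fadd scale_mult_left scale_mult_right)
  also have "\<dots> = (\<Sum>(a, b)\<in>#comult H t. \<Sum>(x, y)\<in>#comult H h. F a (antipode H b * scale H (counit H x) y))"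
    by (rule sum_mset_swap_pairs)
  also have "\<dots> = (\<Sum>(a, b)\<in>#comult H t. F a (antipode H b * (\<Sum>(x, y)\<in>#comult H h. scale H (counit H x) y)))"
    by (simp add: Fsum sum_mset_distrib_left case_prod_unfold multiset.map_comp comp_def)
  finally show ?thesis by (simp add: counit_left)
qed

text \<open>The left ideal to be complemented is the kernel of the counit, and t is the component of
  1 in the complement. Then h t - \<epsilon>(h) t lies in both ideals, hence vanishes. All further
  consequences of semisimplicity are drawn from such an integral.\<close>

lemma left_integral_exists:
  assumes "semisimple_algebra H"
  obtains t where "\<And>h. h * t = scale H (counit H h) t" "counit H t = 1"
proof -
  let ?I = "{x. counit H x = 0}"
  have "left_ideal H ?I"
    by (auto simp: left_ideal_def subspace_def counit_add counit_scale counit_mult)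
  then obtain J where J: "left_ideal H J" "?I \<inter> J = {0}" "?I + J = UNIV"
    using assms unfolding semisimple_algebra_def by blast
  then obtain a t where at: "counit H a = 0" "t \<in> J" "1 = a + t"
    by (metis (mono_tags, lifting) UNIV_I mem_Collect_eq set_plus_elim)
  have e: "counit H t = 1"
    using counit_one at by (metis add_0 counit_add)
  have sub: "subspace J" using J(1) by (simp add: left_ideal_def)
  have "h * t = scale H (counit H h) t" for h
  proof -
    have "h * t - scale H (counit H h) t \<in> J"
      using J(1) at(2) sub by (auto simp: left_ideal_def intro!: subspace_diff subspace_scale)
    moreover have "counit H (h * t - scale H (counit H h) t) = 0"
      using counit_add[of "h * t - scale H (counit H h) t" "scale H (counit H h) t"]
      by (simp add: counit_mult e counit_scale)
    ultimately have "h * t - scale H (counit H h) t \<in> {0}"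
      using J(2) by blast
    then show ?thesis by simp
  qed
  with e that show ?thesis by blast
qed

text \<open>The element \<open>\<Sum> t\<^sub>1 \<otimes> S(t\<^sub>2)\<close> is a separability idempotent, and separable algebras over a field
  are finite-dimensional.\<close>

lemma semisimple_finite_dimensional:
  assumes "semisimple_algebra H"
  obtains B where "finite B" "independent B" "span B = UNIV"
proof -
  obtain t where t: "\<And>h. h * t = scale H (counit H h) t" "counit H t = 1"
    using left_integral_exists[OF assms] by blast
  define E where "E = extend_basis {}"
  have E: "independent E" "span E = UNIV"
    unfolding E_def using independent_extend_basis[of "{}"] span_extend_basis[of "{}"] by (simp_all add: independent_empty)
  \<comment> \<open>The basis \<open>E\<close> may be infinite a priori, but only finitely many of
    its vectors occur in the first components of a fixed formal sum for the comultiplication of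
    t.\<close>
  define C where "C = (\<Union>(a, b)\<in>set_mset (comult H t). {c. representation E a c \<noteq> 0})"
  define D where "D = (\<lambda>(a, b). antipode H b) ` set_mset (comult H t)"
  have finC: "finite C" unfolding C_def by (auto intro: finite_representation)
  have finD: "finite D" unfolding D_def by auto
  have "h \<in> span {c * d |c d. c \<in> C \<and> d \<in> D}" for h
  proof -
    have "h = (\<Sum>(a, b)\<in>#comult H t. a * antipode H b) * h"
      by (simp add: antipode_right t(2))
    also have "\<dots> = (\<Sum>(a, b)\<in>#comult H t. (\<Sum>c\<in>C. scale H (representation E a c) c) * (antipode H b * h))"
    proof -
      have "(\<Sum>c\<in>C. scale H (representation E a c) c) = a" if "(a, b) \<in># comult H t" for a b
      proof -
        have "a = (\<Sum>c | representation E a c \<noteq> 0. scale H (representation E a c) c)"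
          using sum_nonzero_representation_eq[of E a] E by simp
        also have "\<dots> = (\<Sum>c\<in>C. scale H (representation E a c) c)"
          by (rule sum.mono_neutral_left) (use that finC in \<open>auto simp: C_def\<close>)
        finally show ?thesis by simp
      qed
      then have "image_mset (\<lambda>(a, b). a * (antipode H b * h)) (comult H t) =
        image_mset (\<lambda>(a, b). (\<Sum>c\<in>C. scale H (representation E a c) c) * (antipode H b * h)) (comult H t)"
        by (intro image_mset_cong) auto
      then show ?thesis
        by (simp add: sum_mset_distrib_right case_prod_unfold mult.assoc)
    qed
    also have "\<dots> = (\<Sum>c\<in>C. c * (\<Sum>(a, b)\<in>#comult H t. scale H (representation E a c) (antipode H b * h)))"
      by (simp add: sum_distrib_right sum_mset_distrib_left scale_mult_left scale_mult_right
          case_prod_unfold sum_mset_sum_swap multiset.map_comp comp_def)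
    \<comment> \<open>The Casimir property moves h out of the second leg into the scalar coefficient
      of c in h t_1. What remains are scalar multiples of the products c S(t_2), taken from a finite
      set independent of h.\<close>
    also have "\<dots> = (\<Sum>c\<in>C. c * (\<Sum>(a, b)\<in>#comult H t. scale H (representation E (h * a) c) (antipode H b)))"
    proof (rule sum.cong[OF HOL.refl], rule arg_cong2[where f = "(*)", OF HOL.refl])
      fix c
      have bi: "biadditive_balanced (scale H) (\<lambda>a b. scale H (representation E a c) b)"
        using E by (simp add: bilin_simps representation_add representation_scale)
      show "(\<Sum>(a, b)\<in>#comult H t. scale H (representation E a c) (antipode H b * h)) =
        (\<Sum>(a, b)\<in>#comult H t. scale H (representation E (h * a) c) (antipode H b))"
        using casimir[OF t(1) bi, of h] by simp
    qed
    also have "\<dots> = (\<Sum>c\<in>C. \<Sum>(a, b)\<in>#comult H t. scale H (representation E (h * a) c) (c * antipode H b))"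
      by (simp add: sum_mset_distrib_left case_prod_unfold scale_mult_right multiset.map_comp comp_def)
    finally have h: "h = (\<Sum>c\<in>C. \<Sum>(a, b)\<in>#comult H t. scale H (representation E (h * a) c) (c * antipode H b))" .
    have ss: "(\<Sum>x\<in>#M. f x) \<in> span S" if "\<And>x. x \<in># M \<Longrightarrow> f x \<in> span S" for M :: "('h \<times> 'h) multiset" and f S
      using that by (induction M) (auto intro: span_add span_zero)
    have "(\<Sum>c\<in>C. \<Sum>(a, b)\<in>#comult H t. scale H (representation E (h * a) c) (c * antipode H b))
        \<in> span {c * d |c d. c \<in> C \<and> d \<in> D}"
    proof (intro span_sum ss)
      fix c x assume "c \<in> C" "x \<in># comult H t"
      then have "c * antipode H (snd x) \<in> {c * d |c d. c \<in> C \<and> d \<in> D}"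
        unfolding D_def by (cases x) force
      then show "(case x of (a, b) \<Rightarrow> scale H (representation E (h * a) c) (c * antipode H b))
          \<in> span {c * d |c d. c \<in> C \<and> d \<in> D}"
        unfolding case_prod_unfold by (intro span_scale span_base)
    qed
    with h show ?thesis by (rule ssubst[of h _ "\<lambda>x. x \<in> span {c * d |c d. c \<in> C \<and> d \<in> D}"])
  qed
  then have sp: "span {c * d |c d. c \<in> C \<and> d \<in> D} = UNIV" by blast
  have fin: "finite {c * d |c d. c \<in> C \<and> d \<in> D}"
    using finite_image_set2[of "\<lambda>c. c \<in> C" "\<lambda>d. d \<in> D"] finC finD by simp
  obtain B where B: "B \<subseteq> {c * d |c d. c \<in> C \<and> d \<in> D}" "independent B" "{c * d |c d. c \<in> C \<and> d \<in> D} \<subseteq> span B"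
    using maximal_independent_subset by blast
  have "span B = UNIV"
    using span_mono[OF B(3)] unfolding span_span sp by (rule top.extremum_uniqueI)
  with B(2) finite_subset[OF B(1) fin] that show ?thesis by blast
qed

section \<open>Recognising equality in the tensor square\<close>

lemma teq_sum_mset:
  assumes "\<And>x. teq H (F x) (G x)"
  shows "teq H (\<Sum>x\<in>#M. F x) (\<Sum>x\<in>#M. G x)"
proof (induction M)
  case (add x M)
  show ?case using tensor_eq.cong[OF assms[of x] add.IH] by simp
qed (simp add: tensor_eq.refl)

lemma teq_sum_left:
  assumes "finite C"
  shows "teq H {#[\<Sum>c\<in>C. x c, b]#} (\<Sum>c\<in>#mset_set C. {#[x c, b]#})"
  using assms
proof induction
  case empty
  show ?case using tensor_eq.zero[of "scale H" "[]" "[b]"] by simp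
next
  case (insert c C)
  have "teq H {#[x c + (\<Sum>c\<in>C. x c), b]#} ({#[x c, b]#} + {#[\<Sum>c\<in>C. x c, b]#})"
    using tensor_eq.additive[of "scale H" "[]" "x c" "\<Sum>c\<in>C. x c" "[b]"] by (simp add: add_mset_commute)
  from tensor_eq.trans[OF this tensor_eq.cong[OF tensor_eq.refl insert.IH]] show ?case
    using insert.hyps by simp
qed

text \<open>A normal form for elements of the tensor square: one summand for each basis vector c in
  the first leg, the second leg collecting all coefficients of c.\<close>

lemma teq_expand:
  assumes B: "finite B" "independent B" "span B = UNIV"
  shows "teq H (pure2 M) (\<Sum>c\<in>#mset_set B. {#[c, \<Sum>(a, b)\<in>#M. scale H (representation B a c) b]#})"
proof (induction M)
  case empty
  have "teq H (\<Sum>c\<in>#mset_set B. {#}) (\<Sum>c\<in>#mset_set B. {#[c, 0]#})"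
    by (rule teq_sum_mset) (rule tensor_eq.sym[OF tensor_eq.zero[of "scale H" "[_]" "[]", simplified]])
  then show ?case by simp
next
  case (add x M)
  obtain a b where x: "x = (a, b)" by force
  let ?y = "\<lambda>c. \<Sum>(a, b)\<in>#M. scale H (representation B a c) b"
  have a: "(\<Sum>c\<in>B. scale H (representation B a c) c) = a"
    using sum_representation_eq[of B a B] B by simp
  have "teq H {#[a, b]#} (\<Sum>c\<in>#mset_set B. {#[scale H (representation B a c) c, b]#})"
    using teq_sum_left[OF B(1), of "\<lambda>c. scale H (representation B a c) c" b] a by simp
  moreover have "teq H (\<Sum>c\<in>#mset_set B. {#[scale H (representation B a c) c, b]#})
     (\<Sum>c\<in>#mset_set B. {#[c, scale H (representation B a c) b]#})"
    by (rule teq_sum_mset) (rule tensor_eq.balanced[of "scale H" "[]" _ _ "[]" b "[]", simplified])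
  ultimately have 1: "teq H {#[a, b]#} (\<Sum>c\<in>#mset_set B. {#[c, scale H (representation B a c) b]#})"
    by (rule tensor_eq.trans)
  have "teq H ({#[a, b]#} + pure2 M) (\<Sum>c\<in>#mset_set B. {#[c, scale H (representation B a c) b]#} + {#[c, ?y c]#})"
    unfolding sum_mset.distrib by (rule tensor_eq.cong[OF 1 add.IH])
  moreover have "teq H (\<Sum>c\<in>#mset_set B. {#[c, scale H (representation B a c) b]#} + {#[c, ?y c]#})
     (\<Sum>c\<in>#mset_set B. {#[c, scale H (representation B a c) b + ?y c]#})"
  proof (rule teq_sum_mset)
    fix c
    have "teq H ({#[c, scale H (representation B a c) b]#} + {#[c, ?y c]#}) {#[c, scale H (representation B a c) b + ?y c]#}"
      using tensor_eq.sym[OF tensor_eq.additive[of "scale H" "[c]" "scale H (representation B a c) b" "?y c" "[]"]]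
      by (simp add: add_mset_commute)
    then show "teq H ({#[c, scale H (representation B a c) b]#} + {#[c, ?y c]#}) {#[c, scale H (representation B a c) b + ?y c]#}" .
  qed
  ultimately have "teq H ({#[a, b]#} + pure2 M) (\<Sum>c\<in>#mset_set B. {#[c, scale H (representation B a c) b + ?y c]#})"
    by (rule tensor_eq.trans)
  then show ?case by (simp add: x)
qed

text \<open>Products of linear forms separate the tensor square. The coordinate functions of the
  basis are linear forms, so the hypothesis makes the second legs of the two normal forms of
  \<open>teq_expand\<close> agree coordinate by coordinate.\<close>

lemma teq_pure2I:
  assumes B: "finite B" "independent B" "span B = UNIV"
    and eq: "\<And>f g. Vector_Spaces.linear (scale H) (*) f \<Longrightarrow> Vector_Spaces.linear (scale H) (*) g \<Longrightarrow>
      (\<Sum>(a, b)\<in>#M. f a * g b) = (\<Sum>(a, b)\<in>#N. f a * g b)"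
  shows "teq H (pure2 M) (pure2 N)"
proof -
  have lin: "Vector_Spaces.linear (scale H) (*) (\<lambda>x. representation B x c)" for c
    unfolding Vector_Spaces.linear_iff
  proof (intro conjI allI)
    show "vector_space (scale H)" by (rule vector_space_axioms)
    show "vector_space ((*) :: 'k \<Rightarrow> 'k \<Rightarrow> 'k)" by unfold_locales (simp_all add: algebra_simps)
  qed (use B in \<open>simp_all add: representation_add representation_scale\<close>)
  have rs: "representation B (\<Sum>(a, b)\<in>#M. scale H (f a) b) d = (\<Sum>(a, b)\<in>#M. f a * representation B b d)" for M f d
  proof (induction M)
    case empty
    then show ?case using B by (simp add: representation_zero)
  next
    case (add x M)
    then show ?case using B by (cases x) (simp add: representation_add representation_scale)
  qed
  have "(\<Sum>(a, b)\<in>#M. scale H (representation B a c) b) = (\<Sum>(a, b)\<in>#N. scale H (representation B a c) b)" for c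
  proof -
    have "representation B (\<Sum>(a, b)\<in>#M. scale H (representation B a c) b) = representation B (\<Sum>(a, b)\<in>#N. scale H (representation B a c) b)"
      by (rule ext) (simp add: rs eq[OF lin lin])
    then have "(\<Sum>d\<in>B. scale H (representation B (\<Sum>(a, b)\<in>#M. scale H (representation B a c) b) d) d) =
        (\<Sum>d\<in>B. scale H (representation B (\<Sum>(a, b)\<in>#N. scale H (representation B a c) b) d) d)"
      by (simp only:)
    moreover have "(\<Sum>d\<in>B. scale H (representation B v d) d) = v" for v
      using sum_representation_eq[of B v B] B by simp
    ultimately show ?thesis by (simp only:)
  qed
  then have "teq H (pure2 M) (\<Sum>c\<in>#mset_set B. {#[c, \<Sum>(a, b)\<in>#N. scale H (representation B a c) b]#})"
    using teq_expand[OF B, of M] by simp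
  from tensor_eq.trans[OF this tensor_eq.sym[OF teq_expand[OF B, of N]]] show ?thesis .
qed

end

section \<open>Matrices\<close>

text \<open>Partitions into rows only or columns only are four-block matrices with empty blocks.
  This lemma lets an unpartitioned matrix take part in block multiplication.\<close>

lemma four_block_mat_trivial:
  assumes "A \<in> carrier_mat n r"
  shows "four_block_mat A (0\<^sub>m n 0) (0\<^sub>m 0 r) (0\<^sub>m 0 0) = A"
  using assms by (intro eq_matI) auto

lemma mult_right_blocks:
  fixes A :: "'a::comm_ring_1 mat"
  assumes "A \<in> carrier_mat k n" "B \<in> carrier_mat n r" "C \<in> carrier_mat n s"
  shows "A * four_block_mat B C (0\<^sub>m 0 r) (0\<^sub>m 0 s) = four_block_mat (A * B) (A * C) (0\<^sub>m 0 r) (0\<^sub>m 0 s)"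
proof -
  have "four_block_mat A (0\<^sub>m k 0) (0\<^sub>m 0 n) (0\<^sub>m 0 0) * four_block_mat B C (0\<^sub>m 0 r) (0\<^sub>m 0 s) =
    four_block_mat (A * B) (A * C) (0\<^sub>m 0 r) (0\<^sub>m 0 s)"
    using assms by (subst mult_four_block_mat[where ?nr1.0 = k and ?n1.0 = n and ?n2.0 = 0 and ?nr2.0 = 0 and ?nc1.0 = r and ?nc2.0 = s])
      (auto intro!: cong_four_block_mat)
  then show ?thesis using four_block_mat_trivial[OF assms(1)] by simp
qed

lemma mult_left_blocks:
  fixes A :: "'a::comm_ring_1 mat"
  assumes "A \<in> carrier_mat n k" "B \<in> carrier_mat r n" "C \<in> carrier_mat s n"
  shows "four_block_mat B (0\<^sub>m r 0) C (0\<^sub>m s 0) * A = four_block_mat (B * A) (0\<^sub>m r 0) (C * A) (0\<^sub>m s 0)"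
proof -
  have "four_block_mat B (0\<^sub>m r 0) C (0\<^sub>m s 0) * four_block_mat A (0\<^sub>m n 0) (0\<^sub>m 0 k) (0\<^sub>m 0 0) =
    four_block_mat (B * A) (0\<^sub>m r 0) (C * A) (0\<^sub>m s 0)"
    using assms by (subst mult_four_block_mat[where ?nr1.0 = r and ?n1.0 = n and ?n2.0 = 0 and ?nr2.0 = s and ?nc1.0 = k and ?nc2.0 = 0])
      (auto intro!: cong_four_block_mat)
  then show ?thesis using four_block_mat_trivial[OF assms(1)] by simp
qed

lemma mult_row_col_blocks:
  fixes A :: "'a::comm_ring_1 mat"
  assumes "A \<in> carrier_mat n r" "B \<in> carrier_mat n s" "C \<in> carrier_mat r k" "D \<in> carrier_mat s k"
  shows "four_block_mat A B (0\<^sub>m 0 r) (0\<^sub>m 0 s) * four_block_mat C (0\<^sub>m r 0) D (0\<^sub>m s 0) = A * C + B * D"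
  using assms four_block_mat_trivial[of "A * C + B * D" n k]
  by (subst mult_four_block_mat[where ?nr1.0 = n and ?n1.0 = r and ?n2.0 = s and ?nr2.0 = 0 and ?nc1.0 = k and ?nc2.0 = 0])
    auto

lemma mult_col_row_blocks:
  fixes A :: "'a::comm_ring_1 mat"
  assumes "A \<in> carrier_mat n r" "B \<in> carrier_mat n s" "C \<in> carrier_mat k n" "D \<in> carrier_mat l n"
  shows "four_block_mat C (0\<^sub>m k 0) D (0\<^sub>m l 0) * four_block_mat A B (0\<^sub>m 0 r) (0\<^sub>m 0 s) =
    four_block_mat (C * A) (C * B) (D * A) (D * B)"
  using assms
  by (subst mult_four_block_mat[where ?nr1.0 = k and ?n1.0 = n and ?n2.0 = 0 and ?nr2.0 = l and ?nc1.0 = r and ?nc2.0 = s])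
    (auto intro!: cong_four_block_mat)

lemma mult_row_blocks:
  fixes A :: "'a::comm_ring_1 mat"
  assumes "A \<in> carrier_mat n r" "B \<in> carrier_mat n s" "C \<in> carrier_mat r k" "D \<in> carrier_mat s k"
    "E \<in> carrier_mat r l" "F \<in> carrier_mat s l"
  shows "four_block_mat A B (0\<^sub>m 0 r) (0\<^sub>m 0 s) * four_block_mat C E D F =
    four_block_mat (A * C + B * D) (A * E + B * F) (0\<^sub>m 0 k) (0\<^sub>m 0 l)"
  using assms
  by (subst mult_four_block_mat[where ?nr1.0 = n and ?n1.0 = r and ?n2.0 = s and ?nr2.0 = 0 and ?nc1.0 = k and ?nc2.0 = l])
    (auto intro!: cong_four_block_mat)

text \<open>Column elimination: the columns of \<open>A\<close> form a basis of the column space of \<open>M\<close>, and \<open>A B\<close> is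
  a projection onto it.\<close>

lemma column_space_basis:
  fixes M :: "'a::field mat"
  assumes "M \<in> carrier_mat n m"
  obtains r A B C where "A \<in> carrier_mat n r" "B \<in> carrier_mat r n" "C \<in> carrier_mat m r"
    "B * A = 1\<^sub>m r" "A * (B * M) = M" "A = M * C"
proof -
  have "\<exists>r A B C. A \<in> carrier_mat n r \<and> B \<in> carrier_mat r n \<and> C \<in> carrier_mat m r \<and>
    B * A = 1\<^sub>m r \<and> A * (B * M) = M \<and> A = M * C"
    using assms
  proof (induction m arbitrary: M)
    case 0
    show ?case
      by (rule exI[of _ 0], rule exI[of _ "0\<^sub>m n 0"], rule exI[of _ "0\<^sub>m 0 n"], rule exI[of _ "0\<^sub>m 0 0"])
        (use 0 in \<open>auto intro!: eq_matI\<close>)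
  next
    case (Suc m)
    define M0 where "M0 = mat n m (\<lambda>(i, j). M $$ (i, j))"
    define v where "v = mat n 1 (\<lambda>(i, j). M $$ (i, m))"
    have M0: "M0 \<in> carrier_mat n m" and v: "v \<in> carrier_mat n 1" by (auto simp: M0_def v_def)
    have M: "M = four_block_mat M0 v (0\<^sub>m 0 m) (0\<^sub>m 0 1)"
      using Suc.prems by (intro eq_matI) (auto simp: M0_def v_def less_Suc_eq)
    obtain r A B C where A: "A \<in> carrier_mat n r" and B: "B \<in> carrier_mat r n" and C: "C \<in> carrier_mat m r"
      and BA: "B * A = 1\<^sub>m r" and ABM: "A * (B * M0) = M0" and AC: "A = M0 * C"
      using Suc.IH[OF M0] by blast
    \<comment> \<open>The residue of the last column \<open>v\<close> after projection onto the
      column space already found. If it is zero the old data are kept; otherwise it becomes a new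
      basis column.\<close>
    define w where "w = v - A * (B * v)"
    have w: "w \<in> carrier_mat n 1"
      unfolding w_def by (rule minus_carrier_mat, rule mult_carrier_mat[OF A mult_carrier_mat[OF B v]])
    have vw: "v = w + A * (B * v)" using A B v by (intro eq_matI) (auto simp: w_def)
    have Bw: "B * w = 0\<^sub>m r 1"
    proof -
      have "B * w = B * v - B * (A * (B * v))" unfolding w_def using A B v by (simp add: mult_minus_distrib_mat[of _ r n _ 1])
      also have "B * (A * (B * v)) = B * v"
        using assoc_mult_mat[OF B A, of "B * v" 1] A B v BA by simp
      finally show ?thesis using B v by simp
    qed
    show ?case
    proof (cases "w = 0\<^sub>m n 1")
      case True
      then have v': "A * (B * v) = v" using vw v A B by (metis left_add_zero_mat mult_carrier_mat)
      let ?C = "four_block_mat C (0\<^sub>m m 0) (0\<^sub>m 1 r) (0\<^sub>m 1 0)"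
      have "M * ?C = A"
        unfolding M using A B C v M0 AC by (subst mult_row_col_blocks) auto
      moreover have "A * (B * M) = M"
        unfolding M mult_right_blocks[OF B M0 v]
          mult_right_blocks[OF A mult_carrier_mat[OF B M0] mult_carrier_mat[OF B v]] ABM v' ..
      moreover have "?C \<in> carrier_mat (Suc m) r" using C by auto
      ultimately show ?thesis using A B BA by metis
    next
      case False
      then obtain i where i: "i < n" "w $$ (i, 0) \<noteq> 0"
        using w by (metis (no_types, lifting) carrier_matD eq_matI index_zero_mat less_one)
      \<comment> \<open>A row that reads off one nonzero coordinate of \<open>w\<close>, normalised
        to give 1 on \<open>w\<close>. It need not vanish on the columns of \<open>A\<close>;
        subtracting \<open>b0 * A * B\<close> repairs this and keeps the value on \<open>w\<close>
        because \<open>B * w\<close> is zero.\<close>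
      define b0 where "b0 = mat 1 n (\<lambda>(_, j). if j = i then 1 / w $$ (i, 0) else 0)"
      have b0: "b0 \<in> carrier_mat 1 n" by (simp add: b0_def)
      have b0w: "b0 * w = 1\<^sub>m 1"
      proof (rule eq_matI)
        fix p q assume "p < dim_row (1\<^sub>m 1 :: 'a mat)" "q < dim_col (1\<^sub>m 1 :: 'a mat)"
        then have pq: "p = 0" "q = 0" by auto
        have "(b0 * w) $$ (0, 0) = (\<Sum>j\<in>{0..<n}. (if j = i then 1 / w $$ (i, 0) else 0) * w $$ (j, 0))"
          using w by (simp add: b0_def scalar_prod_def)
        also have "\<dots> = (\<Sum>j\<in>{0..<n}. if j = i then 1 else 0)"
          by (rule sum.cong) (use i in auto)
        also have "\<dots> = 1" using i by simp
        finally show "(b0 * w) $$ (p, q) = 1\<^sub>m 1 $$ (p, q)" by (simp add: pq)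
      qed (use b0 w in auto)
      define b where "b = b0 - b0 * A * B"
      have b: "b \<in> carrier_mat 1 n"
        unfolding b_def by (rule minus_carrier_mat, rule mult_carrier_mat[OF mult_carrier_mat[OF b0 A] B])
      have bA: "b * A = 0\<^sub>m 1 r"
      proof -
        have "b * A = b0 * A - b0 * A * B * A" unfolding b_def using b0 A B by (simp add: minus_mult_distrib_mat[of _ 1 n _ _ r])
        also have "b0 * A * B * A = b0 * A"
          using assoc_mult_mat[of "b0 * A" 1 r B n A r] b0 A B BA by simp
        finally show ?thesis using b0 A by simp
      qed
      have bw: "b * w = 1\<^sub>m 1"
      proof -
        have "b * w = b0 * w - b0 * A * B * w" unfolding b_def using b0 A B w by (simp add: minus_mult_distrib_mat[of _ 1 n _ _ 1])
        also have "b0 * A * B * w = 0\<^sub>m 1 1"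
          using assoc_mult_mat[of "b0 * A" 1 r B n w 1] b0 A B w Bw by simp
        finally show ?thesis using b0w by (intro eq_matI) auto
      qed
      have bM: "b * M0 = 0\<^sub>m 1 m"
      proof -
        have "b * M0 = b * (A * (B * M0))" by (simp add: ABM)
        also have "\<dots> = b * A * (B * M0)" using assoc_mult_mat[OF b A, of "B * M0" m] B M0 by simp
        finally show ?thesis using bA B M0 by simp
      qed
      have bv: "b * v = 1\<^sub>m 1"
      proof -
        have "b * v = b * w + b * (A * (B * v))" using b w A B v by (subst vw) (simp add: mult_add_distrib_mat[of _ 1 n _ 1])
        also have "b * (A * (B * v)) = 0\<^sub>m 1 1" using assoc_mult_mat[OF b A, of "B * v" 1] bA B v by simp
        finally show ?thesis using bw by simp
      qed
      let ?A = "four_block_mat A w (0\<^sub>m 0 r) (0\<^sub>m 0 1)"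
      let ?B = "four_block_mat B (0\<^sub>m r 0) b (0\<^sub>m 1 0)"
      \<comment> \<open>The last column of this matrix expresses \<open>w\<close> through the
        columns of the original matrix: \<open>w\<close> is \<open>v\<close> minus
        \<open>M0 * (C * (B * v))\<close>, as \<open>A = M0 * C\<close>.\<close>
      let ?C = "four_block_mat C (- (C * (B * v))) (0\<^sub>m 1 r) (1\<^sub>m 1)"
      have A': "?A \<in> carrier_mat n (Suc r)" and B': "?B \<in> carrier_mat (Suc r) n" and C': "?C \<in> carrier_mat (Suc m) (Suc r)"
        using A B C b w by auto
      have "?B * ?A = four_block_mat (1\<^sub>m r) (0\<^sub>m r 1) (0\<^sub>m 1 r) (1\<^sub>m 1)"
        using A B b w by (subst mult_col_row_blocks[of _ n]) (auto simp: BA Bw bA bw)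
      also have "\<dots> = 1\<^sub>m (Suc r)" by (intro eq_matI) auto
      finally have BA': "?B * ?A = 1\<^sub>m (Suc r)" .
      have "?A * (?B * M) = ?A * ?B * M"
        using assoc_mult_mat[OF A' B' Suc.prems] by simp
      also have "?A * ?B = A * B + w * b" using A B b w by (simp add: mult_row_col_blocks)
      also have "(A * B + w * b) * M = four_block_mat ((A * B + w * b) * M0) ((A * B + w * b) * v) (0\<^sub>m 0 m) (0\<^sub>m 0 1)"
        unfolding M using A B b w M0 v by (intro mult_right_blocks) auto
      also have "(A * B + w * b) * M0 = M0"
        using A B b w M0 assoc_mult_mat[OF A B M0] assoc_mult_mat[OF w b M0] ABM bM
        by (simp add: add_mult_distrib_mat[of _ n n _ _ m])
      also have "(A * B + w * b) * v = v"
        using A B b w v assoc_mult_mat[OF A B v] assoc_mult_mat[OF w b v] bv vw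
        by (simp add: add_mult_distrib_mat[of _ n n _ _ 1] comm_add_mat[of _ n 1])
      finally have ABM': "?A * (?B * M) = M" using M by simp
      have "M0 * (- (C * (B * v))) + v * 1\<^sub>m 1 = w"
      proof -
        have "M0 * (- (C * (B * v))) = - (M0 * (C * (B * v)))" using M0 C B v by simp
        also have "M0 * (C * (B * v)) = A * (B * v)"
          unfolding AC using assoc_mult_mat[OF M0 C, of "B * v" 1] B v by simp
        finally show ?thesis using A B v by (intro eq_matI) (auto simp: w_def)
      qed
      moreover have "M * ?C = four_block_mat (M0 * C + v * 0\<^sub>m 1 r) (M0 * (- (C * (B * v))) + v * 1\<^sub>m 1) (0\<^sub>m 0 r) (0\<^sub>m 0 1)"
        unfolding M using M0 v C B by (intro mult_row_blocks) auto
      ultimately have "?A = M * ?C" using v AC A M0 C by simp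
      with A' B' C' BA' ABM' show ?thesis by blast
    qed
  qed
  then show ?thesis using that by blast
qed

text \<open>The columns of \<open>A\<close> span the image of E, which E fixes, so E A = A.
  Replacing the projection \<open>B\<close> by \<open>B * E\<close> keeps it a left inverse of
  \<open>A\<close> and makes the product in the other order equal to E.\<close>

lemma idempotent_splitting:
  fixes E :: "'a::field mat"
  assumes E: "E \<in> carrier_mat n n" "E * E = E"
  obtains r A B where "A \<in> carrier_mat n r" "B \<in> carrier_mat r n" "B * A = 1\<^sub>m r" "A * B = E"
proof -
  obtain r A B C where A: "A \<in> carrier_mat n r" and B: "B \<in> carrier_mat r n" and C: "C \<in> carrier_mat n r"
    and BA: "B * A = 1\<^sub>m r" and ABE: "A * (B * E) = E" and AC: "A = E * C"
    by (rule column_space_basis[OF E(1)])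
  have EA: "E * A = A" unfolding AC using E C by (metis assoc_mult_mat)
  have "B * E * A = 1\<^sub>m r" using assoc_mult_mat[OF B E(1) A] EA BA by simp
  with A B E(1) ABE that[of A r "B * E"] show ?thesis by auto
qed

text \<open>Column elimination gives P with T P T = T; injectivity then cancels T on the left,
  column by column.\<close>

lemma injective_left_inverse:
  fixes T :: "'a::field mat"
  assumes T: "T \<in> carrier_mat n m" and inj: "\<And>v. v \<in> carrier_vec m \<Longrightarrow> T *\<^sub>v v = 0\<^sub>v n \<Longrightarrow> v = 0\<^sub>v m"
  obtains P where "P \<in> carrier_mat m n" "P * T = 1\<^sub>m m"
proof -
  obtain r A B C where A: "A \<in> carrier_mat n r" and B: "B \<in> carrier_mat r n" and C: "C \<in> carrier_mat m r"
    and BA: "B * A = 1\<^sub>m r" and ABT: "A * (B * T) = T" and AC: "A = T * C"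
    by (rule column_space_basis[OF T])
  let ?P = "C * B"
  have P: "?P \<in> carrier_mat m n" using C B by simp
  have TPT: "T * (?P * T) = T"
    using ABT assoc_mult_mat[OF C B T] assoc_mult_mat[OF T C, of "B * T" m] B T AC by simp
  have "?P * T = 1\<^sub>m m"
  proof (rule mat_col_eqI)
    fix j assume "j < dim_col (1\<^sub>m m :: 'a mat)"
    then have j: "j < m" by simp
    have "T *\<^sub>v (col (?P * T) j - unit_vec m j) = T *\<^sub>v col (?P * T) j - T *\<^sub>v unit_vec m j"
      by (rule mult_minus_distrib_mat_vec[OF T]) (use P T j in auto)
    also have "T *\<^sub>v col (?P * T) j = col T j"
      using TPT P T j by (metis col_mult2 mult_carrier_mat)
    also have "T *\<^sub>v unit_vec m j = col T j"
      using T j by (metis col_mult2 col_one one_carrier_mat right_mult_one_mat)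
    finally have "T *\<^sub>v (col (?P * T) j - unit_vec m j) = 0\<^sub>v n" using T by (intro eq_vecI) auto
    then have z: "col (?P * T) j - unit_vec m j = 0\<^sub>v m" using P T j by (intro inj) auto
    have "col (?P * T) j = unit_vec m j"
    proof (rule eq_vecI)
      fix i assume "i < dim_vec (unit_vec m j :: 'a vec)"
      then have "i < m" by simp
      with z have "(col (?P * T) j - unit_vec m j) $ i = 0" by simp
      then show "col (?P * T) j $ i = unit_vec m j $ i" using \<open>i < m\<close> by simp
    qed (use P in auto)
    then show "col (?P * T) j = col (1\<^sub>m m) j" using j by simp
  qed (use P T in auto)
  with P that show ?thesis by blast
qed

section \<open>Traces, sums of matrices and pair indices\<close>

definition mat_trace :: "'a::comm_monoid_add mat \<Rightarrow> 'a" where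
  "mat_trace A = (\<Sum>i<dim_row A. A $$ (i, i))"

lemma mat_trace_mult_commute:
  fixes A :: "'a::comm_semiring_0 mat"
  assumes "A \<in> carrier_mat n m" "B \<in> carrier_mat m n"
  shows "mat_trace (A * B) = mat_trace (B * A)"
proof -
  have "mat_trace (A * B) = (\<Sum>i<n. \<Sum>j<m. A $$ (i, j) * B $$ (j, i))"
    using assms by (auto simp: mat_trace_def scalar_prod_def atLeast0LessThan intro!: sum.cong)
  also have "\<dots> = (\<Sum>j<m. \<Sum>i<n. A $$ (i, j) * B $$ (j, i))" by (rule sum.swap)
  also have "\<dots> = mat_trace (B * A)"
    using assms by (auto simp: mat_trace_def scalar_prod_def atLeast0LessThan mult.commute intro!: sum.cong)
  finally show ?thesis .
qed

lemma mat_trace_add: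
  "A \<in> carrier_mat n n \<Longrightarrow> B \<in> carrier_mat n n \<Longrightarrow> mat_trace (A + B) = mat_trace A + mat_trace B"
  by (simp add: mat_trace_def sum.distrib)

lemma mat_trace_one [simp]: "mat_trace (1\<^sub>m n :: 'a::semiring_1 mat) = of_nat n"
  by (simp add: mat_trace_def)

lemma mat_trace_zero [simp]: "mat_trace (0\<^sub>m n m :: 'a::comm_monoid_add mat) = 0" if "n \<le> m"
  using that by (simp add: mat_trace_def)

lemma mult_entry:
  "A \<in> carrier_mat n m \<Longrightarrow> B \<in> carrier_mat m k \<Longrightarrow> i < n \<Longrightarrow> j < k \<Longrightarrow>
    (A * B) $$ (i, j) = (\<Sum>l<m. A $$ (i, l) * B $$ (l, j))"
  by (auto simp: scalar_prod_def atLeast0LessThan)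

text \<open>Matrices of all sizes share one type and have no common zero, so the size of the sum is
  a parameter and the empty sum is the zero matrix of that size.\<close>

definition mat_sum :: "nat \<Rightarrow> nat \<Rightarrow> ('b \<Rightarrow> 'a::comm_monoid_add mat) \<Rightarrow> 'b multiset \<Rightarrow> 'a mat" where
  "mat_sum n m f M = mat n m (\<lambda>(i, j). \<Sum>x\<in>#M. f x $$ (i, j))"

lemma mat_sum_carrier [simp]: "mat_sum n m f M \<in> carrier_mat n m"
  "dim_row (mat_sum n m f M) = n" "dim_col (mat_sum n m f M) = m"
  by (simp_all add: mat_sum_def)

lemma mat_sum_index [simp]: "i < n \<Longrightarrow> j < m \<Longrightarrow> mat_sum n m f M $$ (i, j) = (\<Sum>x\<in>#M. f x $$ (i, j))"
  by (simp add: mat_sum_def)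

lemma mult_mat_sum:
  fixes G :: "'a::comm_semiring_0 mat"
  assumes G: "G \<in> carrier_mat k n" and f: "\<And>x. x \<in># M \<Longrightarrow> f x \<in> carrier_mat n m"
  shows "G * mat_sum n m f M = mat_sum k m (\<lambda>x. G * f x) M"
proof (rule eq_matI)
  fix i j assume "i < dim_row (mat_sum k m (\<lambda>x. G * f x) M)" "j < dim_col (mat_sum k m (\<lambda>x. G * f x) M)"
  then have ij: "i < k" "j < m" by auto
  have "(G * mat_sum n m f M) $$ (i, j) = (\<Sum>l<n. G $$ (i, l) * (\<Sum>x\<in>#M. f x $$ (l, j)))"
    using ij by (subst mult_entry[OF G mat_sum_carrier(1)]) auto
  also have "\<dots> = (\<Sum>x\<in>#M. \<Sum>l<n. G $$ (i, l) * f x $$ (l, j))"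
    by (simp add: sum_mset_distrib_left sum_mset_sum_swap multiset.map_comp comp_def)
  also have "image_mset (\<lambda>x. \<Sum>l<n. G $$ (i, l) * f x $$ (l, j)) M = image_mset (\<lambda>x. (G * f x) $$ (i, j)) M"
    by (rule image_mset_cong) (simp only: mult_entry[OF G f ij])
  finally show "(G * mat_sum n m f M) $$ (i, j) = mat_sum k m (\<lambda>x. G * f x) M $$ (i, j)"
    using ij by simp
qed (use G in auto)

lemma mat_sum_mult:
  fixes G :: "'a::comm_semiring_0 mat"
  assumes G: "G \<in> carrier_mat m k" and f: "\<And>x. x \<in># M \<Longrightarrow> f x \<in> carrier_mat n m"
  shows "mat_sum n m f M * G = mat_sum n k (\<lambda>x. f x * G) M"
proof (rule eq_matI)
  fix i j assume "i < dim_row (mat_sum n k (\<lambda>x. f x * G) M)" "j < dim_col (mat_sum n k (\<lambda>x. f x * G) M)"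
  then have ij: "i < n" "j < k" by auto
  have "(mat_sum n m f M * G) $$ (i, j) = (\<Sum>l<m. (\<Sum>x\<in>#M. f x $$ (i, l)) * G $$ (l, j))"
    using ij by (subst mult_entry[OF mat_sum_carrier(1) G]) auto
  also have "\<dots> = (\<Sum>x\<in>#M. \<Sum>l<m. f x $$ (i, l) * G $$ (l, j))"
    by (simp add: sum_mset_distrib_right sum_mset_sum_swap multiset.map_comp comp_def)
  also have "image_mset (\<lambda>x. \<Sum>l<m. f x $$ (i, l) * G $$ (l, j)) M = image_mset (\<lambda>x. (f x * G) $$ (i, j)) M"
    by (rule image_mset_cong) (simp only: mult_entry[OF f G ij])
  finally show "(mat_sum n m f M * G) $$ (i, j) = mat_sum n k (\<lambda>x. f x * G) M $$ (i, j)"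
    using ij by simp
qed (use G in auto)

lemma mat_sum_cong:
  "(\<And>x. x \<in># M \<Longrightarrow> f x = g x) \<Longrightarrow> mat_sum n m f M = mat_sum n m g M"
  unfolding mat_sum_def by (metis (no_types, lifting) image_mset_cong)

lemma mat_trace_mat_sum:
  assumes "\<And>x. x \<in># M \<Longrightarrow> f x \<in> carrier_mat n n"
  shows "mat_trace (mat_sum n n f M) = (\<Sum>x\<in>#M. mat_trace (f x))"
proof -
  have "mat_trace (mat_sum n n f M) = (\<Sum>x\<in>#M. \<Sum>i<n. f x $$ (i, i))"
    by (simp add: mat_trace_def sum_mset_sum_swap)
  also have "image_mset (\<lambda>x. \<Sum>i<n. f x $$ (i, i)) M = image_mset (\<lambda>x. mat_trace (f x)) M"
    by (rule image_mset_cong) (use assms in \<open>auto simp: mat_trace_def\<close>)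
  finally show ?thesis .
qed

lemma sum_div_mod:
  fixes f :: "nat \<Rightarrow> nat \<Rightarrow> 'a::comm_monoid_add"
  shows "(\<Sum>r<m * n. f (r div n) (r mod n)) = (\<Sum>i<m. \<Sum>j<n. f i j)"
proof -
  have "(\<Sum>r<m * n. f (r div n) (r mod n)) = (\<Sum>i<m. \<Sum>r\<in>{i * n..<i * n + n}. f (r div n) (r mod n))"
    by (rule sum.nat_group[symmetric])
  also have "\<dots> = (\<Sum>i<m. \<Sum>j<n. f i j)"
  proof (rule sum.cong[OF HOL.refl])
    fix i
    have "(\<Sum>r\<in>{i * n..<i * n + n}. f (r div n) (r mod n)) = (\<Sum>j\<in>{0..<n}. f ((j + i * n) div n) ((j + i * n) mod n))"
      using sum.shift_bounds_nat_ivl[of "\<lambda>r. f (r div n) (r mod n)" 0 "i * n" n] by (simp add: add.commute)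
    also have "\<dots> = (\<Sum>j<n. f i j)"
      by (rule sum.cong) auto
    finally show "(\<Sum>r\<in>{i * n..<i * n + n}. f (r div n) (r mod n)) = (\<Sum>j<n. f i j)" .
  qed
  finally show ?thesis .
qed

lemma div_mod_less: "(r::nat) < m * n \<Longrightarrow> r div n < m" "(r::nat) < m * n \<Longrightarrow> r mod n < n"
  by (auto simp: less_mult_imp_div_less) (cases n; simp)

lemma pair_index_less: "(i::nat) < m \<Longrightarrow> j < n \<Longrightarrow> i * n + j < m * n"
  using mult_le_mono1[of "Suc i" m n] by simp

section \<open>Complete reducibility\<close>

lemma mult_mat_zero_vec [simp]: "A \<in> carrier_mat n m \<Longrightarrow> A *\<^sub>v 0\<^sub>v m = 0\<^sub>v n"
  by (intro eq_vecI) auto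

text \<open>Dimensions are compared by taking traces, which is faithful in characteristic \<open>0\<close>.\<close>

lemma complementary_splitting:
  fixes T :: "'a::field_char_0 mat"
  assumes T: "T \<in> carrier_mat n m" and P: "P \<in> carrier_mat m n" and PT: "P * T = 1\<^sub>m m"
  obtains r A B where "A \<in> carrier_mat n r" "B \<in> carrier_mat r n" "B * A = 1\<^sub>m r"
    "A * B = 1\<^sub>m n - T * P" "n = m + r"
proof -
  let ?E = "1\<^sub>m n - T * P"
  have TP: "T * P \<in> carrier_mat n n" using T P by simp
  have E: "?E \<in> carrier_mat n n" using TP by (rule minus_carrier_mat)
  have TPTP: "T * P * (T * P) = T * P"
    using assoc_mult_mat[OF T P TP] assoc_mult_mat[OF P T P] PT P by simp
  have "?E * ?E = ?E * 1\<^sub>m n - ?E * (T * P)"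
    by (rule mult_minus_distrib_mat[OF E _ TP]) simp
  also have "?E * (T * P) = 1\<^sub>m n * (T * P) - T * P * (T * P)"
    by (rule minus_mult_distrib_mat[OF _ TP TP]) simp
  also have "\<dots> = 0\<^sub>m n n" unfolding TPTP left_mult_one_mat[OF TP] using TP by (intro eq_matI) auto
  also have "?E * 1\<^sub>m n - 0\<^sub>m n n = ?E" unfolding right_mult_one_mat[OF E] using E T P by (intro eq_matI) auto
  finally obtain r A B where A: "A \<in> carrier_mat n r" "B \<in> carrier_mat r n" "B * A = 1\<^sub>m r" "A * B = ?E"
    by (rule idempotent_splitting[OF E])
  have "(of_nat n :: 'a) = mat_trace (T * P + ?E)"
  proof -
    have "T * P + ?E = 1\<^sub>m n" using T P by (intro eq_matI) auto
    then show ?thesis by simp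
  qed
  also have "\<dots> = mat_trace (T * P) + mat_trace ?E" using TP E by (rule mat_trace_add)
  also have "mat_trace (T * P) = of_nat m" using mat_trace_mult_commute[OF T P] PT by simp
  also have "mat_trace ?E = of_nat r" using mat_trace_mult_commute[OF A(1,2)] A(3,4) by simp
  finally have "n = m + r" by (metis of_nat_add of_nat_eq_iff)
  with A that show ?thesis by blast
qed

lemma left_inverse_dim:
  fixes T :: "'a::field_char_0 mat"
  assumes "T \<in> carrier_mat n m" "P \<in> carrier_mat m n" "P * T = 1\<^sub>m m"
  shows "m \<le> n"
proof -
  obtain r A B where "A \<in> carrier_mat n r" "B \<in> carrier_mat r n" "B * A = 1\<^sub>m r"
    "A * B = 1\<^sub>m n - T * P" "n = m + r"
    by (rule complementary_splitting[OF assms])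
  then show ?thesis by simp
qed

section \<open>Morphisms of representations\<close>

context hopf_algebra
begin

lemma Rep_carrier [simp]: "V \<in> Rep H \<Longrightarrow> snd V x \<in> carrier_mat (fst V) (fst V)"
  and Rep_add: "V \<in> Rep H \<Longrightarrow> snd V (x + y) = snd V x + snd V y"
  and Rep_scale: "V \<in> Rep H \<Longrightarrow> snd V (scale H c x) = c \<cdot>\<^sub>m snd V x"
  and Rep_mult: "V \<in> Rep H \<Longrightarrow> snd V (x * y) = snd V x * snd V y"
  and Rep_one: "V \<in> Rep H \<Longrightarrow> snd V 1 = 1\<^sub>m (fst V)"
  by (auto simp: Rep_def)

lemma Rep_dim [simp]: "V \<in> Rep H \<Longrightarrow> dim_row (snd V x) = fst V" "V \<in> Rep H \<Longrightarrow> dim_col (snd V x) = fst V"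
  by (metis Rep_carrier carrier_matD)+

lemma RepI:
  assumes "\<And>x. \<rho> x \<in> carrier_mat n n" "\<And>x y. \<rho> (x + y) = \<rho> x + \<rho> y" "\<And>c x. \<rho> (scale H c x) = c \<cdot>\<^sub>m \<rho> x"
    "\<And>x y. \<rho> (x * y) = \<rho> x * \<rho> y" "\<rho> 1 = 1\<^sub>m n"
  shows "(n, \<rho>) \<in> Rep H"
  using assms by (auto simp: Rep_def)

lemma Rep_zero: "V \<in> Rep H \<Longrightarrow> snd V 0 = 0\<^sub>m (fst V) (fst V)"
proof -
  assume V: "V \<in> Rep H"
  have "snd V 0 = 0 \<cdot>\<^sub>m snd V 0" using Rep_scale[OF V, of 0 0] by simp
  also have "\<dots> = 0\<^sub>m (fst V) (fst V)" using V by (intro eq_matI) auto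
  finally show ?thesis .
qed

lemma Rep_sum_mset: "V \<in> Rep H \<Longrightarrow> snd V (\<Sum>x\<in>#M. f x) = mat_sum (fst V) (fst V) (\<lambda>x. snd V (f x)) M"
  by (induction M) (auto simp: Rep_zero Rep_add intro!: eq_matI)

lemma rep_homI:
  "T \<in> carrier_mat (fst W) (fst V) \<Longrightarrow> (\<And>h. T * snd V h = snd W h * T) \<Longrightarrow> T \<in> rep_hom V W"
  by (simp add: rep_hom_def)

lemma rep_hom_carrier: "T \<in> rep_hom V W \<Longrightarrow> T \<in> carrier_mat (fst W) (fst V)"
  and rep_hom_comm: "T \<in> rep_hom V W \<Longrightarrow> T * snd V h = snd W h * T"
  by (auto simp: rep_hom_def)

lemma rep_hom_comp:
  assumes "V \<in> Rep H" "W \<in> Rep H" "U \<in> Rep H" "S \<in> rep_hom V W" "T \<in> rep_hom W U"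
  shows "T * S \<in> rep_hom V U"
proof (rule rep_homI)
  note c = assms(4,5)[THEN rep_hom_carrier]
  show "T * S \<in> carrier_mat (fst U) (fst V)" using c by simp
  fix h
  show "T * S * snd V h = snd U h * (T * S)"
    using assoc_mult_mat[OF c(2,1) Rep_carrier[OF assms(1)]] assoc_mult_mat[OF c(2) Rep_carrier[OF assms(2)] c(1)]
      assoc_mult_mat[OF Rep_carrier[OF assms(3)] c(2,1)] rep_hom_comm[OF assms(4)] rep_hom_comm[OF assms(5)] by simp
qed

lemma rep_hom_one: "V \<in> Rep H \<Longrightarrow> 1\<^sub>m (fst V) \<in> rep_hom V V"
  by (rule rep_homI) auto

lemma rep_hom_diff:
  assumes "V \<in> Rep H" "W \<in> Rep H" "S \<in> rep_hom V W" "T \<in> rep_hom V W"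
  shows "S - T \<in> rep_hom V W"
proof (rule rep_homI)
  note c = assms(3,4)[THEN rep_hom_carrier]
  show "S - T \<in> carrier_mat (fst W) (fst V)" using c(2) by (rule minus_carrier_mat)
  fix h
  show "(S - T) * snd V h = snd W h * (S - T)"
    using minus_mult_distrib_mat[OF c Rep_carrier[OF assms(1)]] mult_minus_distrib_mat[OF Rep_carrier[OF assms(2)] c]
      assms(3,4)[THEN rep_hom_comm] by simp
qed

lemma rep_hom_smult:
  assumes "V \<in> Rep H" "W \<in> Rep H" "T \<in> rep_hom V W"
  shows "c \<cdot>\<^sub>m T \<in> rep_hom V W"
proof (rule rep_homI)
  note c = assms(3)[THEN rep_hom_carrier]
  show "c \<cdot>\<^sub>m T \<in> carrier_mat (fst W) (fst V)" using c by simp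
  fix h
  show "(c \<cdot>\<^sub>m T) * snd V h = snd W h * (c \<cdot>\<^sub>m T)"
    using mult_smult_assoc_mat[OF c Rep_carrier[OF assms(1)]] mult_smult_distrib[OF Rep_carrier[OF assms(2)] c]
      assms(3)[THEN rep_hom_comm] by simp
qed

text \<open>The image of an equivariant idempotent, in coordinates: \<open>A\<close> includes it,
  \<open>B\<close> projects onto it. Because \<open>A * B\<close> commutes with the action, A (B h
  A) = h A and (B h A) B = B h; these give multiplicativity and the equivariance of \<open>A\<close>
  and \<open>B\<close>.\<close>

lemma split_rep:
  assumes V: "V \<in> Rep H" and A: "A \<in> carrier_mat (fst V) r" and B: "B \<in> carrier_mat r (fst V)"
    and BA: "B * A = 1\<^sub>m r" and AB: "A * B \<in> rep_hom V V"
  shows "(r, \<lambda>h. B * snd V h * A) \<in> Rep H" "A \<in> rep_hom (r, \<lambda>h. B * snd V h * A) V"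
    "B \<in> rep_hom V (r, \<lambda>h. B * snd V h * A)"
proof -
  note Vc = Rep_carrier[OF V]
  have BVc: "B * snd V h \<in> carrier_mat r (fst V)" and VA: "snd V h * A \<in> carrier_mat (fst V) r" for h
    using mult_carrier_mat[OF B Vc] mult_carrier_mat[OF Vc A] by auto
  have A': "A * (B * snd V h * A) = snd V h * A" for h
  proof -
    have "A * (B * snd V h * A) = A * (B * (snd V h * A))" by (simp add: assoc_mult_mat[OF B Vc A])
    also have "\<dots> = A * B * (snd V h * A)" by (rule assoc_mult_mat[OF A B VA, symmetric])
    also have "\<dots> = A * B * snd V h * A" by (rule assoc_mult_mat[OF mult_carrier_mat[OF A B] Vc A, symmetric])
    also have "\<dots> = snd V h * (A * B) * A" by (simp add: rep_hom_comm[OF AB])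
    also have "\<dots> = snd V h * (A * B * A)" by (rule assoc_mult_mat[OF Vc mult_carrier_mat[OF A B] A])
    also have "\<dots> = snd V h * A" using assoc_mult_mat[OF A B A] BA A by simp
    finally show ?thesis .
  qed
  have B': "B * snd V h * A * B = B * snd V h" for h
  proof -
    have "B * snd V h * A * B = B * snd V h * (A * B)" by (rule assoc_mult_mat[OF BVc A B])
    also have "\<dots> = B * (snd V h * (A * B))" by (rule assoc_mult_mat[OF B Vc mult_carrier_mat[OF A B]])
    also have "\<dots> = B * (A * B * snd V h)" by (simp add: rep_hom_comm[OF AB])
    also have "\<dots> = B * (A * B) * snd V h" by (rule assoc_mult_mat[OF B mult_carrier_mat[OF A B] Vc, symmetric])
    also have "\<dots> = B * snd V h" using assoc_mult_mat[OF B A B] BA B by simp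
    finally show ?thesis .
  qed
  show "(r, \<lambda>h. B * snd V h * A) \<in> Rep H"
  proof (rule RepI)
    show "B * snd V x * A \<in> carrier_mat r r" for x using mult_carrier_mat[OF BVc A] .
    show "B * snd V (x + y) * A = B * snd V x * A + B * snd V y * A" for x y
      unfolding Rep_add[OF V] mult_add_distrib_mat[OF B Vc Vc] by (rule add_mult_distrib_mat[OF BVc BVc A])
    show "B * snd V (scale H c x) * A = c \<cdot>\<^sub>m (B * snd V x * A)" for c x
      unfolding Rep_scale[OF V] mult_smult_distrib[OF B Vc] by (rule mult_smult_assoc_mat[OF BVc A])
    show "B * snd V (x * y) * A = B * snd V x * A * (B * snd V y * A)" for x y
    proof -
      have "B * snd V x * A * (B * snd V y * A) = B * snd V x * (A * (B * snd V y * A))"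
        by (rule assoc_mult_mat[OF BVc A mult_carrier_mat[OF BVc A]])
      also have "\<dots> = B * snd V x * snd V y * A" unfolding A' by (rule assoc_mult_mat[OF BVc Vc A, symmetric])
      also have "\<dots> = B * snd V (x * y) * A" by (simp add: Rep_mult[OF V] assoc_mult_mat[OF B Vc Vc])
      finally show ?thesis by simp
    qed
    show "B * snd V 1 * A = 1\<^sub>m r" using B BA by (simp add: Rep_one[OF V])
  qed
  show "A \<in> rep_hom (r, \<lambda>h. B * snd V h * A) V" by (rule rep_homI) (use A A' in simp_all)
  show "B \<in> rep_hom V (r, \<lambda>h. B * snd V h * A)" by (rule rep_homI) (use B B' in simp_all)
qed

lemma rep_iso_refl: "V \<in> Rep H \<Longrightarrow> rep_iso V V"
  unfolding rep_iso_def rep_isomorphism_def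
  by (rule exI[of _ "1\<^sub>m (fst V)"], rule conjI, erule rep_hom_one, rule bexI[OF _ rep_hom_one]) auto

lemma rep_iso_sym: "rep_iso V W \<Longrightarrow> rep_iso W V"
  unfolding rep_iso_def rep_isomorphism_def by blast

lemma rep_isomorphism_comp:
  assumes "V \<in> Rep H" "W \<in> Rep H" "U \<in> Rep H" "rep_isomorphism V W S" "rep_isomorphism W U T"
  shows "rep_isomorphism V U (T * S)"
proof -
  obtain S' T' where h: "S \<in> rep_hom V W" "T \<in> rep_hom W U" "S' \<in> rep_hom W V" "T' \<in> rep_hom U W"
    and i: "S * S' = 1\<^sub>m (fst W)" "S' * S = 1\<^sub>m (fst V)" "T * T' = 1\<^sub>m (fst U)" "T' * T = 1\<^sub>m (fst W)"
    using assms(4,5) unfolding rep_isomorphism_def by blast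
  note c = h[THEN rep_hom_carrier]
  have "T * S * (S' * T') = T * (S * S' * T')"
    using assoc_mult_mat[OF c(2,1) mult_carrier_mat[OF c(3,4)]] assoc_mult_mat[OF c(1,3,4)] by simp
  then have "T * S * (S' * T') = 1\<^sub>m (fst U)" using i c by simp
  moreover have "S' * T' * (T * S) = S' * (T' * T * S)"
    using assoc_mult_mat[OF c(3,4) mult_carrier_mat[OF c(2,1)]] assoc_mult_mat[OF c(4,2,1)] by simp
  then have "S' * T' * (T * S) = 1\<^sub>m (fst V)" using i c by simp
  ultimately show ?thesis
    unfolding rep_isomorphism_def using rep_hom_comp assms(1-3) h by blast
qed

lemma rep_iso_trans:
  "V \<in> Rep H \<Longrightarrow> W \<in> Rep H \<Longrightarrow> U \<in> Rep H \<Longrightarrow> rep_iso V W \<Longrightarrow> rep_iso W U \<Longrightarrow> rep_iso V U"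
  unfolding rep_iso_def using rep_isomorphism_comp by blast

lemma left_inverse_square_iso:
  assumes "V \<in> Rep H" "W \<in> Rep H" "T \<in> rep_hom V W" "P \<in> rep_hom W V" "P * T = 1\<^sub>m (fst V)" "fst V = fst W"
  shows "rep_isomorphism V W T"
  using assms mat_mult_left_right_inverse[of P "fst V" T] rep_hom_carrier[of P W V] rep_hom_carrier[of T V W]
  unfolding rep_isomorphism_def by auto

lemma simple_repD: "simple_rep H X \<Longrightarrow> X \<in> Rep H" "simple_rep H X \<Longrightarrow> fst X \<noteq> 0"
  by (auto simp: simple_rep_def)

lemma left_inverse_mono:
  fixes V W :: "('k, 'h) rep"
  assumes "T \<in> rep_hom V W" "P \<in> carrier_mat (fst V) (fst W)" "P * T = 1\<^sub>m (fst V)"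
  shows "rep_mono V W T"
  unfolding rep_mono_def
proof (intro conjI ballI impI)
  note c = rep_hom_carrier[OF assms(1)]
  fix v :: "'k vec" assume v: "v \<in> carrier_vec (fst V)" "T *\<^sub>v v = 0\<^sub>v (fst W)"
  have "v = P * T *\<^sub>v v" using assms v by simp
  also have "\<dots> = P *\<^sub>v (T *\<^sub>v v)" by (rule assoc_mult_mat_vec[OF assms(2) c v(1)])
  finally show "v = 0\<^sub>v (fst V)" using v(2) assms(2) by simp
qed (rule assms(1))

text \<open>Splitting E exhibits its image as a subobject, which is zero or everything. In the
  second case the inverse of the inclusion agrees with the projection \<open>B\<close>, so
  \<open>A * B\<close> is the identity.\<close>

lemma simple_idempotent:
  assumes X: "simple_rep H X" and E: "E \<in> rep_hom X X" "E * E = E"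
  shows "E = 0\<^sub>m (fst X) (fst X) \<or> E = 1\<^sub>m (fst X)"
proof -
  note XR = simple_repD(1)[OF X]
  obtain r A B where A: "A \<in> carrier_mat (fst X) r" and B: "B \<in> carrier_mat r (fst X)"
    and BA: "B * A = 1\<^sub>m r" and AB: "A * B = E"
    by (rule idempotent_splitting[OF rep_hom_carrier[OF E(1)] E(2)])
  let ?W = "(r, \<lambda>h. B * snd X h * A)"
  have W: "?W \<in> Rep H" "A \<in> rep_hom ?W X" "B \<in> rep_hom X ?W"
    using split_rep[OF XR A B BA] AB E(1) by auto
  have "rep_mono ?W X A" using left_inverse_mono[OF W(2), of B] B BA by simp
  then have "r = 0 \<or> rep_isomorphism ?W X A" using X W(1) unfolding simple_rep_def by fastforce
  then show ?thesis
  proof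
    assume "r = 0"
    then have "A * B = 0\<^sub>m (fst X) (fst X)" using A B by (intro eq_matI) (auto simp: scalar_prod_def)
    then show ?thesis using AB by simp
  next
    assume "rep_isomorphism ?W X A"
    then obtain A' where A': "A' \<in> carrier_mat r (fst X)" "A * A' = 1\<^sub>m (fst X)"
      unfolding rep_isomorphism_def rep_hom_def by auto
    have "B = B * (A * A')" using B A' by simp
    also have "\<dots> = A'" using assoc_mult_mat[OF B A A'(1)] BA A'(1) by simp
    finally show ?thesis using AB A' by simp
  qed
qed

end

section \<open>Averaging and Schur's lemma\<close>

locale semisimple_hopf_algebra = hopf_algebra H
  for H :: "('k::{alg_closed_field, field_char_0}, 'h::ring_1) hopf_structure" +
  assumes semisimple: "semisimple_algebra H"
begin

text \<open>Maschke averaging: a linear G with T G T = T is replaced by the sum of t_1 G S(t_2) over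
  the comultiplication of t. This treats an arbitrary morphism at once; retractions of monomorphisms
  and Schur's lemma are special cases.\<close>

lemma hom_von_neumann_regular:
  assumes V: "V \<in> Rep H" and W: "W \<in> Rep H" and T: "T \<in> rep_hom V W"
  obtains Q where "Q \<in> rep_hom W V" "T * Q * T = T"
proof -
  note Tc = rep_hom_carrier[OF T]
  obtain t where t: "\<And>h. h * t = scale H (counit H h) t" "counit H t = 1"
    using left_integral_exists[OF semisimple] by blast
  obtain r A B C where A: "A \<in> carrier_mat (fst W) r" and B: "B \<in> carrier_mat r (fst W)" and C: "C \<in> carrier_mat (fst V) r"
    and BA: "B * A = 1\<^sub>m r" and ABT: "A * (B * T) = T" and AC: "A = T * C"
    by (rule column_space_basis[OF Tc])
  \<comment> \<open>With \<open>A = T * C\<close> and \<open>A * (B * T) = T\<close> this is a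
    generalised inverse of T.\<close>
  define G where "G = C * B"
  have G: "G \<in> carrier_mat (fst V) (fst W)" using C B by (simp add: G_def)
  have TGT: "T * (G * T) = T"
    unfolding G_def assoc_mult_mat[OF C B Tc] assoc_mult_mat[OF Tc C mult_carrier_mat[OF B Tc], symmetric]
    using ABT AC by simp
  define Q where "Q = mat_sum (fst V) (fst W) (\<lambda>(a, b). snd V a * G * snd W (antipode H b)) (comult H t)"
  have Qc: "Q \<in> carrier_mat (fst V) (fst W)" by (simp add: Q_def)
  have Vc: "snd V h \<in> carrier_mat (fst V) (fst V)" and Wc: "snd W h \<in> carrier_mat (fst W) (fst W)" for h
    using V W by simp_all
  have VG: "snd V a * G \<in> carrier_mat (fst V) (fst W)" for a using mult_carrier_mat[OF Vc G] .
  have VGW: "(case x of (a, b) \<Rightarrow> snd V a * G * snd W (antipode H b)) \<in> carrier_mat (fst V) (fst W)" for x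
    using mult_carrier_mat[OF VG Wc] by (cases x) simp
  have "Q \<in> rep_hom W V"
  proof (rule rep_homI[OF Qc])
    fix h
    \<comment> \<open>Evaluation over tensors requires values in an abelian group, so the Casimir
      property is applied to each matrix entry separately.\<close>
    have bi: "biadditive_balanced (scale H) (\<lambda>a b. (snd V a * G * snd W b) $$ (i, j))" if "i < fst V" "j < fst W" for i j
      unfolding biadditive_balanced_def
    proof (intro conjI allI)
      fix x y z c
      show "(snd V (x + y) * G * snd W z) $$ (i, j) = (snd V x * G * snd W z) $$ (i, j) + (snd V y * G * snd W z) $$ (i, j)"
        unfolding Rep_add[OF V] add_mult_distrib_mat[OF Vc Vc G] add_mult_distrib_mat[OF VG VG Wc]
        using that V W G by simp
      show "(snd V x * G * snd W (y + z)) $$ (i, j) = (snd V x * G * snd W y) $$ (i, j) + (snd V x * G * snd W z) $$ (i, j)"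
        unfolding Rep_add[OF W] mult_add_distrib_mat[OF VG Wc Wc]
        using that V W G by simp
      show "(snd V (scale H c x) * G * snd W y) $$ (i, j) = (snd V x * G * snd W (scale H c y)) $$ (i, j)"
        unfolding Rep_scale[OF V] Rep_scale[OF W] mult_smult_assoc_mat[OF Vc G] mult_smult_assoc_mat[OF VG Wc]
          mult_smult_distrib[OF VG Wc] ..
    qed
    have 1: "snd V h * Q = mat_sum (fst V) (fst W) (\<lambda>(a, b). snd V (h * a) * G * snd W (antipode H b)) (comult H t)"
      unfolding Q_def using mult_mat_sum[OF Vc[of h] VGW, where M = "comult H t"]
      using assoc_mult_mat[OF Vc VG Wc] assoc_mult_mat[OF Vc Vc G]
      by (simp add: case_prod_unfold Rep_mult[OF V])
    have 2: "Q * snd W h = mat_sum (fst V) (fst W) (\<lambda>(a, b). snd V a * G * snd W (antipode H b * h)) (comult H t)"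
      unfolding Q_def using mat_sum_mult[OF Wc[of h] VGW, where M = "comult H t"]
      using assoc_mult_mat[OF VG Wc Wc]
      by (simp add: case_prod_unfold Rep_mult[OF W])
    show "Q * snd W h = snd V h * Q"
      unfolding 1 2
    proof (rule eq_matI)
      fix i j assume "i < dim_row (mat_sum (fst V) (fst W) (\<lambda>(a, b). snd V (h * a) * G * snd W (antipode H b)) (comult H t))"
        "j < dim_col (mat_sum (fst V) (fst W) (\<lambda>(a, b). snd V (h * a) * G * snd W (antipode H b)) (comult H t))"
      then have ij: "i < fst V" "j < fst W" by auto
      show "mat_sum (fst V) (fst W) (\<lambda>(a, b). snd V a * G * snd W (antipode H b * h)) (comult H t) $$ (i, j) =
        mat_sum (fst V) (fst W) (\<lambda>(a, b). snd V (h * a) * G * snd W (antipode H b)) (comult H t) $$ (i, j)"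
        using casimir[OF t(1) bi[OF ij], of h] ij by (simp add: case_prod_unfold)
    qed auto
  qed
  moreover have "T * Q * T = T"
  proof -
    have TV: "T * snd V a = snd W a * T" for a by (rule rep_hom_comm[OF T])
    \<comment> \<open>Equivariance carries both actions through T, so that T (a G b) T = a b T G T =
      a b T. Summing over t_1 and S(t_2) leaves \<epsilon>(t) T = T.\<close>
    have key: "T * (snd V a * G * snd W b) * T = snd W (a * b) * T" for a b
    proof -
      have "T * (snd V a * G * snd W b) * T = T * ((snd V a * G * snd W b) * T)"
        by (rule assoc_mult_mat[OF Tc mult_carrier_mat[OF VG Wc] Tc])
      also have "(snd V a * G * snd W b) * T = snd V a * G * (T * snd V b)"
        using assoc_mult_mat[OF VG Wc Tc] TV by simp
      also have "\<dots> = snd V a * (G * T * snd V b)"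
        using assoc_mult_mat[OF Vc G mult_carrier_mat[OF Tc Vc]] assoc_mult_mat[OF G Tc Vc] by simp
      also have "T * (snd V a * (G * T * snd V b)) = T * snd V a * (G * T * snd V b)"
        by (rule assoc_mult_mat[OF Tc Vc mult_carrier_mat[OF mult_carrier_mat[OF G Tc] Vc], symmetric])
      also have "\<dots> = snd W a * (T * (G * T * snd V b))" unfolding TV
        by (rule assoc_mult_mat[OF Wc Tc mult_carrier_mat[OF mult_carrier_mat[OF G Tc] Vc]])
      also have "T * (G * T * snd V b) = T * (G * T) * snd V b"
        by (rule assoc_mult_mat[OF Tc mult_carrier_mat[OF G Tc] Vc, symmetric])
      also have "snd W a * (T * (G * T) * snd V b) = snd W (a * b) * T"
        unfolding TGT TV Rep_mult[OF W] by (rule assoc_mult_mat[OF Wc Wc Tc, symmetric])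
      finally show ?thesis .
    qed
    have TVc: "(case x of (a, b) \<Rightarrow> T * (snd V a * G * snd W (antipode H b))) \<in> carrier_mat (fst W) (fst W)" for x
      using mult_carrier_mat[OF Tc mult_carrier_mat[OF VG Wc]] by (cases x) simp
    have "T * Q * T = mat_sum (fst W) (fst V) (\<lambda>(a, b). T * (snd V a * G * snd W (antipode H b)) * T) (comult H t)"
      unfolding Q_def using mult_mat_sum[OF Tc VGW, where M = "comult H t"] mat_sum_mult[OF Tc TVc, where M = "comult H t"]
      by (simp add: case_prod_unfold)
    also have "\<dots> = mat_sum (fst W) (fst V) (\<lambda>(a, b). snd W (a * antipode H b) * T) (comult H t)"
      by (simp only: key)
    also have "\<dots> = snd W (\<Sum>(a, b)\<in>#comult H t. a * antipode H b) * T"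
      unfolding Rep_sum_mset[OF W]
      using mat_sum_mult[OF Tc, where f = "\<lambda>(a, b). snd W (a * antipode H b)" and n = "fst W" and M = "comult H t"] W
      by (simp add: case_prod_unfold)
    also have "\<dots> = T" using Tc by (simp add: antipode_right t(2) Rep_one[OF W])
    finally show ?thesis .
  qed
  ultimately show ?thesis by (rule that)
qed

text \<open>For a regular inverse Q of T, the endomorphism Q T of X is idempotent. It is not zero
  since T Q T = T is not zero, so it is the identity.\<close>

lemma simple_hom_from:
  assumes X: "simple_rep H X" and W: "W \<in> Rep H" and T: "T \<in> rep_hom X W" "T \<noteq> 0\<^sub>m (fst W) (fst X)"
  obtains Q where "Q \<in> rep_hom W X" "Q * T = 1\<^sub>m (fst X)"
proof -
  note XR = simple_repD(1)[OF X]
  obtain Q where Q: "Q \<in> rep_hom W X" "T * Q * T = T" by (rule hom_von_neumann_regular[OF XR W T(1)])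
  note c = rep_hom_carrier[OF T(1)] rep_hom_carrier[OF Q(1)]
  have TQT: "T * (Q * T) = T" using assoc_mult_mat[OF c(1,2,1)] Q(2) by simp
  have "Q * T * (Q * T) = Q * T" using assoc_mult_mat[OF c(2,1) mult_carrier_mat[OF c(2,1)]] TQT by simp
  from simple_idempotent[OF X rep_hom_comp[OF XR W XR T(1) Q(1)] this] have "Q * T = 1\<^sub>m (fst X)"
    using TQT T(2) c(1) by auto
  with Q(1) show ?thesis by (rule that)
qed

lemma mono_retraction:
  assumes V: "V \<in> Rep H" and W: "W \<in> Rep H" and T: "rep_mono V W T"
  obtains Q where "Q \<in> rep_hom W V" "Q * T = 1\<^sub>m (fst V)"
proof -
  have Th: "T \<in> rep_hom V W" using T by (simp add: rep_mono_def)
  obtain Q where Q: "Q \<in> rep_hom W V" "T * Q * T = T" by (rule hom_von_neumann_regular[OF V W Th])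
  note c = rep_hom_carrier[OF Th] rep_hom_carrier[OF Q(1)]
  obtain P where P: "P \<in> carrier_mat (fst V) (fst W)" "P * T = 1\<^sub>m (fst V)"
    by (rule injective_left_inverse[OF c(1)]) (use T in \<open>auto simp: rep_mono_def\<close>)
  have "Q * T = P * T * (Q * T)" using P c by simp
  also have "\<dots> = P * (T * Q * T)"
    using assoc_mult_mat[OF P(1) c(1) mult_carrier_mat[OF c(2,1)]] assoc_mult_mat[OF c(1,2,1)] by simp
  finally have "Q * T = 1\<^sub>m (fst V)" using P Q by simp
  with Q(1) show ?thesis by (rule that)
qed

text \<open>A nonzero retract of least dimension is simple, since a subobject of it is by
  \<open>mono_retraction\<close> again a retract of V and cannot have smaller positive
  dimension.\<close>

lemma exists_simple_summand:
  assumes V: "V \<in> Rep H" "fst V \<noteq> 0"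
  obtains X T P where "simple_rep H X" "T \<in> rep_hom X V" "P \<in> rep_hom V X" "P * T = 1\<^sub>m (fst X)"
proof -
  define S where "S n \<longleftrightarrow> (\<exists>W T P. W \<in> Rep H \<and> fst W = n \<and> n \<noteq> 0 \<and> T \<in> rep_hom W V \<and> P \<in> rep_hom V W \<and> P * T = 1\<^sub>m n)" for n
  have "S (fst V)" unfolding S_def using V rep_hom_one[OF V(1)] by fastforce
  then have L: "S (LEAST n. S n)" by (rule LeastI)
  define n where "n = (LEAST n. S n)"
  obtain X T P where X: "X \<in> Rep H" "fst X = n" "n \<noteq> 0" "T \<in> rep_hom X V" "P \<in> rep_hom V X" "P * T = 1\<^sub>m n"
    using L unfolding n_def[symmetric] unfolding S_def by blast
  have "simple_rep H X"
    unfolding simple_rep_def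
  proof (intro conjI ballI allI impI)
    fix W R assume W: "W \<in> Rep H" and R: "rep_mono W X R"
    obtain Q where Q: "Q \<in> rep_hom X W" "Q * R = 1\<^sub>m (fst W)" by (rule mono_retraction[OF W X(1) R])
    have Rh: "R \<in> rep_hom W X" using R by (simp add: rep_mono_def)
    note c = rep_hom_carrier[OF Q(1)] rep_hom_carrier[OF Rh] rep_hom_carrier[OF X(4)] rep_hom_carrier[OF X(5)]
    have le: "fst W \<le> fst X" using left_inverse_dim[OF c(2,1) Q(2)] .
    show "fst W = 0 \<or> rep_isomorphism W X R"
    proof (cases "fst W = 0")
      case False
      have "Q * P * (T * R) = Q * (P * T * R)"
        using assoc_mult_mat[OF c(1,4) mult_carrier_mat[OF c(3,2)]] assoc_mult_mat[OF c(4,3,2)] by simp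
      also have "\<dots> = 1\<^sub>m (fst W)" using X(2,6) c(2) Q(2) by simp
      finally have "S (fst W)"
        unfolding S_def using W False rep_hom_comp[OF W X(1) V(1) Rh X(4)] rep_hom_comp[OF V(1) X(1) W X(5) Q(1)] by blast
      then have "n \<le> fst W" unfolding n_def by (rule Least_le)
      then have "fst W = fst X" using le X(2) by simp
      then show ?thesis using left_inverse_square_iso[OF W X(1) Rh Q(1) Q(2)] by simp
    qed simp
  qed (use X in auto)
  with X that show ?thesis by auto
qed

text \<open>Algebraic closedness provides an eigenvalue c. The endomorphism Z - c kills an
  eigenvector, whereas a nonzero morphism out of a simple object has a left inverse.\<close>

lemma schur_scalar:
  assumes X: "simple_rep H X" and Z: "Z \<in> rep_hom X X"
  obtains c where "Z = c \<cdot>\<^sub>m 1\<^sub>m (fst X)"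
proof -
  note XR = simple_repD(1)[OF X] and Zc = rep_hom_carrier[OF Z]
  have "degree (char_poly Z) \<noteq> 0" using degree_monic_char_poly[OF Zc] simple_repD(2)[OF X] by simp
  then obtain c where "poly (char_poly Z) c = 0"
    using alg_closed_imp_poly_has_root[of "char_poly Z"] by auto
  then obtain v where v: "v \<in> carrier_vec (fst X)" "v \<noteq> 0\<^sub>v (fst X)" "Z *\<^sub>v v = c \<cdot>\<^sub>v v"
    using Zc unfolding eigenvalue_root_char_poly[OF Zc, symmetric] eigenvalue_def eigenvector_def by auto
  define T where "T = Z - c \<cdot>\<^sub>m 1\<^sub>m (fst X)"
  have T: "T \<in> rep_hom X X"
    unfolding T_def by (intro rep_hom_diff rep_hom_smult rep_hom_one XR Z)
  note Tc = rep_hom_carrier[OF T]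
  have "T = 0\<^sub>m (fst X) (fst X)"
  proof (rule ccontr)
    assume "T \<noteq> 0\<^sub>m (fst X) (fst X)"
    then obtain Q where Q: "Q \<in> rep_hom X X" "Q * T = 1\<^sub>m (fst X)"
      using simple_hom_from[OF X XR T] by blast
    have "T *\<^sub>v v = Z *\<^sub>v v - (c \<cdot>\<^sub>m 1\<^sub>m (fst X)) *\<^sub>v v"
      unfolding T_def by (rule minus_mult_distrib_mat_vec[OF Zc _ v(1)]) simp
    also have "\<dots> = 0\<^sub>v (fst X)" unfolding v(3) using v(1) by (intro eq_vecI) auto
    finally have Tv: "T *\<^sub>v v = 0\<^sub>v (fst X)" .
    have "v = Q * T *\<^sub>v v" using Q v by simp
    also have "\<dots> = Q *\<^sub>v (T *\<^sub>v v)" by (rule assoc_mult_mat_vec[OF rep_hom_carrier[OF Q(1)] Tc v(1)])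
    also have "\<dots> = 0\<^sub>v (fst X)" unfolding Tv using rep_hom_carrier[OF Q(1)] by simp
    finally show False using v by simp
  qed
  then have "Z = c \<cdot>\<^sub>m 1\<^sub>m (fst X)"
    using Zc unfolding T_def by (intro eq_matI) (auto simp: mat_eq_iff)
  then show ?thesis by (rule that)
qed

end

section \<open>Direct sums, decompositions and characters\<close>

context hopf_algebra
begin

lemma direct_sum_rep_Nil: "direct_sum_rep [] = (0, \<lambda>h. 0\<^sub>m 0 0)"
  by (simp add: direct_sum_rep_def)

lemma direct_sum_rep_Cons:
  assumes "V \<in> Rep H" "direct_sum_rep Vs \<in> Rep H"
  shows "fst (direct_sum_rep (V # Vs)) = fst V + fst (direct_sum_rep Vs)"
    "snd (direct_sum_rep (V # Vs)) h = four_block_mat (snd V h) (0\<^sub>m (fst V) (fst (direct_sum_rep Vs)))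
       (0\<^sub>m (fst (direct_sum_rep Vs)) (fst V)) (snd (direct_sum_rep Vs) h)"
proof -
  let ?D = "diag_block_mat (map (\<lambda>V. snd V h) Vs)"
  have D: "?D = snd (direct_sum_rep Vs) h"
    by (simp add: direct_sum_rep_def)
  have "snd (direct_sum_rep (V # Vs)) h = four_block_mat (snd V h) (0\<^sub>m (dim_row (snd V h)) (dim_col ?D))
       (0\<^sub>m (dim_row ?D) (dim_col (snd V h))) ?D"
    by (simp add: direct_sum_rep_def Let_def)
  then show "snd (direct_sum_rep (V # Vs)) h = four_block_mat (snd V h) (0\<^sub>m (fst V) (fst (direct_sum_rep Vs)))
       (0\<^sub>m (fst (direct_sum_rep Vs)) (fst V)) (snd (direct_sum_rep Vs) h)"
    unfolding D using assms by simp
qed (simp add: direct_sum_rep_def)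

lemma direct_sum_rep_Rep: "set Vs \<subseteq> Rep H \<Longrightarrow> direct_sum_rep Vs \<in> Rep H"
proof (induction Vs)
  case Nil
  show ?case unfolding direct_sum_rep_Nil by (rule RepI) auto
next
  case (Cons V Vs)
  let ?W = "direct_sum_rep Vs"
  have V: "V \<in> Rep H" and W: "?W \<in> Rep H" using Cons by auto
  note s = direct_sum_rep_Cons[OF V W]
  note c = Rep_carrier[OF V] zero_carrier_mat zero_carrier_mat Rep_carrier[OF W]
  have "(fst (direct_sum_rep (V # Vs)), snd (direct_sum_rep (V # Vs))) \<in> Rep H"
  proof (rule RepI)
    fix x y a
    show "snd (direct_sum_rep (V # Vs)) x \<in> carrier_mat (fst (direct_sum_rep (V # Vs))) (fst (direct_sum_rep (V # Vs)))"
      unfolding s using V W by (intro four_block_carrier_mat) auto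
    show "snd (direct_sum_rep (V # Vs)) (x + y) = snd (direct_sum_rep (V # Vs)) x + snd (direct_sum_rep (V # Vs)) y"
      unfolding s Rep_add[OF V] Rep_add[OF W]
      by (subst add_four_block_mat[OF c c]) (simp_all)
    show "snd (direct_sum_rep (V # Vs)) (scale H a x) = a \<cdot>\<^sub>m snd (direct_sum_rep (V # Vs)) x"
      unfolding s Rep_scale[OF V] Rep_scale[OF W]
      by (subst smult_four_block_mat[OF c]) (simp_all)
    show "snd (direct_sum_rep (V # Vs)) (x * y) = snd (direct_sum_rep (V # Vs)) x * snd (direct_sum_rep (V # Vs)) y"
      unfolding s Rep_mult[OF V] Rep_mult[OF W]
      by (subst mult_four_block_mat[OF c c], rule arg_cong4[where f = four_block_mat])
       (use V W mult_carrier_mat[OF Rep_carrier[OF V] Rep_carrier[OF V]] mult_carrier_mat[OF Rep_carrier[OF W] Rep_carrier[OF W]] in \<open>auto\<close>)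
    show "snd (direct_sum_rep (V # Vs)) 1 = 1\<^sub>m (fst (direct_sum_rep (V # Vs)))"
      unfolding s Rep_one[OF V] Rep_one[OF W] by (rule four_block_one_mat)
  qed
  then show ?case by simp
qed

text \<open>A list of simple summands with inclusion and projection, repetitions recording
  multiplicities. The equations B A = 1 and the sum of all A B being 1 are what the expansion of the
  action and the trace formula use.\<close>

definition decomposition :: "('k, 'h) rep \<Rightarrow> (('k, 'h) rep \<times> 'k mat \<times> 'k mat) list \<Rightarrow> bool" where
  "decomposition V Ds \<longleftrightarrow>
     (\<forall>(X, A, B)\<in>set Ds. simple_rep H X \<and> A \<in> rep_hom X V \<and> B \<in> rep_hom V X \<and> B * A = 1\<^sub>m (fst X)) \<and>
     mat_sum (fst V) (fst V) (\<lambda>(X, A, B). A * B) (mset Ds) = 1\<^sub>m (fst V)"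

definition character :: "('k, 'h) rep \<Rightarrow> 'h \<Rightarrow> 'k" where
  "character V h = mat_trace (snd V h)"

lemma decomposition_expand:
  assumes V: "V \<in> Rep H" and D: "decomposition V Ds"
  shows "snd V h = mat_sum (fst V) (fst V) (\<lambda>(X, A, B). A * snd X h * B) (mset Ds)"
proof -
  have c: "A \<in> carrier_mat (fst V) (fst X)" "B \<in> carrier_mat (fst X) (fst V)" "B * snd V h = snd X h * B" "X \<in> Rep H"
    if "(X, A, B) \<in># mset Ds" for X A B
    using D that unfolding decomposition_def by (auto dest: rep_hom_carrier rep_hom_comm simple_repD)
  have "snd V h = mat_sum (fst V) (fst V) (\<lambda>(X, A, B). A * B) (mset Ds) * snd V h"
    using D V unfolding decomposition_def by simp
  also have "\<dots> = mat_sum (fst V) (fst V) (\<lambda>x. (case x of (X, A, B) \<Rightarrow> A * B) * snd V h) (mset Ds)"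
  proof (rule mat_sum_mult[OF Rep_carrier[OF V]])
    fix x assume "x \<in># mset Ds"
    moreover obtain X A B where x: "x = (X, A, B)" by (cases x)
    ultimately have "(X, A, B) \<in># mset Ds" by simp
    from c[OF this] show "(case x of (X, A, B) \<Rightarrow> A * B) \<in> carrier_mat (fst V) (fst V)"
      unfolding x prod.case by (intro mult_carrier_mat[of _ _ "fst X"])
  qed
  also have "\<dots> = mat_sum (fst V) (fst V) (\<lambda>(X, A, B). A * snd X h * B) (mset Ds)"
  proof (rule mat_sum_cong)
    fix x assume "x \<in># mset Ds"
    moreover obtain X A B where x: "x = (X, A, B)" by (cases x)
    ultimately have m: "(X, A, B) \<in># mset Ds" by simp
    note cc = c[OF m]
    have "A * B * snd V h = A * (snd X h * B)"
      using assoc_mult_mat[OF cc(1,2) Rep_carrier[OF V]] cc(3) by simp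
    also have "\<dots> = A * snd X h * B"
      by (rule assoc_mult_mat[OF cc(1) Rep_carrier[OF cc(4)] cc(2), symmetric])
    finally show "(case x of (X, A, B) \<Rightarrow> A * B) * snd V h = (case x of (X, A, B) \<Rightarrow> A * snd X h * B)"
      by (simp add: x)
  qed
  finally show ?thesis .
qed

text \<open>By cyclicity the trace of A x B is that of B A x, and B A = 1.\<close>

lemma decomposition_character:
  assumes V: "V \<in> Rep H" and D: "decomposition V Ds"
  shows "character V h = (\<Sum>X\<leftarrow>map fst Ds. character X h)"
proof -
  have c: "A \<in> carrier_mat (fst V) (fst X)" "B \<in> carrier_mat (fst X) (fst V)" "B * A = 1\<^sub>m (fst X)" "X \<in> Rep H"
    if "(X, A, B) \<in># mset Ds" for X A B
    using D that unfolding decomposition_def by (auto dest: rep_hom_carrier rep_hom_comm simple_repD)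
  have "character V h = (\<Sum>x\<in>#mset Ds. mat_trace (case x of (X, A, B) \<Rightarrow> A * snd X h * B))"
    unfolding character_def decomposition_expand[OF V D, of h]
  proof (rule mat_trace_mat_sum)
    fix x assume "x \<in># mset Ds"
    moreover obtain X A B where x: "x = (X, A, B)" by (cases x)
    ultimately have "(X, A, B) \<in># mset Ds" by simp
    from c[OF this] show "(case x of (X, A, B) \<Rightarrow> A * snd X h * B) \<in> carrier_mat (fst V) (fst V)"
      unfolding x prod.case by (intro mult_carrier_mat[of _ _ "fst X"] Rep_carrier)
  qed
  also have "image_mset (\<lambda>x. mat_trace (case x of (X, A, B) \<Rightarrow> A * snd X h * B)) (mset Ds) =
    image_mset (\<lambda>x. character (fst x) h) (mset Ds)"
  proof (rule image_mset_cong)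
    fix x assume "x \<in># mset Ds"
    moreover obtain X A B where x: "x = (X, A, B)" by (cases x)
    ultimately have m: "(X, A, B) \<in># mset Ds" by simp
    note cc = c[OF m]
    have "mat_trace (A * snd X h * B) = mat_trace (B * (A * snd X h))"
      by (rule mat_trace_mult_commute[OF mult_carrier_mat[OF cc(1) Rep_carrier[OF cc(4)]] cc(2)])
    also have "B * (A * snd X h) = snd X h"
      using assoc_mult_mat[OF cc(2,1) Rep_carrier[OF cc(4)]] cc(3,4) by simp
    finally show "mat_trace (case x of (X, A, B) \<Rightarrow> A * snd X h * B) = character (fst x) h"
      by (simp add: x character_def)
  qed
  also have "sum_mset \<dots> = (\<Sum>X\<leftarrow>map fst Ds. character X h)"
    by (simp flip: sum_mset_sum_list mset_map add: multiset.map_comp comp_def)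
  finally show ?thesis .
qed

lemma rep_iso_character:
  assumes "V \<in> Rep H" "W \<in> Rep H" "rep_iso V W"
  shows "character V h = character W h"
proof -
  obtain T T' where T: "T \<in> rep_hom V W" "T' \<in> rep_hom W V" "T * T' = 1\<^sub>m (fst W)" "T' * T = 1\<^sub>m (fst V)"
    using assms(3) unfolding rep_iso_def rep_isomorphism_def by blast
  note c = T(1,2)[THEN rep_hom_carrier]
  have "snd V h = T' * (T * snd V h)" using assoc_mult_mat[OF c(2,1) Rep_carrier[OF assms(1)]] T(4) assms(1) by simp
  then have "character V h = mat_trace (T' * (T * snd V h))"
    unfolding character_def by (rule arg_cong)
  also have "\<dots> = mat_trace (T * snd V h * T')"
    by (rule mat_trace_mult_commute[OF c(2) mult_carrier_mat[OF c(1) Rep_carrier[OF assms(1)]]])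
  also have "T * snd V h * T' = snd W h"
    using rep_hom_comm[OF T(1)] assoc_mult_mat[OF Rep_carrier[OF assms(2)] c] T(3) assms(2) by simp
  finally show ?thesis by (simp add: character_def)
qed

lemma direct_sum_character:
  "set Vs \<subseteq> Rep H \<Longrightarrow> character (direct_sum_rep Vs) h = (\<Sum>V\<leftarrow>Vs. character V h)"
proof (induction Vs)
  case Nil
  show ?case by (simp add: direct_sum_rep_Nil character_def mat_trace_def)
next
  case (Cons V Vs)
  let ?W = "direct_sum_rep Vs"
  have V: "V \<in> Rep H" and W: "?W \<in> Rep H" using Cons by (auto intro: direct_sum_rep_Rep)
  have "character (direct_sum_rep (V # Vs)) h = (\<Sum>i<fst V + fst ?W. snd (direct_sum_rep (V # Vs)) h $$ (i, i))"
    using V W by (simp add: character_def mat_trace_def direct_sum_rep_Cons)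
  also have "\<dots> = (\<Sum>i<fst V. snd V h $$ (i, i)) + (\<Sum>i<fst ?W. snd ?W h $$ (i, i))"
    using V W by (simp add: direct_sum_rep_Cons sum.nat_group lessThan_atLeast0 sum.atLeastLessThan_concat[of 0 "fst V" "fst V + fst ?W", symmetric]
      sum.shift_bounds_nat_ivl[of _ 0 "fst V" "fst ?W", simplified, unfolded add.commute[of "fst ?W"]])
  also have "\<dots> = character V h + character ?W h"
    using V W by (simp add: character_def mat_trace_def)
  finally show ?case using Cons by simp
qed

lemma character_one: "V \<in> Rep H \<Longrightarrow> character V 1 = of_nat (fst V)"
  by (simp add: character_def Rep_one)

lemma iso_class_eq_iff:
  assumes "V \<in> Rep H" "W \<in> Rep H"
  shows "iso_class H V = iso_class H W \<longleftrightarrow> rep_iso V W"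
proof
  assume "iso_class H V = iso_class H W"
  moreover have "W \<in> iso_class H W" using assms rep_iso_refl by (simp add: iso_class_def)
  ultimately have "W \<in> iso_class H V" by simp
  then show "rep_iso V W" by (simp add: iso_class_def)
next
  assume "rep_iso V W"
  then show "iso_class H V = iso_class H W"
    unfolding iso_class_def using rep_iso_trans rep_iso_sym assms by blast
qed

end

context semisimple_hopf_algebra
begin

lemma simple_hom_iso:
  assumes X: "simple_rep H X" and Y: "simple_rep H Y" and T: "T \<in> rep_hom X Y" "T \<noteq> 0\<^sub>m (fst Y) (fst X)"
  shows "rep_iso X Y"
proof -
  note R = simple_repD(1)[OF X] simple_repD(1)[OF Y]
  obtain Q where Q: "Q \<in> rep_hom Y X" "Q * T = 1\<^sub>m (fst X)" by (rule simple_hom_from[OF X R(2) T])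
  have "rep_mono X Y T" using left_inverse_mono[OF T(1) rep_hom_carrier[OF Q(1)] Q(2)] .
  moreover have "\<forall>W\<in>Rep H. \<forall>T. rep_mono W Y T \<longrightarrow> fst W = 0 \<or> rep_isomorphism W Y T"
    using Y unfolding simple_rep_def by blast
  ultimately have "fst X = 0 \<or> rep_isomorphism X Y T" using R(1) by blast
  then have "rep_isomorphism X Y T" using simple_repD(2)[OF X] by simp
  then show ?thesis unfolding rep_iso_def by blast
qed

text \<open>Induction on the dimension, splitting off one simple summand. The two conclusions serve
  different ends: the decomposition computes characters, while the explicit isomorphism is what
  \<open>K0_class\<close> and the closure of subcategories under direct sums refer to.\<close>

lemma exists_decomposition:
  assumes "V \<in> Rep H"
  shows "\<exists>Ds. decomposition V Ds \<and> rep_iso V (direct_sum_rep (map fst Ds))"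
  using assms
proof (induction "fst V" arbitrary: V rule: less_induct)
  case less
  note V = less.prems
  show ?case
  proof (cases "fst V = 0")
    case True
    have "decomposition V []"
      unfolding decomposition_def using True by (auto intro!: eq_matI)
    moreover have "rep_iso V (direct_sum_rep (map fst []))"
      unfolding rep_iso_def rep_isomorphism_def direct_sum_rep_Nil list.map
      using True V by (intro exI[of _ "0\<^sub>m 0 0"] conjI rep_homI bexI[of _ "0\<^sub>m 0 0"] eq_matI) auto
    ultimately show ?thesis by blast
  next
    case False
    obtain X T P where X: "simple_rep H X" "T \<in> rep_hom X V" "P \<in> rep_hom V X" "P * T = 1\<^sub>m (fst X)"
      by (rule exists_simple_summand[OF V False])
    note XR = simple_repD(1)[OF X(1)] and cT = rep_hom_carrier[OF X(2)] and cP = rep_hom_carrier[OF X(3)]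
    obtain r A B where A: "A \<in> carrier_mat (fst V) r" and B: "B \<in> carrier_mat r (fst V)" and BA: "B * A = 1\<^sub>m r"
      and AB: "A * B = 1\<^sub>m (fst V) - T * P" and dim: "fst V = fst X + r"
      by (rule complementary_splitting[OF cT cP X(4)])
    have ABh: "A * B \<in> rep_hom V V"
      unfolding AB by (intro rep_hom_diff rep_hom_one V rep_hom_comp[OF V XR V X(3,2)])
    let ?W = "(r, \<lambda>h. B * snd V h * A)"
    note W = split_rep[OF V A B BA ABh]
    have "r < fst V" using dim simple_repD(2)[OF X(1)] by simp
    then obtain Ds where Ds: "decomposition ?W Ds" "rep_iso ?W (direct_sum_rep (map fst Ds))"
      using less.hyps[of ?W] W(1) by auto
    let ?Es = "(X, T, P) # map (\<lambda>(Y, C, D). (Y, A * C, D * B)) Ds"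
    have d0: "simple_rep H Y" "Y \<in> Rep H" "C \<in> rep_hom Y ?W" "D \<in> rep_hom ?W Y" "D * C = 1\<^sub>m (fst Y)"
      if "(Y, C, D) \<in> set Ds" for Y C D
      using Ds(1) that unfolding decomposition_def by (auto dest: simple_repD)
    have cc: "C \<in> carrier_mat r (fst Y)" "D \<in> carrier_mat (fst Y) r" if "(Y, C, D) \<in> set Ds" for Y C D
      using d0(3,4)[OF that, THEN rep_hom_carrier] by simp_all
    note d = d0 cc
    have BAC: "B * (A * C) = C" if "C \<in> carrier_mat r k" for C k
      using assoc_mult_mat[OF B A that] BA that by simp
    have id: "T * P + A * B = 1\<^sub>m (fst V)"
      unfolding AB using cT cP by (intro eq_matI) auto
    have "decomposition V ?Es"
      unfolding decomposition_def
    proof (intro conjI ballI)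
      fix x assume "x \<in> set ?Es"
      then consider "x = (X, T, P)" | Y C D where "(Y, C, D) \<in> set Ds" "x = (Y, A * C, D * B)" by force
      then show "case x of (X, A, B) \<Rightarrow> simple_rep H X \<and> A \<in> rep_hom X V \<and> B \<in> rep_hom V X \<and> B * A = 1\<^sub>m (fst X)"
      proof cases
        case 2
        note dd = d[OF 2(1)]
        have "D * B * (A * C) = 1\<^sub>m (fst Y)"
          using assoc_mult_mat[OF dd(7) B mult_carrier_mat[OF A dd(6)]] BAC[OF dd(6)] dd(5) by simp
        then show ?thesis
          using 2 dd rep_hom_comp[OF dd(2) W(1) V dd(3) W(2)] rep_hom_comp[OF V W(1) dd(2) W(3) dd(4)] by simp
      qed (use X in simp)
    next
      have "mat_sum (fst V) (fst V) (\<lambda>(X, A, B). A * B) (mset (map (\<lambda>(Y, C, D). (Y, A * C, D * B)) Ds)) =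
        mat_sum (fst V) (fst V) (\<lambda>(Y, C, D). A * C * (D * B)) (mset Ds)"
        unfolding mat_sum_def by (simp add: multiset.map_comp comp_def case_prod_unfold)
      also have "\<dots> = mat_sum (fst V) (fst V) (\<lambda>x. A * (case x of (Y, C, D) \<Rightarrow> C * D) * B) (mset Ds)"
      proof (rule mat_sum_cong)
        fix x assume "x \<in># mset Ds"
        moreover obtain Y C D where x: "x = (Y, C, D)" by (cases x)
        ultimately have "(Y, C, D) \<in> set Ds" by simp
        note dd = d[OF this]
        have "A * (C * D) * B = A * C * D * B" using assoc_mult_mat[OF A dd(6,7)] by simp
        also have "\<dots> = A * C * (D * B)" by (rule assoc_mult_mat[OF mult_carrier_mat[OF A dd(6)] dd(7) B])
        finally show "(case x of (Y, C, D) \<Rightarrow> A * C * (D * B)) = A * (case x of (Y, C, D) \<Rightarrow> C * D) * B"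
          by (simp add: x)
      qed
      also have "\<dots> = mat_sum (fst V) r (\<lambda>x. A * (case x of (Y, C, D) \<Rightarrow> C * D)) (mset Ds) * B"
        by (rule mat_sum_mult[OF B, symmetric]) (use A d in \<open>auto intro!: mult_carrier_mat\<close>)
      also have "mat_sum (fst V) r (\<lambda>x. A * (case x of (Y, C, D) \<Rightarrow> C * D)) (mset Ds) =
         A * mat_sum r r (\<lambda>(Y, C, D). C * D) (mset Ds)"
        by (rule mult_mat_sum[OF A, symmetric]) (use d in \<open>auto intro!: mult_carrier_mat\<close>)
      also have "mat_sum r r (\<lambda>(Y, C, D). C * D) (mset Ds) = 1\<^sub>m r"
        using Ds(1) unfolding decomposition_def by simp
      finally have "mat_sum (fst V) (fst V) (\<lambda>(X, A, B). A * B) (mset (map (\<lambda>(Y, C, D). (Y, A * C, D * B)) Ds)) = A * B"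
        using A by simp
      then have "mat_sum (fst V) (fst V) (\<lambda>(X, A, B). A * B) (mset ?Es) = T * P + A * B"
        using A B cT cP by (intro eq_matI) (auto simp: mat_eq_iff)
      then show "mat_sum (fst V) (fst V) (\<lambda>(X, A, B). A * B) (mset ?Es) = 1\<^sub>m (fst V)" using id by simp
    qed
    moreover have "rep_iso V (direct_sum_rep (map fst ?Es))"
    proof -
      let ?D = "direct_sum_rep (map fst Ds)" and ?E = "direct_sum_rep (X # map fst Ds)"
      have DR: "?D \<in> Rep H" by (rule direct_sum_rep_Rep) (use d in auto)
      have ER: "?E \<in> Rep H" by (rule direct_sum_rep_Rep) (use d XR in auto)
      obtain S S' where S: "S \<in> rep_hom ?W ?D" "S' \<in> rep_hom ?D ?W" "S' * S = 1\<^sub>m r" "S * S' = 1\<^sub>m (fst ?D)"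
        using Ds(2) unfolding rep_iso_def rep_isomorphism_def by auto
      have cS: "S \<in> carrier_mat (fst ?D) r" "S' \<in> carrier_mat r (fst ?D)"
        using S(1,2)[THEN rep_hom_carrier] by auto
      have fD: "fst ?D = r"
        using left_inverse_dim[OF cS S(3)] left_inverse_dim[OF cS(2,1) S(4)] by simp
      define A2 where "A2 = A * S'"
      define B2 where "B2 = S * B"
      have A2: "A2 \<in> rep_hom ?D V" and B2: "B2 \<in> rep_hom V ?D"
        unfolding A2_def B2_def using rep_hom_comp[OF DR W(1) V S(2) W(2)] rep_hom_comp[OF V W(1) DR W(3) S(1)] by auto
      note c2 = A2[THEN rep_hom_carrier, unfolded fD] B2[THEN rep_hom_carrier, unfolded fD]
      have "A2 * B2 = A * B"
      proof -
        have "A2 * B2 = A * (S' * (S * B))" unfolding A2_def B2_def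
          by (rule assoc_mult_mat[OF A cS(2) mult_carrier_mat[OF cS(1) B]])
        also have "S' * (S * B) = B" using assoc_mult_mat[OF cS(2,1) B] S(3) B by simp
        finally show ?thesis .
      qed
      then have id2: "T * P + A2 * B2 = 1\<^sub>m (fst V)" using id by simp
      \<comment> \<open>The isomorphism stacks the projections to \<open>X\<close> and to the
        remaining direct sum; its inverse places the two inclusions side by side. Their product in
        one order is the resolution of the identity, and as both are square the other order
        follows.\<close>
      let ?U = "four_block_mat P (0\<^sub>m (fst X) 0) B2 (0\<^sub>m r 0)" and ?U' = "four_block_mat T A2 (0\<^sub>m 0 (fst X)) (0\<^sub>m 0 r)"
      note sE = direct_sum_rep_Cons[OF XR DR, unfolded fD]
      have fE: "fst ?E = fst V" using sE dim by simp
      have U'U: "?U' * ?U = 1\<^sub>m (fst V)" using mult_row_col_blocks[OF cT c2(1) cP c2(2)] id2 by simp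
      have cU: "?U \<in> carrier_mat (fst V) (fst V)" "?U' \<in> carrier_mat (fst V) (fst V)"
        using cT cP c2 dim by (auto intro!: carrier_matI)
      have UU': "?U * ?U' = 1\<^sub>m (fst V)" by (rule mat_mult_left_right_inverse[OF cU(2,1) U'U])
      have "?U \<in> rep_hom V ?E"
      proof (rule rep_homI)
        fix h
        have "?U * snd V h = four_block_mat (P * snd V h) (0\<^sub>m (fst X) 0) (B2 * snd V h) (0\<^sub>m r 0)"
          by (rule mult_left_blocks[OF Rep_carrier[OF V] cP c2(2)])
        also have "\<dots> = four_block_mat (snd X h * P) (0\<^sub>m (fst X) 0) (snd ?D h * B2) (0\<^sub>m r 0)"
          using rep_hom_comm[OF X(3)] rep_hom_comm[OF B2] by simp
        also have "\<dots> = snd ?E h * ?U"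
          unfolding sE(2) using Rep_carrier[OF XR, of h] Rep_carrier[OF DR, of h] cP c2 fD
          by (subst mult_four_block_mat[where ?nr1.0 = "fst X" and ?n1.0 = "fst X" and ?n2.0 = r and ?nr2.0 = r and ?nc1.0 = "fst V" and ?nc2.0 = 0])
            (auto intro!: arg_cong4[where f = four_block_mat] simp: mult_carrier_mat[of _ _ "fst X"] mult_carrier_mat[of _ _ r])
        finally show "?U * snd V h = snd ?E h * ?U" .
      qed (use cU fE in simp)
      moreover have "?U' \<in> rep_hom ?E V"
      proof (rule rep_homI)
        fix h
        have "snd V h * ?U' = four_block_mat (snd V h * T) (snd V h * A2) (0\<^sub>m 0 (fst X)) (0\<^sub>m 0 r)"
          by (rule mult_right_blocks[OF Rep_carrier[OF V] cT c2(1)])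
        also have "\<dots> = four_block_mat (T * snd X h) (A2 * snd ?D h) (0\<^sub>m 0 (fst X)) (0\<^sub>m 0 r)"
          using rep_hom_comm[OF X(2)] rep_hom_comm[OF A2] by simp
        also have "\<dots> = ?U' * snd ?E h"
          unfolding sE(2) using Rep_carrier[OF XR, of h] Rep_carrier[OF DR, of h] cT c2 fD
          by (subst mult_row_blocks[where n = "fst V" and k = "fst X" and l = r])
            (auto intro!: arg_cong4[where f = four_block_mat] simp: mult_carrier_mat[of _ _ "fst X"] mult_carrier_mat[of _ _ r])
        finally show "?U' * snd ?E h = snd V h * ?U'" by simp
      qed (use cU fE in simp)
      ultimately show ?thesis
        unfolding rep_iso_def rep_isomorphism_def using UU' U'U fE
        by (auto simp: case_prod_unfold comp_def)
    qed
    ultimately show ?thesis by blast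
  qed
qed

end

section \<open>Central idempotents and multiplicities\<close>

lemma sum_list_filter_partition:
  assumes "finite B" "\<And>x. x \<in> set xs \<Longrightarrow> c x \<in> B"
  shows "(\<Sum>x\<leftarrow>xs. g (c x)) = (\<Sum>b\<in>B. of_nat (length (filter (\<lambda>x. c x = b) xs)) * (g b :: 'a::semiring_1))"
  using assms(2)
proof (induction xs)
  case (Cons x xs)
  have "(\<Sum>b\<in>B. of_nat (length (filter (\<lambda>y. c y = b) (x # xs))) * g b) =
    (\<Sum>b\<in>B. (if b = c x then g b else 0) + of_nat (length (filter (\<lambda>y. c y = b) xs)) * g b)"
    by (rule sum.cong) (auto simp: algebra_simps)
  also have "\<dots> = g (c x) + (\<Sum>b\<in>B. of_nat (length (filter (\<lambda>y. c y = b) xs)) * g b)"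
    using Cons.prems assms(1) by (simp add: sum.distrib)
  finally show ?case using Cons by simp
qed simp

context semisimple_hopf_algebra
begin

lemma rep_iso_dim_eq:
  fixes V W :: "('k, 'h) rep"
  assumes "rep_iso V W"
  shows "fst V = fst W"
proof -
  obtain T T' where T: "T \<in> rep_hom V W" "T' \<in> rep_hom W V" "T * T' = 1\<^sub>m (fst W)" "T' * T = 1\<^sub>m (fst V)"
    using assms unfolding rep_iso_def rep_isomorphism_def by blast
  note c = T(1,2)[THEN rep_hom_carrier]
  show ?thesis using left_inverse_dim[OF c T(4)] left_inverse_dim[OF c(2,1) T(3)] by simp
qed

lemma simple_rep_iso:
  assumes X: "simple_rep H X" and W: "W \<in> Rep H" and iso: "rep_iso X W"
  shows "simple_rep H W"
  unfolding simple_rep_def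
proof (intro conjI ballI allI impI)
  show "fst W \<noteq> 0" using rep_iso_dim_eq[OF iso] simple_repD(2)[OF X] by simp
  obtain S where S: "rep_isomorphism W X S"
    using rep_iso_sym[OF iso] unfolding rep_iso_def by blast
  then obtain S' where S': "S \<in> rep_hom W X" "S' \<in> rep_hom X W" "S * S' = 1\<^sub>m (fst X)" "S' * S = 1\<^sub>m (fst W)"
    unfolding rep_isomorphism_def by blast
  have SI: "rep_isomorphism X W S'" using S' unfolding rep_isomorphism_def by blast
  note XR = simple_repD(1)[OF X]
  note c = S'(1,2)[THEN rep_hom_carrier]
  fix U T assume U: "U \<in> Rep H" and T: "rep_mono U W T"
  have Th: "T \<in> rep_hom U W" using T by (simp add: rep_mono_def)
  note cT = rep_hom_carrier[OF Th]
  obtain Q where Q: "Q \<in> rep_hom W U" "Q * T = 1\<^sub>m (fst U)" by (rule mono_retraction[OF U W T])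
  note cQ = rep_hom_carrier[OF Q(1)]
  have ST: "S * T \<in> rep_hom U X" by (rule rep_hom_comp[OF U W XR Th S'(1)])
  have S'ST: "S' * (S * T) = T" using assoc_mult_mat[OF c(2,1) cT] S'(4) cT by simp
  have "Q * S' * (S * T) = 1\<^sub>m (fst U)"
    using assoc_mult_mat[OF cQ c(2) mult_carrier_mat[OF c(1) cT]] S'ST Q(2) by simp
  then have "rep_mono U X (S * T)"
    using left_inverse_mono[OF ST mult_carrier_mat[OF cQ c(2)]] by simp
  then have "fst U = 0 \<or> rep_isomorphism U X (S * T)" using X U unfolding simple_rep_def by blast
  then show "fst U = 0 \<or> rep_isomorphism U W T"
    using rep_isomorphism_comp[OF U XR W _ SI] S'ST by fastforce
qed (rule W)

text \<open>A decomposition of the left regular representation, written in the algebra itself: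
  \<phi> s is column s of the inclusion of X, read as an element of H, and \<beta> s is coordinate s
  of the projection of 1 to X. Equivariance of the inclusion is the transformation rule of
  \<phi>.\<close>

lemma simple_spanning:
  obtains Ds :: "(('k, 'h) rep \<times> (nat \<Rightarrow> 'h) \<times> (nat \<Rightarrow> 'k)) list" where
    "\<forall>X \<phi> \<beta>. (X, \<phi>, \<beta>) \<in> set Ds \<longrightarrow> simple_rep H X"
    "\<forall>X \<phi> \<beta> h s. (X, \<phi>, \<beta>) \<in> set Ds \<longrightarrow> s < fst X \<longrightarrow> h * \<phi> s = (\<Sum>s'<fst X. scale H (snd X h $$ (s', s)) (\<phi> s'))"
    "1 = (\<Sum>(X, \<phi>, \<beta>)\<leftarrow>Ds. \<Sum>s<fst X. scale H (\<beta> s) (\<phi> s))"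
proof -
  obtain B where B: "finite B" "independent B" "span B = UNIV"
    by (rule semisimple_finite_dimensional[OF semisimple])
  obtain bs where bs: "set bs = B" "distinct bs" using finite_distinct_list[OF B(1)] by blast
  define N where "N = length bs"
  define \<kappa> where "\<kappa> x i = representation B x (bs ! i)" for x i
  have bsB: "i < N \<Longrightarrow> bs ! i \<in> B" for i using bs by (auto simp: N_def)
  have k_add: "\<kappa> (x + y) i = \<kappa> x i + \<kappa> y i" for x y i
    using B by (simp add: \<kappa>_def representation_add)
  have k_scale: "\<kappa> (scale H c x) i = c * \<kappa> x i" for c x i
    using B by (simp add: \<kappa>_def representation_scale)
  have k_0: "\<kappa> 0 i = 0" for i by (simp add: \<kappa>_def representation_zero)
  have k_sum: "\<kappa> (\<Sum>j\<in>J. f j) i = (\<Sum>j\<in>J. \<kappa> (f j) i)" for f :: "nat \<Rightarrow> 'h" and J i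
    by (induction J rule: infinite_finite_induct) (auto simp: k_add k_0)
  have k_basis: "\<kappa> (bs ! j) i = (if i = j then 1 else 0)" if "i < N" "j < N" for i j
    using representation_basis[OF B(2) bsB[OF that(2)]] bs that
    by (auto simp: \<kappa>_def N_def nth_eq_iff_index_eq)
  have expand: "(\<Sum>i<N. scale H (\<kappa> x i) (bs ! i)) = x" for x
  proof -
    have "(\<Sum>i<N. scale H (\<kappa> x i) (bs ! i)) = (\<Sum>b\<in>B. scale H (representation B x b) b)"
      unfolding \<kappa>_def by (rule sum.reindex_bij_betw) (use bij_betw_nth[OF bs(2)] bs(1) N_def in \<open>auto simp: lessThan_atLeast0\<close>)
    also have "\<dots> = x" using sum_representation_eq[of B x B] B by simp
    finally show ?thesis .
  qed
  have k_eq: "x = y" if "\<And>i. i < N \<Longrightarrow> \<kappa> x i = \<kappa> y i" for x y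
  proof -
    have "(\<Sum>i<N. scale H (\<kappa> x i) (bs ! i)) = (\<Sum>i<N. scale H (\<kappa> y i) (bs ! i))"
      by (rule sum.cong) (use that in auto)
    then show ?thesis unfolding expand .
  qed
  have k_comb: "\<kappa> (\<Sum>j<N. scale H (a j) (bs ! j)) i = a i" if "i < N" for a i
    using that by (simp add: k_sum k_scale k_basis if_distrib[of "\<lambda>x. _ * x"] cong: if_cong)
  have k_mult: "\<kappa> (h * x) i = (\<Sum>j<N. \<kappa> (h * bs ! j) i * \<kappa> x j)" for h x i
  proof -
    have "\<kappa> (h * x) i = \<kappa> (h * (\<Sum>j<N. scale H (\<kappa> x j) (bs ! j))) i" by (simp only: expand)
    also have "\<dots> = (\<Sum>j<N. \<kappa> (h * bs ! j) i * \<kappa> x j)"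
      by (simp add: sum_distrib_left scale_mult_right k_sum k_scale mult.commute)
    finally show ?thesis .
  qed
  \<comment> \<open>The left regular representation in the coordinates
    \<open>\<kappa>\<close>.\<close>
  define R where "R = (N, \<lambda>h. mat N N (\<lambda>(i, j). \<kappa> (h * bs ! j) i))"
  have R: "R \<in> Rep H"
    unfolding R_def
  proof (rule RepI)
    fix x y
    show "mat N N (\<lambda>(i, j). \<kappa> (x * y * bs ! j) i) = mat N N (\<lambda>(i, j). \<kappa> (x * bs ! j) i) * mat N N (\<lambda>(i, j). \<kappa> (y * bs ! j) i)"
      using k_mult[of x "y * _"]
      by (intro eq_matI) (auto simp: mult.assoc scalar_prod_def lessThan_atLeast0)
  qed (auto intro!: eq_matI simp: k_add k_scale scale_mult_left distrib_right k_basis)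
  have fR: "fst R = N" and sR: "i < N \<Longrightarrow> j < N \<Longrightarrow> snd R h $$ (i, j) = \<kappa> (h * bs ! j) i" for i j h
    by (simp_all add: R_def)
  obtain Es where Es: "decomposition R Es" using exists_decomposition[OF R] by blast
  define \<phi> where "\<phi> A s = (\<Sum>i<N. scale H (A $$ (i, s)) (bs ! i))" for A :: "'k mat" and s :: nat
  define \<beta> where "\<beta> B s = (\<Sum>j<N. B $$ (s, j) * \<kappa> 1 j)" for B :: "'k mat" and s :: nat
  have es: "simple_rep H X" "A \<in> rep_hom X R" "A \<in> carrier_mat N (fst X)" "B \<in> carrier_mat (fst X) N"
    if "(X, A, B) \<in> set Es" for X A B
    using Es that unfolding decomposition_def fR[symmetric] by (auto dest: rep_hom_carrier)
  have k_phi: "\<kappa> (\<phi> A s) i = A $$ (i, s)" if "i < N" for A s i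
    using k_comb[OF that] by (simp add: \<phi>_def)
  let ?Ds = "map (\<lambda>(X, A, B). (X, \<phi> A, \<beta> B)) Es"
  show ?thesis
  proof (rule that[of ?Ds]; (intro allI impI)?)
    show "simple_rep H X" if "(X, f, b) \<in> set ?Ds" for X f b using that es by auto
    show "h * f s = (\<Sum>s'<fst X. scale H (snd X h $$ (s', s)) (f s'))" if D: "(X, f, b) \<in> set ?Ds" and s: "s < fst X" for X f b h s
    proof -
      obtain A B where A: "(X, A, B) \<in> set Es" and f: "f = \<phi> A" using D by auto
      note e = es[OF A]
      have XR: "X \<in> Rep H" using simple_repD(1)[OF e(1)] .
      show ?thesis
      proof (rule k_eq)
        fix i assume i: "i < N"
        have "\<kappa> (h * f s) i = (\<Sum>j<N. snd R h $$ (i, j) * A $$ (j, s))"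
          unfolding f k_mult[of h "\<phi> A s"] using i by (intro sum.cong) (auto simp: sR k_phi)
        also have "\<dots> = (snd R h * A) $$ (i, s)"
          using mult_entry[OF Rep_carrier[OF R, unfolded fR] e(3) i s] by simp
        also have "\<dots> = (A * snd X h) $$ (i, s)" using rep_hom_comm[OF e(2)] by simp
        also have "\<dots> = (\<Sum>s'<fst X. A $$ (i, s') * snd X h $$ (s', s))"
          by (rule mult_entry[OF e(3) Rep_carrier[OF XR] i s])
        also have "\<dots> = \<kappa> (\<Sum>s'<fst X. scale H (snd X h $$ (s', s)) (f s')) i"
          using i by (simp add: k_sum k_scale f k_phi mult.commute)
        finally show "\<kappa> (h * f s) i = \<kappa> (\<Sum>s'<fst X. scale H (snd X h $$ (s', s)) (f s')) i" .
      qed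
    qed
    show "1 = (\<Sum>(X, f, b)\<leftarrow>?Ds. \<Sum>s<fst X. scale H (b s) (f s))"
    proof (rule k_eq)
      fix i assume i: "i < N"
      have k_list: "\<kappa> (\<Sum>x\<leftarrow>xs. g x) i = (\<Sum>x\<leftarrow>xs. \<kappa> (g x) i)" for xs :: "(('k, 'h) rep \<times> 'k mat \<times> 'k mat) list" and g
        by (induction xs) (auto simp: k_0 k_add)
      have "\<kappa> (\<Sum>(X, f, b)\<leftarrow>?Ds. \<Sum>s<fst X. scale H (b s) (f s)) i =
        \<kappa> (\<Sum>(X, A, B)\<leftarrow>Es. \<Sum>s<fst X. scale H (\<beta> B s) (\<phi> A s)) i"
        by (simp add: comp_def case_prod_unfold)
      also have "\<dots> = (\<Sum>(X, A, B)\<leftarrow>Es. \<Sum>s<fst X. \<beta> B s * A $$ (i, s))"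
        using i by (simp add: k_list case_prod_unfold k_sum k_scale k_phi)
      also have "map (\<lambda>(X, A, B). \<Sum>s<fst X. \<beta> B s * A $$ (i, s)) Es =
         map (\<lambda>(X, A, B). \<Sum>j<N. (A * B) $$ (i, j) * \<kappa> 1 j) Es"
      proof (rule map_cong[OF HOL.refl])
        fix x assume "x \<in> set Es"
        moreover obtain X A B where x: "x = (X, A, B)" by (cases x)
        ultimately have "(X, A, B) \<in> set Es" by simp
        note e = es[OF this]
        have "(\<Sum>s<fst X. \<beta> B s * A $$ (i, s)) = (\<Sum>j<N. \<Sum>s<fst X. A $$ (i, s) * B $$ (s, j) * \<kappa> 1 j)"
          unfolding \<beta>_def sum_distrib_right by (subst sum.swap) (simp add: mult_ac)
        also have "\<dots> = (\<Sum>j<N. (A * B) $$ (i, j) * \<kappa> 1 j)"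
          using i by (intro sum.cong) (auto simp: mult_entry[OF e(3,4)] sum_distrib_right simp del: index_mult_mat(1))
        finally show "(case x of (X, A, B) \<Rightarrow> \<Sum>s<fst X. \<beta> B s * A $$ (i, s)) =
          (case x of (X, A, B) \<Rightarrow> \<Sum>j<N. (A * B) $$ (i, j) * \<kappa> 1 j)" by (simp add: x)
      qed
      also have "(\<Sum>(X, A, B)\<leftarrow>Es. \<Sum>j<N. (A * B) $$ (i, j) * \<kappa> 1 j) =
        (\<Sum>j<N. mat_sum N N (\<lambda>(X, A, B). A * B) (mset Es) $$ (i, j) * \<kappa> 1 j)"
        using i by (simp add: sum_mset_sum_list flip: mset_map)
           (simp add: sum_mset_distrib_right sum_mset_sum_swap case_prod_unfold multiset.map_comp comp_def flip: sum_mset_sum_list)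
      also have "\<dots> = (\<Sum>j<N. 1\<^sub>m N $$ (i, j) * \<kappa> 1 j)"
        using Es unfolding decomposition_def fR by simp
      also have "\<dots> = \<kappa> 1 i" using i by (simp add: if_distrib[of "\<lambda>x. x * _"] cong: if_cong)
      finally show "\<kappa> 1 i = \<kappa> (\<Sum>(X, f, b)\<leftarrow>?Ds. \<Sum>s<fst X. scale H (b s) (f s)) i" by simp
    qed
  qed
qed

end

section \<open>Faithfulness of the simple objects and tests on matrix coefficients\<close>

context semisimple_hopf_algebra
begin

text \<open>Multiplying the expansion of 1 by h from the left expresses h through its own matrix
  entries in simple objects, with coefficients that do not depend on h.\<close>

lemma simple_expansion:
  obtains Ds :: "(('k, 'h) rep \<times> (nat \<Rightarrow> 'h) \<times> (nat \<Rightarrow> 'k)) list" where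
    "\<forall>X \<phi> \<beta>. (X, \<phi>, \<beta>) \<in> set Ds \<longrightarrow> simple_rep H X"
    "\<forall>h. h = (\<Sum>(X, \<phi>, \<beta>)\<leftarrow>Ds. \<Sum>s<fst X. \<Sum>s'<fst X. scale H (\<beta> s * snd X h $$ (s', s)) (\<phi> s'))"
proof -
  obtain Ds :: "(('k, 'h) rep \<times> (nat \<Rightarrow> 'h) \<times> (nat \<Rightarrow> 'k)) list" where Ds0:
    "\<forall>X \<phi> \<beta>. (X, \<phi>, \<beta>) \<in> set Ds \<longrightarrow> simple_rep H X"
    "\<forall>X \<phi> \<beta> h s. (X, \<phi>, \<beta>) \<in> set Ds \<longrightarrow> s < fst X \<longrightarrow> h * \<phi> s = (\<Sum>s'<fst X. scale H (snd X h $$ (s', s)) (\<phi> s'))"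
    "1 = (\<Sum>(X, \<phi>, \<beta>)\<leftarrow>Ds. \<Sum>s<fst X. scale H (\<beta> s) (\<phi> s))"
    by (rule simple_spanning)
  note Ds = Ds0(1,2)[rule_format] Ds0(3)
  have "h = (\<Sum>(X, \<phi>, \<beta>)\<leftarrow>Ds. \<Sum>s<fst X. \<Sum>s'<fst X. scale H (\<beta> s * snd X h $$ (s', s)) (\<phi> s'))" for h
  proof -
    have "h = h * (\<Sum>(X, \<phi>, \<beta>)\<leftarrow>Ds. \<Sum>s<fst X. scale H (\<beta> s) (\<phi> s))"
      unfolding Ds(3)[symmetric] by simp
    also have "\<dots> = (\<Sum>(X, \<phi>, \<beta>)\<leftarrow>Ds. \<Sum>s<fst X. scale H (\<beta> s) (h * \<phi> s))"
      by (simp add: sum_list_const_mult case_prod_unfold sum_distrib_left scale_mult_right comp_def flip: sum_list_const_mult)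
    also have "map (\<lambda>(X, \<phi>, \<beta>). \<Sum>s<fst X. scale H (\<beta> s) (h * \<phi> s)) Ds =
      map (\<lambda>(X, \<phi>, \<beta>). \<Sum>s<fst X. \<Sum>s'<fst X. scale H (\<beta> s * snd X h $$ (s', s)) (\<phi> s')) Ds"
      by (rule map_cong[OF HOL.refl]) (auto simp: Ds(2) scale_sum_right intro!: sum.cong)
    finally show ?thesis .
  qed
  with Ds0(1) show ?thesis using that by blast
qed

lemma simple_faithful:
  assumes "\<And>X. simple_rep H X \<Longrightarrow> snd X x = snd X y"
  shows "x = y"
proof -
  obtain Ds :: "(('k, 'h) rep \<times> (nat \<Rightarrow> 'h) \<times> (nat \<Rightarrow> 'k)) list" where Ds0:
    "\<forall>X \<phi> \<beta>. (X, \<phi>, \<beta>) \<in> set Ds \<longrightarrow> simple_rep H X"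
    "\<forall>h. h = (\<Sum>(X, \<phi>, \<beta>)\<leftarrow>Ds. \<Sum>s<fst X. \<Sum>s'<fst X. scale H (\<beta> s * snd X h $$ (s', s)) (\<phi> s'))"
    by (rule simple_expansion)
  note Ds = Ds0(1,2)[rule_format]
  have "map (\<lambda>(X, \<phi>, \<beta>). \<Sum>s<fst X. \<Sum>s'<fst X. scale H (\<beta> s * snd X x $$ (s', s)) (\<phi> s')) Ds =
    map (\<lambda>(X, \<phi>, \<beta>). \<Sum>s<fst X. \<Sum>s'<fst X. scale H (\<beta> s * snd X y $$ (s', s)) (\<phi> s')) Ds"
  proof (rule map_cong[OF HOL.refl])
    fix D assume "D \<in> set Ds"
    moreover obtain X \<phi> \<beta> where D: "D = (X, \<phi>, \<beta>)" by (cases D)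
    ultimately have "snd X x = snd X y" using assms Ds(1) by simp
    then show "(case D of (X, \<phi>, \<beta>) \<Rightarrow> \<Sum>s<fst X. \<Sum>s'<fst X. scale H (\<beta> s * snd X x $$ (s', s)) (\<phi> s')) =
      (case D of (X, \<phi>, \<beta>) \<Rightarrow> \<Sum>s<fst X. \<Sum>s'<fst X. scale H (\<beta> s * snd X y $$ (s', s)) (\<phi> s'))"
      by (simp add: D)
  qed
  from HOL.trans[OF HOL.trans[OF Ds(2)[of x] arg_cong[OF this, of sum_list]] Ds(2)[of y, symmetric]] show ?thesis .
qed

text \<open>By \<open>simple_expansion\<close> every linear form is a fixed linear combination of
  matrix coefficients of simple objects. The extra factor G can contain the other leg of a tensor,
  so that the two legs are treated one after the other.\<close>

lemma linear_functional_sum_eqI: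
  fixes G :: "'b \<Rightarrow> 'k"
  assumes f: "Vector_Spaces.linear (scale H) (*) f"
    and eq: "\<And>X i j. simple_rep H X \<Longrightarrow> i < fst X \<Longrightarrow> j < fst X \<Longrightarrow>
      (\<Sum>x\<in>#M. snd X (p x) $$ (i, j) * G x) = (\<Sum>x\<in>#N. snd X (p x) $$ (i, j) * G x)"
  shows "(\<Sum>x\<in>#M. f (p x) * G x) = (\<Sum>x\<in>#N. f (p x) * G x)"
proof -
  obtain Ds :: "(('k, 'h) rep \<times> (nat \<Rightarrow> 'h) \<times> (nat \<Rightarrow> 'k)) list" where Ds0:
    "\<forall>X \<phi> \<beta>. (X, \<phi>, \<beta>) \<in> set Ds \<longrightarrow> simple_rep H X"
    "\<forall>h. h = (\<Sum>(X, \<phi>, \<beta>)\<leftarrow>Ds. \<Sum>s<fst X. \<Sum>s'<fst X. scale H (\<beta> s * snd X h $$ (s', s)) (\<phi> s'))"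
    by (rule simple_expansion)
  note Ds = Ds0(1,2)[rule_format]
  have fa: "f (x + y) = f x + f y" and fs: "f (scale H c x) = c * f x" for x y c
    using f by (simp_all add: Vector_Spaces.linear_iff)
  have f0: "f 0 = 0" using fs[of 0 0] by simp
  have fsum: "f (\<Sum>s<n. g s) = (\<Sum>s<n. f (g s))" for n :: nat and g
    by (induction n) (auto simp: f0 fa)
  have flist: "f (\<Sum>x\<leftarrow>xs. g x) = (\<Sum>x\<leftarrow>xs. f (g x))" for xs :: "(('k, 'h) rep \<times> (nat \<Rightarrow> 'h) \<times> (nat \<Rightarrow> 'k)) list" and g
    by (induction xs) (auto simp: f0 fa)
  have fh: "f h = (\<Sum>(X, \<phi>, \<beta>)\<in>#mset Ds. \<Sum>s<fst X. \<Sum>s'<fst X. \<beta> s * snd X h $$ (s', s) * f (\<phi> s'))" for h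
    by (subst Ds(2)[of h]) (simp add: flist fsum fs case_prod_unfold sum_mset_sum_list flip: mset_map)
  have key: "(\<Sum>x\<in>#M. f (p x) * G x) =
    (\<Sum>(X, \<phi>, \<beta>)\<in>#mset Ds. \<Sum>s<fst X. \<Sum>s'<fst X. \<beta> s * f (\<phi> s') * (\<Sum>x\<in>#M. snd X (p x) $$ (s', s) * G x))" for M
  proof -
    have fg: "f h * g = (\<Sum>D\<in>#mset Ds. case D of (X, \<phi>, \<beta>) \<Rightarrow>
        \<Sum>s<fst X. \<Sum>s'<fst X. \<beta> s * f (\<phi> s') * (snd X h $$ (s', s) * g))" for h g
      by (subst fh) (simp add: sum_mset_distrib_right case_prod_unfold sum_distrib_right sum_distrib_left mult_ac multiset.map_comp comp_def)
    have "(\<Sum>x\<in>#M. f (p x) * G x) = (\<Sum>x\<in>#M. \<Sum>D\<in>#mset Ds. case D of (X, \<phi>, \<beta>) \<Rightarrow>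
        \<Sum>s<fst X. \<Sum>s'<fst X. \<beta> s * f (\<phi> s') * (snd X (p x) $$ (s', s) * G x))"
      by (rule arg_cong[where f = sum_mset], rule image_mset_cong, rule fg)
    also have "\<dots> = (\<Sum>D\<in>#mset Ds. \<Sum>x\<in>#M. case D of (X, \<phi>, \<beta>) \<Rightarrow>
        \<Sum>s<fst X. \<Sum>s'<fst X. \<beta> s * f (\<phi> s') * (snd X (p x) $$ (s', s) * G x))"
      by (rule sum_mset.swap)
    finally show ?thesis
      by (simp add: case_prod_unfold sum_mset_sum_swap sum_mset_distrib_left multiset.map_comp comp_def)
  qed
  show ?thesis
    unfolding key
  proof (rule arg_cong[where f = sum_mset], rule image_mset_cong)
    fix D assume "D \<in># mset Ds"
    moreover obtain X \<phi> \<beta> where D: "D = (X, \<phi>, \<beta>)" by (cases D)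
    ultimately have X: "simple_rep H X" using Ds(1) by simp
    show "(case D of (X, \<phi>, \<beta>) \<Rightarrow> \<Sum>s<fst X. \<Sum>s'<fst X. \<beta> s * f (\<phi> s') * (\<Sum>x\<in>#M. snd X (p x) $$ (s', s) * G x)) =
      (case D of (X, \<phi>, \<beta>) \<Rightarrow> \<Sum>s<fst X. \<Sum>s'<fst X. \<beta> s * f (\<phi> s') * (\<Sum>x\<in>#N. snd X (p x) $$ (s', s) * G x))"
      unfolding D prod.case
      by (intro sum.cong HOL.refl arg_cong2[where f = "(*)"] eq[OF X]) auto
  qed
qed

lemma teq_simpleI:
  assumes "\<And>X Y i j k l. simple_rep H X \<Longrightarrow> simple_rep H Y \<Longrightarrow> i < fst X \<Longrightarrow> j < fst X \<Longrightarrow> k < fst Y \<Longrightarrow> l < fst Y \<Longrightarrow>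
      (\<Sum>(a, b)\<in>#M. snd X a $$ (i, j) * snd Y b $$ (k, l)) = (\<Sum>(a, b)\<in>#N. snd X a $$ (i, j) * snd Y b $$ (k, l))"
  shows "teq H (pure2 M) (pure2 N)"
proof -
  obtain B where B: "finite B" "independent B" "span B = UNIV"
    by (rule semisimple_finite_dimensional[OF semisimple])
  show ?thesis
  proof (rule teq_pure2I[OF B])
    fix f g assume f: "Vector_Spaces.linear (scale H) (*) f" and g: "Vector_Spaces.linear (scale H) (*) g"
    have 1: "(\<Sum>x\<in>#M. g (snd x) * snd X (fst x) $$ (i, j)) = (\<Sum>x\<in>#N. g (snd x) * snd X (fst x) $$ (i, j))"
      if "simple_rep H X" "i < fst X" "j < fst X" for X i j
      by (rule linear_functional_sum_eqI[OF g])
        (use assms[OF that(1) _ that(2,3)] in \<open>simp add: case_prod_unfold mult.commute\<close>)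
    have "(\<Sum>x\<in>#M. f (fst x) * g (snd x)) = (\<Sum>x\<in>#N. f (fst x) * g (snd x))"
      by (rule linear_functional_sum_eqI[OF f]) (use 1 in \<open>simp add: mult.commute\<close>)
    then show "(\<Sum>(a, b)\<in>#M. f a * g b) = (\<Sum>(a, b)\<in>#N. f a * g b)" by (simp add: case_prod_unfold)
  qed
qed

lemma Rep_sum_list_zero:
  assumes "V \<in> Rep H" "\<And>x. x \<in> set xs \<Longrightarrow> snd V (f x) = 0\<^sub>m (fst V) (fst V)"
  shows "snd V (\<Sum>x\<leftarrow>xs. f x) = 0\<^sub>m (fst V) (fst V)"
  using assms(2) by (induction xs) (auto simp: Rep_zero[OF assms(1)] Rep_add[OF assms(1)])

lemma Rep_sum_zero:
  assumes "V \<in> Rep H" "\<And>x. x \<in> A \<Longrightarrow> snd V (f x) = 0\<^sub>m (fst V) (fst V)"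
  shows "snd V (\<Sum>x\<in>A. f x) = 0\<^sub>m (fst V) (fst V)"
  using assms(2)
  by (induction A rule: infinite_finite_induct) (auto simp: Rep_zero[OF assms(1)] Rep_add[OF assms(1)])

text \<open>Here w is the part of 1 coming from one simple summand X of the regular representation.
  It kills every simple Y of another class, since the action of w on Y is assembled from morphisms
  from X to Y.\<close>

lemma isotypic_spanning:
  obtains Ws :: "(('k, 'h) rep \<times> 'h) list" where
    "\<forall>X w. (X, w) \<in> set Ws \<longrightarrow> simple_rep H X" "1 = (\<Sum>(X, w)\<leftarrow>Ws. w)"
    "\<forall>X w Y. (X, w) \<in> set Ws \<longrightarrow> simple_rep H Y \<longrightarrow> iso_class H X \<noteq> iso_class H Y \<longrightarrow> snd Y w = 0\<^sub>m (fst Y) (fst Y)"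
proof -
  obtain Ds :: "(('k, 'h) rep \<times> (nat \<Rightarrow> 'h) \<times> (nat \<Rightarrow> 'k)) list" where Ds0:
    "\<forall>X \<phi> \<beta>. (X, \<phi>, \<beta>) \<in> set Ds \<longrightarrow> simple_rep H X"
    "\<forall>X \<phi> \<beta> h s. (X, \<phi>, \<beta>) \<in> set Ds \<longrightarrow> s < fst X \<longrightarrow> h * \<phi> s = (\<Sum>s'<fst X. scale H (snd X h $$ (s', s)) (\<phi> s'))"
    "1 = (\<Sum>(X, \<phi>, \<beta>)\<leftarrow>Ds. \<Sum>s<fst X. scale H (\<beta> s) (\<phi> s))"
    by (rule simple_spanning)
  note Ds = Ds0(1,2)[rule_format] Ds0(3)
  let ?Ws = "map (\<lambda>(X, \<phi>, \<beta>). (X, \<Sum>s<fst X. scale H (\<beta> s) (\<phi> s))) Ds"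
  show ?thesis
  proof (rule that[of ?Ws]; (intro allI impI)?)
    show "simple_rep H X" if "(X, w) \<in> set ?Ws" for X w using that Ds(1) by auto
    show "1 = (\<Sum>(X, w)\<leftarrow>?Ws. w)" using Ds(3) by (simp add: case_prod_unfold comp_def)
    fix X w Y assume W: "(X, w) \<in> set ?Ws" and Y: "simple_rep H Y" and ne: "iso_class H X \<noteq> iso_class H Y"
    obtain \<phi> \<beta> where D: "(X, \<phi>, \<beta>) \<in> set Ds" and w: "w = (\<Sum>s<fst X. scale H (\<beta> s) (\<phi> s))" using W by auto
    note X = Ds(1)[OF D] and YR = simple_repD(1)[OF Y]
    note XR = simple_repD(1)[OF X]
    have Ysum: "snd Y (\<Sum>s<n. f s) $$ (i, j) = (\<Sum>s<n. snd Y (f s) $$ (i, j))" if "i < fst Y" "j < fst Y" for n :: nat and f i j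
      using that YR by (induction n) (auto simp: Rep_zero Rep_add)
    have "snd Y (\<phi> s) $$ (p, q) = 0" if s: "s < fst X" and pq: "p < fst Y" "q < fst Y" for s p q
    proof -
      \<comment> \<open>For a fixed column q, the q-th columns of the matrices by which the \<phi> s
        act on Y, taken together, form the matrix of a morphism from X to Y: the transformation rule
        of \<phi> is exactly equivariance. By Schur's lemma it vanishes.\<close>
      define Q where "Q = mat (fst Y) (fst X) (\<lambda>(p, s). snd Y (\<phi> s) $$ (p, q))"
      have Qc: "Q \<in> carrier_mat (fst Y) (fst X)" by (simp add: Q_def)
      have "Q \<in> rep_hom X Y"
      proof (rule rep_homI[OF Qc], rule eq_matI)
        fix h i j assume "i < dim_row (snd Y h * Q)" "j < dim_col (snd Y h * Q)"
        then have ij: "i < fst Y" "j < fst X" using YR Qc by auto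
        have "(Q * snd X h) $$ (i, j) = (\<Sum>s<fst X. snd Y (\<phi> s) $$ (i, q) * snd X h $$ (s, j))"
          using ij by (subst mult_entry[OF Qc Rep_carrier[OF XR]]) (auto simp: Q_def)
        also have "\<dots> = snd Y (\<Sum>s<fst X. scale H (snd X h $$ (s, j)) (\<phi> s)) $$ (i, q)"
          using ij pq YR by (simp add: Ysum Rep_scale mult.commute)
        also have "\<dots> = snd Y (h * \<phi> j) $$ (i, q)" by (simp only: Ds(2)[OF D ij(2)])
        also have "\<dots> = (\<Sum>l<fst Y. snd Y h $$ (i, l) * snd Y (\<phi> j) $$ (l, q))"
          unfolding Rep_mult[OF YR] by (rule mult_entry[OF Rep_carrier[OF YR] Rep_carrier[OF YR] ij(1) pq(2)])
        also have "\<dots> = (snd Y h * Q) $$ (i, j)"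
          using ij by (subst mult_entry[OF Rep_carrier[OF YR] Qc]) (auto simp: Q_def)
        finally show "(Q * snd X h) $$ (i, j) = (snd Y h * Q) $$ (i, j)" .
      qed (use XR YR Qc in auto)
      moreover have "\<not> rep_iso X Y" using ne iso_class_eq_iff[OF XR YR] by simp
      ultimately have "Q = 0\<^sub>m (fst Y) (fst X)" using simple_hom_iso[OF X Y] by blast
      then have "Q $$ (p, s) = 0" using pq s by simp
      then show ?thesis using pq s by (simp add: Q_def)
    qed
    then have "snd Y (\<phi> s) = 0\<^sub>m (fst Y) (fst Y)" if "s < fst X" for s
      using that YR by (intro eq_matI) auto
    then show "snd Y w = 0\<^sub>m (fst Y) (fst Y)"
      unfolding w by (intro Rep_sum_zero[OF YR]) (auto simp: Rep_scale[OF YR])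
  qed
qed

text \<open>Specified by its action on simple objects, which by \<open>simple_faithful\<close>
  leaves only one such element; existence is shown in \<open>idem_action\<close>.\<close>

definition idem :: "('k, 'h) rep set \<Rightarrow> 'h" where
  "idem b = (SOME e. \<forall>X. simple_rep H X \<longrightarrow>
     snd X e = (if iso_class H X = b then 1\<^sub>m (fst X) else 0\<^sub>m (fst X) (fst X)))"

text \<open>The witness is the sum of the parts of 1 that belong to b. The remaining parts vanish on
  objects of class b, so on these the witness acts like 1.\<close>

lemma idem_action:
  assumes "simple_rep H X"
  shows "snd X (idem b) = (if iso_class H X = b then 1\<^sub>m (fst X) else 0\<^sub>m (fst X) (fst X))"
proof -
  obtain Ws :: "(('k, 'h) rep \<times> 'h) list" where W0:
    "\<forall>X w. (X, w) \<in> set Ws \<longrightarrow> simple_rep H X" "1 = (\<Sum>(X, w)\<leftarrow>Ws. w)"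
    "\<forall>X w Y. (X, w) \<in> set Ws \<longrightarrow> simple_rep H Y \<longrightarrow> iso_class H X \<noteq> iso_class H Y \<longrightarrow> snd Y w = 0\<^sub>m (fst Y) (fst Y)"
    by (rule isotypic_spanning)
  note W = W0(1)[rule_format] W0(2) W0(3)[rule_format]
  let ?e = "\<Sum>x\<leftarrow>filter (\<lambda>x. iso_class H (fst x) = b) Ws. snd x"
  let ?e' = "\<Sum>x\<leftarrow>filter (\<lambda>x. iso_class H (fst x) \<noteq> b) Ws. snd x"
  have one: "?e + ?e' = 1"
  proof -
    have "?e + ?e' = (\<Sum>x\<leftarrow>Ws. snd x)" by (induction Ws) (auto simp: algebra_simps)
    then show ?thesis using W(2) by (simp add: case_prod_unfold)
  qed
  have "\<forall>Y. simple_rep H Y \<longrightarrow> snd Y ?e = (if iso_class H Y = b then 1\<^sub>m (fst Y) else 0\<^sub>m (fst Y) (fst Y))"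
  proof (intro allI impI)
    fix Y assume Y: "simple_rep H Y"
    note YR = simple_repD(1)[OF Y]
    show "snd Y ?e = (if iso_class H Y = b then 1\<^sub>m (fst Y) else 0\<^sub>m (fst Y) (fst Y))"
    proof (cases "iso_class H Y = b")
      case True
      have "snd Y ?e' = 0\<^sub>m (fst Y) (fst Y)"
        by (rule Rep_sum_list_zero[OF YR], rule W(3)[OF _ Y]) (use True in auto)
      then have "snd Y ?e = snd Y ?e + snd Y ?e'" using YR by simp
      also have "\<dots> = 1\<^sub>m (fst Y)" unfolding Rep_add[OF YR, symmetric] one by (rule Rep_one[OF YR])
      finally show ?thesis using True by simp
    next
      case False
      have "snd Y ?e = 0\<^sub>m (fst Y) (fst Y)"
        by (rule Rep_sum_list_zero[OF YR], rule W(3)[OF _ Y]) (use False in auto)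
      then show ?thesis using False by simp
    qed
  qed
  from someI[of "\<lambda>e. \<forall>X. simple_rep H X \<longrightarrow> snd X e = (if iso_class H X = b then 1\<^sub>m (fst X) else 0\<^sub>m (fst X) (fst X))", OF this]
  show ?thesis using assms unfolding idem_def by blast
qed

text \<open>A class that does not occur in the regular representation would be annihilated by every
  part of 1, hence by 1 itself.\<close>

lemma finite_Irr: "finite (Irr H)"
proof -
  obtain Ws :: "(('k, 'h) rep \<times> 'h) list" where W0:
    "\<forall>X w. (X, w) \<in> set Ws \<longrightarrow> simple_rep H X" "1 = (\<Sum>(X, w)\<leftarrow>Ws. w)"
    "\<forall>X w Y. (X, w) \<in> set Ws \<longrightarrow> simple_rep H Y \<longrightarrow> iso_class H X \<noteq> iso_class H Y \<longrightarrow> snd Y w = 0\<^sub>m (fst Y) (fst Y)"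
    by (rule isotypic_spanning)
  note W = W0(1)[rule_format] W0(2) W0(3)[rule_format]
  have "iso_class H Y \<in> (\<lambda>x. iso_class H (fst x)) ` set Ws" if Y: "simple_rep H Y" for Y
  proof (rule ccontr)
    assume c: "iso_class H Y \<notin> (\<lambda>x. iso_class H (fst x)) ` set Ws"
    note YR = simple_repD(1)[OF Y]
    have "snd Y (\<Sum>(X, w)\<leftarrow>Ws. w) = 0\<^sub>m (fst Y) (fst Y)"
      by (rule Rep_sum_list_zero[OF YR]) (use W(3)[OF _ Y] c in force)
    then have "1\<^sub>m (fst Y) = (0\<^sub>m (fst Y) (fst Y) :: 'k mat)" unfolding W(2)[symmetric] Rep_one[OF YR] .
    then have "(1\<^sub>m (fst Y) :: 'k mat) $$ (0, 0) = 0\<^sub>m (fst Y) (fst Y) $$ (0, 0)" by (rule arg_cong)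
    then show False using simple_repD(2)[OF Y] by simp
  qed
  then have "Irr H \<subseteq> (\<lambda>x. iso_class H (fst x)) ` set Ws" by (auto simp: Irr_def)
  then show ?thesis by (rule finite_subset) simp
qed

text \<open>The same choice as in \<open>K0_mult\<close>, so that a product of two basis elements is
  literally the class of a tensor product of chosen representatives.\<close>

definition rp :: "('k, 'h) rep set \<Rightarrow> ('k, 'h) rep" where
  "rp b = (SOME X. X \<in> b)"

lemma Irr_iff: "simple_rep H X \<Longrightarrow> iso_class H X \<in> Irr H"
  by (auto simp: Irr_def)

lemma rp:
  assumes "b \<in> Irr H"
  shows "simple_rep H (rp b)" "iso_class H (rp b) = b" "rp b \<in> Rep H" "fst (rp b) \<noteq> 0"
proof -
  obtain X where X: "simple_rep H X" "b = iso_class H X" using assms by (auto simp: Irr_def)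
  note XR = simple_repD(1)[OF X(1)]
  have "X \<in> b" using X XR rep_iso_refl by (simp add: iso_class_def)
  then have "rp b \<in> b" unfolding rp_def by (rule someI)
  then have r: "rp b \<in> Rep H" "rep_iso X (rp b)" by (auto simp: X(2) iso_class_def)
  show s: "simple_rep H (rp b)" by (rule simple_rep_iso[OF X(1) r])
  show "iso_class H (rp b) = b" using r iso_class_eq_iff[OF XR r(1)] X(2) by simp
  show "rp b \<in> Rep H" "fst (rp b) \<noteq> 0" using simple_repD[OF s] by auto
qed

lemma rp_iso: "simple_rep H X \<Longrightarrow> rep_iso X (rp (iso_class H X))"
  using rp[OF Irr_iff] iso_class_eq_iff simple_repD(1) by metis

section \<open>Multiplicities read off from characters\<close>

lemma character_idem_simple:
  assumes "simple_rep H X"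
  shows "character X (idem b) = (if iso_class H X = b then of_nat (fst X) else 0)"
  by (simp add: character_def idem_action[OF assms])

definition rep_mult :: "('k, 'h) rep \<Rightarrow> ('k, 'h) rep set \<Rightarrow> nat" where
  "rep_mult V b = length (filter (\<lambda>X. iso_class H X = b) (map fst (SOME Ds. decomposition V Ds)))"

lemma decomposition_simple: "decomposition V Ds \<Longrightarrow> X \<in> set (map fst Ds) \<Longrightarrow> simple_rep H X"
  by (auto simp: decomposition_def)

text \<open>The value of the character at \<open>idem b\<close> is the multiplicity of b times its
  dimension. Characteristic 0 turns this into an equation of natural numbers and the positive
  dimension cancels, so the decomposition chosen in \<open>rep_mult\<close> is immaterial.\<close>

lemma mult_list:
  assumes V: "V \<in> Rep H" and Xs: "\<And>X. X \<in> set Xs \<Longrightarrow> simple_rep H X"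
    and ch: "\<And>h. character V h = (\<Sum>X\<leftarrow>Xs. character X h)"
  shows "rep_mult V b = length (filter (\<lambda>X. iso_class H X = b) Xs)"
proof (cases "b \<in> Irr H")
  case b: True
  have ci: "(\<Sum>X\<leftarrow>Ys. character X (idem b)) = of_nat (length (filter (\<lambda>X. iso_class H X = b) Ys) * fst (rp b))"
    if "\<And>X. X \<in> set Ys \<Longrightarrow> simple_rep H X" for Ys
    using that
  proof (induction Ys)
    case (Cons X Ys)
    have "fst X = fst (rp b)" if "iso_class H X = b"
      using rep_iso_dim_eq[OF rp_iso[of X]] Cons.prems that by simp
    then show ?case using Cons by (auto simp: character_idem_simple algebra_simps)
  qed simp
  obtain Ds where "decomposition V Ds" using exists_decomposition[OF V] by blast
  then have D: "decomposition V (SOME Ds. decomposition V Ds)" by (rule someI)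
  have "(of_nat (rep_mult V b * fst (rp b)) :: 'k) = (\<Sum>X\<leftarrow>map fst (SOME Ds. decomposition V Ds). character X (idem b))"
    unfolding rep_mult_def by (rule ci[symmetric]) (rule decomposition_simple[OF D])
  also have "\<dots> = character V (idem b)" by (rule decomposition_character[OF V D, symmetric])
  also have "\<dots> = of_nat (length (filter (\<lambda>X. iso_class H X = b) Xs) * fst (rp b))"
    unfolding ch by (rule ci[OF Xs])
  finally have "rep_mult V b * fst (rp b) = length (filter (\<lambda>X. iso_class H X = b) Xs) * fst (rp b)"
    by (simp only: of_nat_eq_iff)
  then show ?thesis using rp(4)[OF b] by simp
next
  case False
  obtain Ds where "decomposition V Ds" using exists_decomposition[OF V] by blast
  then have D: "decomposition V (SOME Ds. decomposition V Ds)" by (rule someI)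
  have "filter (\<lambda>X. iso_class H X = b) Ys = []" if "\<And>X. X \<in> set Ys \<Longrightarrow> simple_rep H X" for Ys
    using that False Irr_iff by (auto simp: filter_empty_conv)
  then show ?thesis
    unfolding rep_mult_def using Xs decomposition_simple[OF D] by presburger
qed

lemma mult_decomposition:
  assumes "V \<in> Rep H" "decomposition V Ds"
  shows "rep_mult V b = length (filter (\<lambda>X. iso_class H X = b) (map fst Ds))"
  by (rule mult_list[OF assms(1)]) (use assms decomposition_character in \<open>auto simp: decomposition_def\<close>)

text \<open>Characters determine multiplicities. This replaces the construction of isomorphisms
  wherever only constituents matter.\<close>

lemma mult_cong:
  assumes "V \<in> Rep H" "W \<in> Rep H" "\<And>h. character V h = character W h"
  shows "rep_mult V b = rep_mult W b"
proof -
  obtain Ds where D: "decomposition W Ds" using exists_decomposition[OF assms(2)] by blast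
  show ?thesis unfolding mult_decomposition[OF assms(2) D]
    by (rule mult_list[OF assms(1)])
      (use D decomposition_character[OF assms(2) D] assms(3) in \<open>auto simp: decomposition_def\<close>)
qed

lemma mult_simple: "simple_rep H X \<Longrightarrow> rep_mult X b = (if iso_class H X = b then 1 else 0)"
  by (subst mult_list[where Xs = "[X]"]) (auto simp: simple_repD)

lemma mult_notin_Irr: "V \<in> Rep H \<Longrightarrow> b \<notin> Irr H \<Longrightarrow> rep_mult V b = 0"
proof -
  assume V: "V \<in> Rep H" and b: "b \<notin> Irr H"
  obtain Ds where D: "decomposition V Ds" using exists_decomposition[OF V] by blast
  then show "rep_mult V b = 0"
    unfolding mult_decomposition[OF V D] using b Irr_iff by (auto simp: decomposition_def filter_empty_conv)
qed

lemma character_mult: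
  assumes V: "V \<in> Rep H"
  shows "character V h = (\<Sum>b\<in>Irr H. of_nat (rep_mult V b) * character (rp b) h)"
proof -
  obtain Ds where D: "decomposition V Ds" using exists_decomposition[OF V] by blast
  then have s: "X \<in> set (map fst Ds) \<Longrightarrow> simple_rep H X" for X by (auto simp: decomposition_def)
  have "character V h = (\<Sum>X\<leftarrow>map fst Ds. character X h)" by (rule decomposition_character[OF V D])
  also have "map (\<lambda>X. character X h) (map fst Ds) = map (\<lambda>X. character (rp (iso_class H X)) h) (map fst Ds)"
    by (rule map_cong[OF HOL.refl]) (metis s rep_iso_character rp_iso rp(3) Irr_iff simple_repD(1))
  also have "sum_list \<dots> = (\<Sum>b\<in>Irr H. of_nat (length (filter (\<lambda>X. iso_class H X = b) (map fst Ds))) * character (rp b) h)"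
    by (rule sum_list_filter_partition[OF finite_Irr]) (use s Irr_iff in blast)
  finally show ?thesis by (simp only: mult_decomposition[OF V D])
qed

lemma character_idem:
  assumes V: "V \<in> Rep H" and b: "b \<in> Irr H"
  shows "character V (idem b) = of_nat (rep_mult V b * fst (rp b))"
proof -
  have "character V (idem b) = (\<Sum>c\<in>Irr H. if c = b then of_nat (rep_mult V b * fst (rp b)) else 0)"
    unfolding character_mult[OF V] by (rule sum.cong) (auto simp: character_idem_simple rp)
  then show ?thesis using b finite_Irr by simp
qed

text \<open>A common scalar on all constituents can be taken out of the expansion of the action,
  leaving the resolution of the identity.\<close>

lemma action_scalar:
  assumes V: "V \<in> Rep H"
    and z: "\<And>X. simple_rep H X \<Longrightarrow> rep_mult V (iso_class H X) > 0 \<Longrightarrow> snd X z = c \<cdot>\<^sub>m 1\<^sub>m (fst X)"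
  shows "snd V z = c \<cdot>\<^sub>m 1\<^sub>m (fst V)"
proof -
  obtain Ds where D: "decomposition V Ds" using exists_decomposition[OF V] by blast
  have d0: "simple_rep H X" "A \<in> carrier_mat (fst V) (fst X)" "B \<in> carrier_mat (fst X) (fst V)"
    if "(X, A, B) \<in> set Ds" for X A B
    using D that by (auto simp: decomposition_def dest: rep_hom_carrier)
  have d1: "rep_mult V (iso_class H X) > 0" if "(X, A, B) \<in> set Ds" for X A B
    using that unfolding mult_decomposition[OF V D] by (force simp: filter_empty_conv)
  note d = d0 d1
  have "snd V z = mat_sum (fst V) (fst V) (\<lambda>(X, A, B). A * snd X z * B) (mset Ds)"
    by (rule decomposition_expand[OF V D])
  also have "\<dots> = mat_sum (fst V) (fst V) (\<lambda>x. (c \<cdot>\<^sub>m 1\<^sub>m (fst V)) * (case x of (X, A, B) \<Rightarrow> A * B)) (mset Ds)"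
  proof (rule mat_sum_cong)
    fix x assume "x \<in># mset Ds"
    moreover obtain X A B where x: "x = (X, A, B)" by (cases x)
    ultimately have "(X, A, B) \<in> set Ds" by simp
    note dd = d[OF this]
    have "A * snd X z * B = c \<cdot>\<^sub>m (A * B)"
      unfolding z[OF dd(1,4)] mult_smult_distrib[OF dd(2) one_carrier_mat] right_mult_one_mat[OF dd(2)]
      by (rule mult_smult_assoc_mat[OF dd(2,3)])
    also have "\<dots> = (c \<cdot>\<^sub>m 1\<^sub>m (fst V)) * (A * B)"
      unfolding mult_smult_assoc_mat[OF one_carrier_mat mult_carrier_mat[OF dd(2,3)]]
        left_mult_one_mat[OF mult_carrier_mat[OF dd(2,3)]] ..
    finally show "(case x of (X, A, B) \<Rightarrow> A * snd X z * B) = (c \<cdot>\<^sub>m 1\<^sub>m (fst V)) * (case x of (X, A, B) \<Rightarrow> A * B)"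
      by (simp add: x)
  qed
  also have "\<dots> = (c \<cdot>\<^sub>m 1\<^sub>m (fst V)) * mat_sum (fst V) (fst V) (\<lambda>(X, A, B). A * B) (mset Ds)"
    by (rule mult_mat_sum[symmetric]) (use d in \<open>auto intro!: mult_carrier_mat\<close>)
  also have "\<dots> = c \<cdot>\<^sub>m 1\<^sub>m (fst V)"
    using D unfolding decomposition_def by simp
  finally show ?thesis .
qed

text \<open>One direction is \<open>action_scalar\<close> with the scalar 0, the other takes the
  trace. It turns absence of a constituent into an equation that can be transported along
  morphisms.\<close>

lemma mult_zero_iff: "V \<in> Rep H \<Longrightarrow> rep_mult V b = 0 \<longleftrightarrow> snd V (idem b) = 0\<^sub>m (fst V) (fst V)"
proof
  have z: "0 \<cdot>\<^sub>m 1\<^sub>m n = (0\<^sub>m n n :: 'k mat)" for n by (intro eq_matI) auto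
  assume V: "V \<in> Rep H" and 0: "rep_mult V b = 0"
  have "snd V (idem b) = 0 \<cdot>\<^sub>m 1\<^sub>m (fst V)"
  proof (rule action_scalar[OF V])
    fix X assume X: "simple_rep H X" "rep_mult V (iso_class H X) > 0"
    then have "iso_class H X \<noteq> b" using 0 by auto
    then show "snd X (idem b) = 0 \<cdot>\<^sub>m 1\<^sub>m (fst X)" unfolding z by (simp add: idem_action[OF X(1)])
  qed
  then show "snd V (idem b) = 0\<^sub>m (fst V) (fst V)" unfolding z .
next
  assume V: "V \<in> Rep H" and 0: "snd V (idem b) = 0\<^sub>m (fst V) (fst V)"
  show "rep_mult V b = 0"
  proof (cases "b \<in> Irr H")
    case True
    have "(of_nat (rep_mult V b * fst (rp b)) :: 'k) = 0"
      unfolding character_idem[OF V True, symmetric] character_def 0 by simp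
    then have "rep_mult V b * fst (rp b) = 0" unfolding of_nat_eq_0_iff .
    then show ?thesis using rp(4)[OF True] by simp
  qed (use V mult_notin_Irr in auto)
qed

text \<open>If the class of X were absent from V, its idempotent would act as 0 on V and as 1 on X,
  and a morphism intertwining the two actions would vanish.\<close>

lemma mult_pos_from:
  assumes X: "simple_rep H X" and V: "V \<in> Rep H" and T: "T \<in> rep_hom X V" "T \<noteq> 0\<^sub>m (fst V) (fst X)"
  shows "rep_mult V (iso_class H X) > 0"
proof (rule ccontr)
  assume "\<not> ?thesis"
  then have "snd V (idem (iso_class H X)) = 0\<^sub>m (fst V) (fst V)" using mult_zero_iff[OF V] by simp
  then have "T * snd X (idem (iso_class H X)) = 0\<^sub>m (fst V) (fst X)"
    using rep_hom_comm[OF T(1)] rep_hom_carrier[OF T(1)] by simp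
  then show False using T rep_hom_carrier[OF T(1)] by (simp add: idem_action[OF X])
qed

lemma mult_pos_to:
  assumes X: "simple_rep H X" and V: "V \<in> Rep H" and T: "T \<in> rep_hom V X" "T \<noteq> 0\<^sub>m (fst X) (fst V)"
  shows "rep_mult V (iso_class H X) > 0"
proof (rule ccontr)
  assume "\<not> ?thesis"
  then have "snd V (idem (iso_class H X)) = 0\<^sub>m (fst V) (fst V)" using mult_zero_iff[OF V] by simp
  then have "snd X (idem (iso_class H X)) * T = 0\<^sub>m (fst X) (fst V)"
    using rep_hom_comm[OF T(1), symmetric] rep_hom_carrier[OF T(1)] by simp
  then show False using T rep_hom_carrier[OF T(1)] by (simp add: idem_action[OF X])
qed

lemma mult_pos_homs:
  assumes V: "V \<in> Rep H" and pos: "rep_mult V b > 0"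
  obtains A B where "A \<in> rep_hom (rp b) V" "B \<in> rep_hom V (rp b)" "B * A = 1\<^sub>m (fst (rp b))"
proof -
  have b: "b \<in> Irr H" using pos mult_notin_Irr[OF V] by force
  obtain Ds where D: "decomposition V Ds" using exists_decomposition[OF V] by blast
  have "filter (\<lambda>X. iso_class H X = b) (map fst Ds) \<noteq> []"
    using pos unfolding mult_decomposition[OF V D] by (simp only: length_greater_0_conv not_False_eq_True)
  then obtain X A B where "(X, A, B) \<in> set Ds" and Xb: "iso_class H X = b"
    by (auto simp: filter_empty_conv)
  then have X: "simple_rep H X" "A \<in> rep_hom X V" "B \<in> rep_hom V X" "B * A = 1\<^sub>m (fst X)"
    using D by (auto simp: decomposition_def)
  note XR = simple_repD(1)[OF X(1)]
  obtain S S' where S: "S \<in> rep_hom X (rp b)" "S' \<in> rep_hom (rp b) X" "S * S' = 1\<^sub>m (fst (rp b))"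
    using rp_iso[OF X(1)] Xb unfolding rep_iso_def rep_isomorphism_def by auto
  note c = X(2,3)[THEN rep_hom_carrier] S(1,2)[THEN rep_hom_carrier]
  have "S * B * (A * S') = S * (B * A * S')"
    using assoc_mult_mat[OF c(3,2) mult_carrier_mat[OF c(1,4)]] assoc_mult_mat[OF c(2,1,4)] by simp
  then have "S * B * (A * S') = 1\<^sub>m (fst (rp b))" using X(4) S(3) c by simp
  then show ?thesis
    using that rep_hom_comp[OF rp(3)[OF b] XR V S(2) X(2)] rep_hom_comp[OF V XR rp(3)[OF b] X(3) S(1)] by blast
qed

lemma lookup_frag_sum_list:
  "Poly_Mapping.lookup (\<Sum>X\<leftarrow>Xs. frag_of (c X)) b = int (length (filter (\<lambda>X. c X = b) Xs))"
  by (induction Xs) (auto simp: lookup_add)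

text \<open>The definite description in \<open>K0_class\<close> has a value because the coefficients
  obtained from any direct sum of simple objects isomorphic to V are the multiplicities in
  V.\<close>

lemma lookup_K0_class:
  assumes V: "V \<in> Rep H"
  shows "Poly_Mapping.lookup (K0_class H V) b = int (rep_mult V b)"
proof -
  have L: "Poly_Mapping.lookup (\<Sum>X\<leftarrow>Xs. frag_of (iso_class H X)) b = int (rep_mult V b)"
    if "\<forall>X\<in>set Xs. simple_rep H X" "rep_iso V (direct_sum_rep Xs)" for Xs b
  proof -
    have R: "set Xs \<subseteq> Rep H" using that simple_repD by blast
    have "rep_mult V b = length (filter (\<lambda>X. iso_class H X = b) Xs)"
      by (rule mult_list[OF V]) (use that rep_iso_character[OF V direct_sum_rep_Rep[OF R]] direct_sum_character[OF R] in auto)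
    then show ?thesis by (simp add: lookup_frag_sum_list)
  qed
  obtain Ds where D: "decomposition V Ds" "rep_iso V (direct_sum_rep (map fst Ds))" using exists_decomposition[OF V] by blast
  have Ds: "\<forall>X\<in>set (map fst Ds). simple_rep H X" using decomposition_simple[OF D(1)] by blast
  have ex: "\<exists>Xs. (\<forall>X\<in>set Xs. simple_rep H X) \<and> rep_iso V (direct_sum_rep Xs) \<and>
     (\<Sum>X\<leftarrow>map fst Ds. frag_of (iso_class H X)) = (\<Sum>X\<leftarrow>Xs. frag_of (iso_class H X))"
    using D(2) Ds by blast
  have "K0_class H V = (\<Sum>X\<leftarrow>map fst Ds. frag_of (iso_class H X))"
    unfolding K0_class_def
  proof (rule the_equality, rule ex)
    fix r assume "\<exists>Xs. (\<forall>X\<in>set Xs. simple_rep H X) \<and> rep_iso V (direct_sum_rep Xs) \<and> r = (\<Sum>X\<leftarrow>Xs. frag_of (iso_class H X))"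
    then obtain Xs where Xs: "\<forall>X\<in>set Xs. simple_rep H X" "rep_iso V (direct_sum_rep Xs)" "r = (\<Sum>X\<leftarrow>Xs. frag_of (iso_class H X))"
      by blast
    show "r = (\<Sum>X\<leftarrow>map fst Ds. frag_of (iso_class H X))"
      unfolding Xs(3) by (rule poly_mapping_eqI) (simp only: L[OF Xs(1,2)] L[OF Ds D(2)])
  qed
  then show ?thesis using L[OF Ds D(2)] by simp
qed

end

section \<open>Tensor products and duals\<close>

context hopf_algebra
begin

abbreviation linear_form :: "('h \<Rightarrow> 'k) \<Rightarrow> bool" where
  "linear_form f \<equiv> Vector_Spaces.linear (scale H) (*) f"

lemma linear_formI:
  assumes "\<And>x y. f (x + y) = f x + f y" "\<And>c x. f (scale H c x) = c * f x"
  shows "linear_form f"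
  unfolding Vector_Spaces.linear_iff
proof (intro conjI allI)
  show "vector_space (scale H)" by (rule vector_space_axioms)
  show "vector_space ((*) :: 'k \<Rightarrow> 'k \<Rightarrow> 'k)" by unfold_locales (simp_all add: algebra_simps)
qed (use assms in auto)

lemma linear_formD:
  assumes "linear_form f"
  shows "f (x + y) = f x + f y" "f (scale H c x) = c * f x"
  using assms by (simp_all add: Vector_Spaces.linear_iff)

lemma linear_form_0: "linear_form f \<Longrightarrow> f 0 = 0"
  using linear_formD(2)[of f 0 0] by simp

lemma linear_form_sum_mset: "linear_form f \<Longrightarrow> f (\<Sum>x\<in>#M. g x) = (\<Sum>x\<in>#M. f (g x))"
  by (induction M) (auto simp: linear_form_0 linear_formD)

lemma linear_form_entry: "V \<in> Rep H \<Longrightarrow> i < fst V \<Longrightarrow> j < fst V \<Longrightarrow> linear_form (\<lambda>h. snd V h $$ (i, j))"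
  by (rule linear_formI) (auto simp: Rep_add Rep_scale)

lemma biadditive_product:
  "linear_form f \<Longrightarrow> linear_form g \<Longrightarrow> biadditive_balanced (scale H) (\<lambda>a b. f a * g b)"
  by (auto simp: biadditive_balanced_def linear_formD algebra_simps)

text \<open>The identity S(h_1) h_2 \<otimes> h_3 = 1 \<otimes> h, tested on a pair of linear forms.
  It is what makes evaluation maps equivariant.\<close>

lemma antipode_left_forms:
  assumes f: "linear_form f" and g: "linear_form g"
  shows "(\<Sum>(a, b)\<in>#comult H h. \<Sum>(b1, b2)\<in>#comult H b. f (antipode H a * b1) * g b2) = f 1 * g h"
proof -
  have tri: "triadditive_balanced (scale H) (\<lambda>a b c. f (antipode H a * b) * g c)"
    by (simp add: bilin_simps linear_formD[OF f] linear_formD[OF g])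
  have "(\<Sum>(a, b)\<in>#comult H h. \<Sum>(b1, b2)\<in>#comult H b. f (antipode H a * b1) * g b2) =
    (\<Sum>(a, b)\<in>#comult H h. \<Sum>(a1, a2)\<in>#comult H a. f (antipode H a1 * a2) * g b)"
    by (rule comult_sum_coassoc[OF tri, symmetric])
  also have "\<dots> = (\<Sum>(a, b)\<in>#comult H h. f (\<Sum>(a1, a2)\<in>#comult H a. antipode H a1 * a2) * g b)"
    by (simp add: linear_form_sum_mset[OF f] sum_mset_distrib_right case_prod_unfold multiset.map_comp comp_def)
  also have "\<dots> = f 1 * g (\<Sum>(a, b)\<in>#comult H h. scale H (counit H a) b)"
    by (simp only: antipode_left) (simp add: linear_form_sum_mset[OF g] linear_formD(2)[OF f] linear_formD(2)[OF g]
      sum_mset_distrib_left case_prod_unfold mult_ac multiset.map_comp comp_def)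
  finally show ?thesis by (simp add: counit_left)
qed

text \<open>The counterpart h_1 \<otimes> h_2 S(h_3) = h \<otimes> 1, for coevaluation maps.\<close>

lemma antipode_right_forms:
  assumes f: "linear_form f" and g: "linear_form g"
  shows "(\<Sum>(a, b)\<in>#comult H h. \<Sum>(a1, a2)\<in>#comult H a. g a1 * f (a2 * antipode H b)) = g h * f 1"
proof -
  have tri: "triadditive_balanced (scale H) (\<lambda>a b c. g a * f (b * antipode H c))"
    by (simp add: bilin_simps linear_formD[OF f] linear_formD[OF g])
  have "(\<Sum>(a, b)\<in>#comult H h. \<Sum>(a1, a2)\<in>#comult H a. g a1 * f (a2 * antipode H b)) =
    (\<Sum>(a, b)\<in>#comult H h. \<Sum>(b1, b2)\<in>#comult H b. g a * f (b1 * antipode H b2))"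
    by (rule comult_sum_coassoc[OF tri])
  also have "\<dots> = (\<Sum>(a, b)\<in>#comult H h. g a * f (\<Sum>(b1, b2)\<in>#comult H b. b1 * antipode H b2))"
    by (simp add: linear_form_sum_mset[OF f] sum_mset_distrib_left case_prod_unfold multiset.map_comp comp_def)
  also have "\<dots> = g (\<Sum>(a, b)\<in>#comult H h. scale H (counit H b) a) * f 1"
    by (simp only: antipode_right) (simp add: linear_form_sum_mset[OF g] linear_formD(2)[OF f] linear_formD(2)[OF g]
      sum_mset_distrib_right case_prod_unfold mult_ac multiset.map_comp comp_def)
  finally show ?thesis by (simp add: counit_right)
qed

section \<open>The unit, duals and Kronecker products as representations\<close>

lemma unit_rep_Rep: "unit_rep H \<in> Rep H"
  unfolding unit_rep_def
  by (rule RepI) (auto intro!: eq_matI simp: counit_add counit_scale counit_mult counit_one scalar_prod_def)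

lemma unit_rep_simps [simp]: "fst (unit_rep H) = 1" "snd (unit_rep H) h $$ (0, 0) = counit H h"
  by (simp_all add: unit_rep_def)

lemma character_unit: "character (unit_rep H) h = counit H h"
  by (simp add: character_def mat_trace_def unit_rep_def)

lemma dual_rep_Rep: "V \<in> Rep H \<Longrightarrow> dual_rep H V \<in> Rep H"
  unfolding dual_rep_def
proof (rule RepI)
  assume V: "V \<in> Rep H"
  fix x y c
  show "transpose_mat (snd V (antipode H x)) \<in> carrier_mat (fst V) (fst V)" using V by simp
  show "transpose_mat (snd V (antipode H (x + y))) = transpose_mat (snd V (antipode H x)) + transpose_mat (snd V (antipode H y))"
    using V by (simp add: antipode_add Rep_add transpose_add[of _ "fst V" "fst V"])
  show "transpose_mat (snd V (antipode H (scale H c x))) = c \<cdot>\<^sub>m transpose_mat (snd V (antipode H x))"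
    using V by (intro eq_matI) (auto simp: antipode_scale Rep_scale)
  show "transpose_mat (snd V (antipode H (x * y))) = transpose_mat (snd V (antipode H x)) * transpose_mat (snd V (antipode H y))"
    using V by (simp add: antipode_mult Rep_mult transpose_mult[of _ "fst V" "fst V" _ "fst V"])
  show "transpose_mat (snd V (antipode H 1)) = 1\<^sub>m (fst V)"
    using V by (simp add: antipode_one Rep_one)
qed

lemma fst_dual_rep [simp]: "fst (dual_rep H V) = fst V"
  by (simp add: dual_rep_def)

lemma dual_rep_entry:
  "V \<in> Rep H \<Longrightarrow> i < fst V \<Longrightarrow> j < fst V \<Longrightarrow> snd (dual_rep H V) h $$ (i, j) = snd V (antipode H h) $$ (j, i)"
  by (simp add: dual_rep_def)

lemma character_dual: "V \<in> Rep H \<Longrightarrow> character (dual_rep H V) h = character V (antipode H h)"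
  by (simp add: character_def mat_trace_def dual_rep_def)

lemma fst_tensor_rep [simp]: "fst (tensor_rep H V W) = fst V * fst W"
  by (simp add: tensor_rep_def)

lemma tensor_rep_carrier [simp]: "snd (tensor_rep H V W) h \<in> carrier_mat (fst V * fst W) (fst V * fst W)"
  by (simp add: tensor_rep_def)

lemma tensor_rep_index:
  assumes "r < fst V * fst W" "s < fst V * fst W"
  shows "snd (tensor_rep H V W) h $$ (r, s) = (\<Sum>(a, b)\<in>#comult H h.
    snd V a $$ (r div fst W, s div fst W) * snd W b $$ (r mod fst W, s mod fst W))"
  using assms by (simp add: tensor_rep_def)

lemma tensor_rep_entry:
  assumes "i < fst V" "j < fst W" "k < fst V" "l < fst W"
  shows "snd (tensor_rep H V W) h $$ (i * fst W + j, k * fst W + l) = (\<Sum>(a, b)\<in>#comult H h. snd V a $$ (i, k) * snd W b $$ (j, l))"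
  using assms by (subst tensor_rep_index) (auto simp: pair_index_less)

lemma tensor_rep_bilin:
  assumes "V \<in> Rep H" "W \<in> Rep H" "i < fst V" "j < fst W" "k < fst V" "l < fst W"
  shows "biadditive_balanced (scale H) (\<lambda>a b. snd V a $$ (i, k) * snd W b $$ (j, l))"
  using assms by (intro biadditive_product linear_form_entry)

lemma tensor_mat_eqI:
  assumes "A \<in> carrier_mat (m * n) (m' * n')" "B \<in> carrier_mat (m * n) (m' * n')"
    and "\<And>i j k l. i < m \<Longrightarrow> j < n \<Longrightarrow> k < m' \<Longrightarrow> l < n' \<Longrightarrow> A $$ (i * n + j, k * n' + l) = B $$ (i * n + j, k * n' + l)"
  shows "A = B"
proof (rule eq_matI)
  fix r s assume "r < dim_row B" "s < dim_col B"
  then have rs: "r < m * n" "s < m' * n'" using assms(2) by auto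
  show "A $$ (r, s) = B $$ (r, s)"
    using assms(3)[OF div_mod_less[OF rs(1)] div_mod_less[OF rs(2)]] by (simp add: div_mult_mod_eq)
qed (use assms in auto)

lemma sum_pair_index:
  fixes f :: "nat \<Rightarrow> 'a::comm_monoid_add"
  shows "(\<Sum>r<m * n. f r) = (\<Sum>i<m. \<Sum>j<n. f (i * n + j))"
  using sum_div_mod[of "\<lambda>i j. f (i * n + j)" n m] by (simp add: div_mult_mod_eq)

lemma tensor_rep_Rep:
  assumes V: "V \<in> Rep H" and W: "W \<in> Rep H"
  shows "tensor_rep H V W \<in> Rep H"
proof -
  note bi = tensor_rep_bilin[OF V W]
  have "(fst V * fst W, snd (tensor_rep H V W)) \<in> Rep H"
  proof (rule RepI)
    fix x y c
    show "snd (tensor_rep H V W) (x + y) = snd (tensor_rep H V W) x + snd (tensor_rep H V W) y"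
    proof (rule tensor_mat_eqI)
      fix i j k l assume ij: "i < fst V" "j < fst W" "k < fst V" "l < fst W"
      then show "snd (tensor_rep H V W) (x + y) $$ (i * fst W + j, k * fst W + l) =
          (snd (tensor_rep H V W) x + snd (tensor_rep H V W) y) $$ (i * fst W + j, k * fst W + l)"
        by (simp add: tensor_rep_entry comult_sum_add[OF bi] pair_index_less carrier_matD[OF tensor_rep_carrier])
    qed (auto simp: carrier_matD[OF tensor_rep_carrier])
    show "snd (tensor_rep H V W) (scale H c x) = c \<cdot>\<^sub>m snd (tensor_rep H V W) x"
    proof (rule tensor_mat_eqI)
      fix i j k l assume ij: "i < fst V" "j < fst W" "k < fst V" "l < fst W"
      then show "snd (tensor_rep H V W) (scale H c x) $$ (i * fst W + j, k * fst W + l) =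
          (c \<cdot>\<^sub>m snd (tensor_rep H V W) x) $$ (i * fst W + j, k * fst W + l)"
        using V W by (simp add: tensor_rep_entry comult_sum_scale[OF bi] pair_index_less carrier_matD[OF tensor_rep_carrier])
          (simp add: Rep_scale sum_mset_distrib_left case_prod_unfold mult.assoc multiset.map_comp comp_def)
    qed auto
    show "snd (tensor_rep H V W) (x * y) = snd (tensor_rep H V W) x * snd (tensor_rep H V W) y"
    proof (rule tensor_mat_eqI)
      fix i j k l assume ij: "i < fst V" "j < fst W" "k < fst V" "l < fst W"
      have "(snd (tensor_rep H V W) x * snd (tensor_rep H V W) y) $$ (i * fst W + j, k * fst W + l) =
        (\<Sum>p<fst V. \<Sum>q<fst W. snd (tensor_rep H V W) x $$ (i * fst W + j, p * fst W + q) * snd (tensor_rep H V W) y $$ (p * fst W + q, k * fst W + l))"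
        using ij by (subst mult_entry[OF tensor_rep_carrier tensor_rep_carrier]) (auto simp: pair_index_less sum_pair_index)
      also have "\<dots> = (\<Sum>p<fst V. \<Sum>q<fst W. (\<Sum>(a, b)\<in>#comult H x. snd V a $$ (i, p) * snd W b $$ (j, q)) *
         (\<Sum>(a', b')\<in>#comult H y. snd V a' $$ (p, k) * snd W b' $$ (q, l)))"
        using ij by (intro sum.cong) (auto simp: tensor_rep_entry)
      also have "\<dots> = (\<Sum>p<fst V. \<Sum>q<fst W. \<Sum>x\<in>#comult H x. \<Sum>y\<in>#comult H y.
          snd V (fst x) $$ (i, p) * snd W (snd x) $$ (j, q) * (snd V (fst y) $$ (p, k) * snd W (snd y) $$ (q, l)))"
        by (simp add: case_prod_unfold sum_mset_distrib_left sum_mset_distrib_right multiset.map_comp comp_def)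
          (simp only: sum_mset.swap[of _ "comult H x"])
      also have "\<dots> = (\<Sum>x\<in>#comult H x. \<Sum>y\<in>#comult H y. \<Sum>p<fst V. \<Sum>q<fst W.
          snd V (fst x) $$ (i, p) * snd W (snd x) $$ (j, q) * (snd V (fst y) $$ (p, k) * snd W (snd y) $$ (q, l)))"
        by (simp only: sum_mset_sum_swap)
      also have "\<dots> = (\<Sum>x\<in>#comult H x. \<Sum>y\<in>#comult H y. (\<Sum>p<fst V. snd V (fst x) $$ (i, p) * snd V (fst y) $$ (p, k)) *
         (\<Sum>q<fst W. snd W (snd x) $$ (j, q) * snd W (snd y) $$ (q, l)))"
        by (simp add: sum_product mult_ac)
      also have "\<dots> = (\<Sum>x\<in>#comult H x. \<Sum>y\<in>#comult H y. snd V (fst x * fst y) $$ (i, k) * snd W (snd x * snd y) $$ (j, l))"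
        unfolding Rep_mult[OF V] Rep_mult[OF W] mult_entry[OF Rep_carrier[OF V] Rep_carrier[OF V] ij(1,3)]
          mult_entry[OF Rep_carrier[OF W] Rep_carrier[OF W] ij(2,4)] ..
      also have "\<dots> = snd (tensor_rep H V W) (x * y) $$ (i * fst W + j, k * fst W + l)"
        using ij by (simp add: tensor_rep_entry comult_sum_mult[OF bi]) (simp add: case_prod_unfold)
      finally show "snd (tensor_rep H V W) (x * y) $$ (i * fst W + j, k * fst W + l) =
          (snd (tensor_rep H V W) x * snd (tensor_rep H V W) y) $$ (i * fst W + j, k * fst W + l)" by simp
    qed (use mult_carrier_mat[OF tensor_rep_carrier tensor_rep_carrier] in simp_all)
    show "snd (tensor_rep H V W) 1 = 1\<^sub>m (fst V * fst W)"
    proof (rule tensor_mat_eqI)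
      fix i j k l assume ij: "i < fst V" "j < fst W" "k < fst V" "l < fst W"
      have "i * fst W + j = k * fst W + l \<longleftrightarrow> i = k \<and> j = l"
        using ij by (metis div_mult_self3 mod_mult_self3 add.right_neutral div_less gr_implies_not0 mod_less)
      then show "snd (tensor_rep H V W) 1 $$ (i * fst W + j, k * fst W + l) = 1\<^sub>m (fst V * fst W) $$ (i * fst W + j, k * fst W + l)"
        using ij V W by (simp add: tensor_rep_entry comult_sum_one[OF bi] pair_index_less Rep_one)
    qed auto
  qed simp
  then show ?thesis by (metis fst_tensor_rep prod.collapse)
qed

lemma character_linear: "V \<in> Rep H \<Longrightarrow> linear_form (character V)"
  by (rule linear_formI) (auto simp: character_def mat_trace_def Rep_add Rep_scale sum.distrib sum_distrib_left)

lemma character_tensor: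
  assumes V: "V \<in> Rep H" and W: "W \<in> Rep H"
  shows "character (tensor_rep H V W) h = (\<Sum>(a, b)\<in>#comult H h. character V a * character W b)"
proof -
  have "character (tensor_rep H V W) h = (\<Sum>i<fst V. \<Sum>j<fst W. \<Sum>(a, b)\<in>#comult H h. snd V a $$ (i, i) * snd W b $$ (j, j))"
    unfolding character_def mat_trace_def carrier_matD(1)[OF tensor_rep_carrier] sum_pair_index
    by (intro sum.cong HOL.refl tensor_rep_entry) auto
  also have "\<dots> = (\<Sum>x\<in>#comult H h. \<Sum>i<fst V. \<Sum>j<fst W. snd V (fst x) $$ (i, i) * snd W (snd x) $$ (j, j))"
    by (simp add: sum_mset_sum_swap case_prod_unfold)
  also have "\<dots> = (\<Sum>(a, b)\<in>#comult H h. character V a * character W b)"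
    using V W by (simp add: character_def mat_trace_def sum_product case_prod_unfold)
  finally show ?thesis .
qed

text \<open>Coassociativity, evaluated on the product of three characters. The equality of traces is
  enough to compare the constituents of the two bracketings.\<close>

lemma character_tensor_assoc:
  assumes U: "U \<in> Rep H" and V: "V \<in> Rep H" and W: "W \<in> Rep H"
  shows "character (tensor_rep H (tensor_rep H U V) W) h = character (tensor_rep H U (tensor_rep H V W)) h"
proof -
  note l = linear_formD[OF character_linear[OF U]] linear_formD[OF character_linear[OF V]] linear_formD[OF character_linear[OF W]]
  have tri: "triadditive_balanced (scale H) (\<lambda>a b c. character U a * character V b * character W c)"
    by (auto simp: triadditive_balanced_def biadditive_balanced_def l algebra_simps)
  have "character (tensor_rep H (tensor_rep H U V) W) h =
    (\<Sum>(a, b)\<in>#comult H h. \<Sum>(a1, a2)\<in>#comult H a. character U a1 * character V a2 * character W b)"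
    using U V W by (simp add: character_tensor tensor_rep_Rep case_prod_unfold sum_mset_distrib_right multiset.map_comp comp_def)
  also have "\<dots> = (\<Sum>(a, b)\<in>#comult H h. \<Sum>(b1, b2)\<in>#comult H b. character U a * character V b1 * character W b2)"
    by (rule comult_sum_coassoc[OF tri])
  also have "\<dots> = character (tensor_rep H U (tensor_rep H V W)) h"
    using U V W by (simp add: character_tensor tensor_rep_Rep case_prod_unfold sum_mset_distrib_left mult.assoc multiset.map_comp comp_def)
  finally show ?thesis .
qed

text \<open>Formulated for any U whose character is the counit, because the chosen representative of
  the unit class is only isomorphic to \<open>unit_rep\<close>.\<close>

lemma character_tensor_unit:
  assumes V: "V \<in> Rep H" and U: "U \<in> Rep H" "\<And>h. character U h = counit H h"
  shows "character (tensor_rep H U V) h = character V h" "character (tensor_rep H V U) h = character V h"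
proof -
  note l = character_linear[OF V]
  have "character (tensor_rep H U V) h = character V (\<Sum>(a, b)\<in>#comult H h. scale H (counit H a) b)"
    using U V by (simp add: character_tensor linear_form_sum_mset[OF l] linear_formD[OF l] case_prod_unfold)
  then show "character (tensor_rep H U V) h = character V h" by (simp add: counit_left)
  have "character (tensor_rep H V U) h = character V (\<Sum>(a, b)\<in>#comult H h. scale H (counit H b) a)"
    using U V by (simp add: character_tensor linear_form_sum_mset[OF l] linear_formD[OF l] case_prod_unfold mult.commute)
  then show "character (tensor_rep H V U) h = character V h" by (simp add: counit_right)
qed

section \<open>Equivariance and duality in coordinates\<close>

lemma tensor_rep_homI:
  assumes X: "X \<in> Rep H" and Y: "Y \<in> Rep H" and Z: "Z \<in> Rep H" and T: "T \<in> carrier_mat (fst X * fst Y) (fst Z)"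
    and eq: "\<And>h i j q. i < fst X \<Longrightarrow> j < fst Y \<Longrightarrow> q < fst Z \<Longrightarrow>
      (\<Sum>q'<fst Z. T $$ (i * fst Y + j, q') * snd Z h $$ (q', q)) =
      (\<Sum>(a, b)\<in>#comult H h. \<Sum>k<fst X. \<Sum>l<fst Y. snd X a $$ (i, k) * snd Y b $$ (j, l) * T $$ (k * fst Y + l, q))"
  shows "T \<in> rep_hom Z (tensor_rep H X Y)"
proof (rule rep_homI)
  show "T \<in> carrier_mat (fst (tensor_rep H X Y)) (fst Z)" using T by simp
  fix h
  show "T * snd Z h = snd (tensor_rep H X Y) h * T"
  proof (rule eq_matI)
    fix r q assume "r < dim_row (snd (tensor_rep H X Y) h * T)" "q < dim_col (snd (tensor_rep H X Y) h * T)"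
    then have r: "r < fst X * fst Y" and q: "q < fst Z" using T by (auto simp: carrier_matD[OF tensor_rep_carrier])
    define i j where "i = r div fst Y" and "j = r mod fst Y"
    have ij: "i < fst X" "j < fst Y" "r = i * fst Y + j" using div_mod_less[OF r] by (simp_all add: i_def j_def div_mult_mod_eq)
    have "(snd (tensor_rep H X Y) h * T) $$ (r, q) =
      (\<Sum>k<fst X. \<Sum>l<fst Y. snd (tensor_rep H X Y) h $$ (i * fst Y + j, k * fst Y + l) * T $$ (k * fst Y + l, q))"
      using mult_entry[OF tensor_rep_carrier T r q] by (simp add: sum_pair_index ij(3))
    also have "\<dots> = (\<Sum>k<fst X. \<Sum>l<fst Y. \<Sum>(a, b)\<in>#comult H h. snd X a $$ (i, k) * snd Y b $$ (j, l) * T $$ (k * fst Y + l, q))"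
      using ij by (intro sum.cong HOL.refl) (auto simp: tensor_rep_entry sum_mset_distrib_right case_prod_unfold multiset.map_comp comp_def)
    also have "\<dots> = (T * snd Z h) $$ (r, q)"
      using mult_entry[OF T Rep_carrier[OF Z] r q] eq[OF ij(1,2) q, of h] by (simp add: ij(3) sum_mset_sum_swap case_prod_unfold)
    finally show "(T * snd Z h) $$ (r, q) = (snd (tensor_rep H X Y) h * T) $$ (r, q)" by simp
  qed (use T Z in \<open>auto simp: carrier_matD[OF tensor_rep_carrier]\<close>)
qed

lemma tensor_rep_homD:
  assumes X: "X \<in> Rep H" and Y: "Y \<in> Rep H" and Z: "Z \<in> Rep H" and T: "T \<in> rep_hom Z (tensor_rep H X Y)"
    and ij: "i < fst X" "j < fst Y" "q < fst Z"
  shows "(\<Sum>q'<fst Z. T $$ (i * fst Y + j, q') * snd Z h $$ (q', q)) =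
      (\<Sum>(a, b)\<in>#comult H h. \<Sum>k<fst X. \<Sum>l<fst Y. snd X a $$ (i, k) * snd Y b $$ (j, l) * T $$ (k * fst Y + l, q))"
proof -
  have Tc: "T \<in> carrier_mat (fst X * fst Y) (fst Z)" using rep_hom_carrier[OF T] by simp
  note r = pair_index_less[OF ij(1,2)]
  have "(\<Sum>q'<fst Z. T $$ (i * fst Y + j, q') * snd Z h $$ (q', q)) = (snd (tensor_rep H X Y) h * T) $$ (i * fst Y + j, q)"
    using mult_entry[OF Tc Rep_carrier[OF Z] r ij(3)] rep_hom_comm[OF T] by simp
  also have "\<dots> = (\<Sum>k<fst X. \<Sum>l<fst Y. snd (tensor_rep H X Y) h $$ (i * fst Y + j, k * fst Y + l) * T $$ (k * fst Y + l, q))"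
    using mult_entry[OF tensor_rep_carrier Tc r ij(3)] by (simp add: sum_pair_index)
  also have "\<dots> = (\<Sum>k<fst X. \<Sum>l<fst Y. \<Sum>(a, b)\<in>#comult H h. snd X a $$ (i, k) * snd Y b $$ (j, l) * T $$ (k * fst Y + l, q))"
    using ij by (intro sum.cong HOL.refl) (auto simp: tensor_rep_entry sum_mset_distrib_right case_prod_unfold multiset.map_comp comp_def)
  finally show ?thesis by (simp add: sum_mset_sum_swap case_prod_unfold)
qed

lemma hom_tensor_repI:
  assumes X: "X \<in> Rep H" and Y: "Y \<in> Rep H" and Z: "Z \<in> Rep H" and T: "T \<in> carrier_mat (fst Z) (fst X * fst Y)"
    and eq: "\<And>h i j q. i < fst X \<Longrightarrow> j < fst Y \<Longrightarrow> q < fst Z \<Longrightarrow>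
      (\<Sum>(a, b)\<in>#comult H h. \<Sum>k<fst X. \<Sum>l<fst Y. T $$ (q, k * fst Y + l) * (snd X a $$ (k, i) * snd Y b $$ (l, j))) =
      (\<Sum>q'<fst Z. snd Z h $$ (q, q') * T $$ (q', i * fst Y + j))"
  shows "T \<in> rep_hom (tensor_rep H X Y) Z"
proof (rule rep_homI)
  show "T \<in> carrier_mat (fst Z) (fst (tensor_rep H X Y))" using T by simp
  fix h
  show "T * snd (tensor_rep H X Y) h = snd Z h * T"
  proof (rule eq_matI)
    fix q r assume "q < dim_row (snd Z h * T)" "r < dim_col (snd Z h * T)"
    then have r: "r < fst X * fst Y" and q: "q < fst Z" using T Z by auto
    define i j where "i = r div fst Y" and "j = r mod fst Y"
    have ij: "i < fst X" "j < fst Y" "r = i * fst Y + j" using div_mod_less[OF r] by (simp_all add: i_def j_def div_mult_mod_eq)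
    have "(T * snd (tensor_rep H X Y) h) $$ (q, r) =
      (\<Sum>k<fst X. \<Sum>l<fst Y. T $$ (q, k * fst Y + l) * snd (tensor_rep H X Y) h $$ (k * fst Y + l, i * fst Y + j))"
      using mult_entry[OF T tensor_rep_carrier q r] by (simp add: sum_pair_index ij(3))
    also have "\<dots> = (\<Sum>k<fst X. \<Sum>l<fst Y. \<Sum>(a, b)\<in>#comult H h. T $$ (q, k * fst Y + l) * (snd X a $$ (k, i) * snd Y b $$ (l, j)))"
      using ij by (intro sum.cong HOL.refl) (auto simp: tensor_rep_entry sum_mset_distrib_left case_prod_unfold multiset.map_comp comp_def)
    also have "\<dots> = (snd Z h * T) $$ (q, r)"
      using mult_entry[OF Rep_carrier[OF Z] T q r] eq[OF ij(1,2) q, of h] by (simp add: ij(3) sum_mset_sum_swap case_prod_unfold)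
    finally show "(T * snd (tensor_rep H X Y) h) $$ (q, r) = (snd Z h * T) $$ (q, r)" .
  qed (use T Z in \<open>auto simp: carrier_matD[OF tensor_rep_carrier]\<close>)
qed

lemma hom_tensor_repD:
  assumes X: "X \<in> Rep H" and Y: "Y \<in> Rep H" and Z: "Z \<in> Rep H" and T: "T \<in> rep_hom (tensor_rep H X Y) Z"
    and ij: "i < fst X" "j < fst Y" "q < fst Z"
  shows "(\<Sum>(a, b)\<in>#comult H h. \<Sum>k<fst X. \<Sum>l<fst Y. T $$ (q, k * fst Y + l) * (snd X a $$ (k, i) * snd Y b $$ (l, j))) =
      (\<Sum>q'<fst Z. snd Z h $$ (q, q') * T $$ (q', i * fst Y + j))"
proof -
  have Tc: "T \<in> carrier_mat (fst Z) (fst X * fst Y)" using rep_hom_carrier[OF T] by simp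
  note r = pair_index_less[OF ij(1,2)]
  have "(\<Sum>q'<fst Z. snd Z h $$ (q, q') * T $$ (q', i * fst Y + j)) = (T * snd (tensor_rep H X Y) h) $$ (q, i * fst Y + j)"
    using mult_entry[OF Rep_carrier[OF Z] Tc ij(3) r] rep_hom_comm[OF T] by simp
  also have "\<dots> = (\<Sum>k<fst X. \<Sum>l<fst Y. T $$ (q, k * fst Y + l) * snd (tensor_rep H X Y) h $$ (k * fst Y + l, i * fst Y + j))"
    using mult_entry[OF Tc tensor_rep_carrier ij(3) r] by (simp add: sum_pair_index)
  also have "\<dots> = (\<Sum>k<fst X. \<Sum>l<fst Y. \<Sum>(a, b)\<in>#comult H h. T $$ (q, k * fst Y + l) * (snd X a $$ (k, i) * snd Y b $$ (l, j)))"
    using ij by (intro sum.cong HOL.refl) (auto simp: tensor_rep_entry sum_mset_distrib_left case_prod_unfold multiset.map_comp comp_def)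
  finally show ?thesis by (simp add: sum_mset_sum_swap case_prod_unfold)
qed

text \<open>The natural maps \<open>Hom(Z, X \<otimes> Y) \<rightarrow> Hom(X\<^sup>* \<otimes> Z, Y)\<close> and \<open>Hom(X \<otimes> Y, Z) \<rightarrow> Hom(X, Z \<otimes> Y\<^sup>*)\<close> given by
  evaluation and coevaluation; in coordinates they only permute the indices of a matrix.\<close>

lemma hom_dual_left:
  assumes X: "X \<in> Rep H" and Y: "Y \<in> Rep H" and Z: "Z \<in> Rep H" and T: "T \<in> rep_hom Z (tensor_rep H X Y)"
    and ne: "T \<noteq> 0\<^sub>m (fst X * fst Y) (fst Z)"
  obtains T' where "T' \<in> rep_hom (tensor_rep H (dual_rep H X) Z) Y" "T' \<noteq> 0\<^sub>m (fst Y) (fst X * fst Z)"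
proof -
  have Tc: "T \<in> carrier_mat (fst X * fst Y) (fst Z)" using rep_hom_carrier[OF T] by simp
  note DX = dual_rep_Rep[OF X]
  define T' where "T' = mat (fst Y) (fst X * fst Z) (\<lambda>(j, r). T $$ ((r div fst Z) * fst Y + j, r mod fst Z))"
  have T'c: "T' \<in> carrier_mat (fst Y) (fst X * fst Z)" by (simp add: T'_def)
  have T': "T' $$ (j, i * fst Z + q) = T $$ (i * fst Y + j, q)" if "i < fst X" "j < fst Y" "q < fst Z" for i j q
    using that by (simp add: T'_def pair_index_less)
  have "T' \<in> rep_hom (tensor_rep H (dual_rep H X) Z) Y"
  proof (rule hom_tensor_repI[OF DX Z Y])
    fix h i q j assume "i < fst (dual_rep H X)" and q: "q < fst Z" and j: "j < fst Y"
    then have i: "i < fst X" by simp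
    have "(\<Sum>(a, b)\<in>#comult H h. \<Sum>k<fst (dual_rep H X). \<Sum>l<fst Z. T' $$ (j, k * fst Z + l) * (snd (dual_rep H X) a $$ (k, i) * snd Z b $$ (l, q)))
      = (\<Sum>(a, b)\<in>#comult H h. \<Sum>k<fst X. snd X (antipode H a) $$ (i, k) * (\<Sum>l<fst Z. T $$ (k * fst Y + j, l) * snd Z b $$ (l, q)))"
      using i j by (simp add: dual_rep_entry[OF X] T' sum_distrib_left mult_ac)
    also have "\<dots> = (\<Sum>(a, b)\<in>#comult H h. \<Sum>k<fst X. snd X (antipode H a) $$ (i, k) * (\<Sum>(b1, b2)\<in>#comult H b.
        \<Sum>p<fst X. \<Sum>l<fst Y. snd X b1 $$ (k, p) * snd Y b2 $$ (j, l) * T $$ (p * fst Y + l, q)))"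
      using j q by (simp add: tensor_rep_homD[OF X Y Z T])
    also have "\<dots> = (\<Sum>(a, b)\<in>#comult H h. \<Sum>(b1, b2)\<in>#comult H b. \<Sum>p<fst X. \<Sum>l<fst Y.
        (\<Sum>k<fst X. snd X (antipode H a) $$ (i, k) * snd X b1 $$ (k, p)) * snd Y b2 $$ (j, l) * T $$ (p * fst Y + l, q))"
    proof (rule arg_cong[where f = sum_mset], rule image_mset_cong, clarify)
      fix a b
      have "(\<Sum>k<fst X. snd X (antipode H a) $$ (i, k) * (\<Sum>(b1, b2)\<in>#comult H b.
          \<Sum>p<fst X. \<Sum>l<fst Y. snd X b1 $$ (k, p) * snd Y b2 $$ (j, l) * T $$ (p * fst Y + l, q))) =
        (\<Sum>x\<in>#comult H b. \<Sum>k<fst X. \<Sum>p<fst X. \<Sum>l<fst Y. snd X (antipode H a) $$ (i, k) * (snd X (fst x) $$ (k, p) * snd Y (snd x) $$ (j, l) * T $$ (p * fst Y + l, q)))"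
        by (simp add: sum_mset_distrib_left sum_distrib_left case_prod_unfold sum_mset_sum_swap multiset.map_comp comp_def)
      also have "\<dots> = (\<Sum>x\<in>#comult H b. \<Sum>p<fst X. \<Sum>l<fst Y. \<Sum>k<fst X. snd X (antipode H a) $$ (i, k) * (snd X (fst x) $$ (k, p) * snd Y (snd x) $$ (j, l) * T $$ (p * fst Y + l, q)))"
        by (subst sum.swap) (subst sum.swap[of _ "{..<fst Y}"], rule HOL.refl)
      finally show "(\<Sum>k<fst X. snd X (antipode H a) $$ (i, k) * (\<Sum>(b1, b2)\<in>#comult H b.
          \<Sum>p<fst X. \<Sum>l<fst Y. snd X b1 $$ (k, p) * snd Y b2 $$ (j, l) * T $$ (p * fst Y + l, q))) =
        (\<Sum>(b1, b2)\<in>#comult H b. \<Sum>p<fst X. \<Sum>l<fst Y.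
          (\<Sum>k<fst X. snd X (antipode H a) $$ (i, k) * snd X b1 $$ (k, p)) * snd Y b2 $$ (j, l) * T $$ (p * fst Y + l, q))"
        by (simp add: sum_distrib_right case_prod_unfold mult.assoc)
    qed
    also have "\<dots> = (\<Sum>(a, b)\<in>#comult H h. \<Sum>(b1, b2)\<in>#comult H b. \<Sum>p<fst X. \<Sum>l<fst Y.
        snd X (antipode H a * b1) $$ (i, p) * snd Y b2 $$ (j, l) * T $$ (p * fst Y + l, q))"
      using i by (simp add: Rep_mult[OF X] mult_entry[OF Rep_carrier[OF X] Rep_carrier[OF X]] del: index_mult_mat(1))
    also have "\<dots> = (\<Sum>p<fst X. \<Sum>l<fst Y. (\<Sum>(a, b)\<in>#comult H h. \<Sum>(b1, b2)\<in>#comult H b.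
        snd X (antipode H a * b1) $$ (i, p) * snd Y b2 $$ (j, l)) * T $$ (p * fst Y + l, q))"
      by (simp add: sum_mset_sum_swap sum_mset_distrib_right case_prod_unfold multiset.map_comp comp_def)
    \<comment> \<open>The factor S(h_1) h_2 acting on X collapses to 1, leaving a Kronecker delta on
      the X index and the action of h on Y.\<close>
    also have "\<dots> = (\<Sum>p<fst X. \<Sum>l<fst Y. snd X 1 $$ (i, p) * snd Y h $$ (j, l) * T $$ (p * fst Y + l, q))"
      using i j by (intro sum.cong HOL.refl arg_cong2[where f = "(*)"] antipode_left_forms linear_form_entry X Y) auto
    also have "\<dots> = (\<Sum>p<fst X. if p = i then \<Sum>l<fst Y. snd Y h $$ (j, l) * T $$ (p * fst Y + l, q) else 0)"
      using i by (intro sum.cong) (auto simp: Rep_one[OF X])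
    also have "\<dots> = (\<Sum>l<fst Y. snd Y h $$ (j, l) * T' $$ (l, i * fst Z + q))"
      using i q by (simp add: T')
    finally show "(\<Sum>(a, b)\<in>#comult H h. \<Sum>k<fst (dual_rep H X). \<Sum>l<fst Z. T' $$ (j, k * fst Z + l) * (snd (dual_rep H X) a $$ (k, i) * snd Z b $$ (l, q)))
      = (\<Sum>l<fst Y. snd Y h $$ (j, l) * T' $$ (l, i * fst Z + q))" .
  qed (simp add: T'c)
  moreover have "T' \<noteq> 0\<^sub>m (fst Y) (fst X * fst Z)"
  proof
    assume 0: "T' = 0\<^sub>m (fst Y) (fst X * fst Z)"
    have "T $$ (r, q) = 0" if "r < fst X * fst Y" "q < fst Z" for r q
      using T'[OF div_mod_less[OF that(1)] that(2)] 0 div_mod_less[OF that(1)] that(2) pair_index_less[of "r div fst Y" "fst X" q "fst Z"]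
      by (simp add: div_mult_mod_eq)
    then have "T = 0\<^sub>m (fst X * fst Y) (fst Z)" using Tc by (intro eq_matI) auto
    then show False using ne by simp
  qed
  ultimately show ?thesis by (rule that)
qed

lemma hom_dual_right:
  assumes X: "X \<in> Rep H" and Y: "Y \<in> Rep H" and Z: "Z \<in> Rep H" and T: "T \<in> rep_hom (tensor_rep H X Y) Z"
    and ne: "T \<noteq> 0\<^sub>m (fst Z) (fst X * fst Y)"
  obtains T' where "T' \<in> rep_hom X (tensor_rep H Z (dual_rep H Y))" "T' \<noteq> 0\<^sub>m (fst Z * fst Y) (fst X)"
proof -
  have Tc: "T \<in> carrier_mat (fst Z) (fst X * fst Y)" using rep_hom_carrier[OF T] by simp
  note DY = dual_rep_Rep[OF Y]
  define T' where "T' = mat (fst Z * fst Y) (fst X) (\<lambda>(r, k). T $$ (r div fst Y, k * fst Y + r mod fst Y))"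
  have T'c: "T' \<in> carrier_mat (fst Z * fst Y) (fst X)" by (simp add: T'_def)
  have T': "T' $$ (q * fst Y + l, k) = T $$ (q, k * fst Y + l)" if "q < fst Z" "l < fst Y" "k < fst X" for q l k
    using that by (simp add: T'_def pair_index_less)
  have "T' \<in> rep_hom X (tensor_rep H Z (dual_rep H Y))"
  proof (rule tensor_rep_homI[OF Z DY X])
    fix h q l i assume q: "q < fst Z" and "l < fst (dual_rep H Y)" and i: "i < fst X"
    then have l: "l < fst Y" by simp
    have "(\<Sum>(a, b)\<in>#comult H h. \<Sum>q'<fst Z. \<Sum>l'<fst (dual_rep H Y). snd Z a $$ (q, q') * snd (dual_rep H Y) b $$ (l, l') * T' $$ (q' * fst (dual_rep H Y) + l', i))
      = (\<Sum>(a, b)\<in>#comult H h. \<Sum>q'<fst Z. \<Sum>l'<fst Y. snd Y (antipode H b) $$ (l', l) * (snd Z a $$ (q, q') * T $$ (q', i * fst Y + l')))"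
      using i l by (simp add: dual_rep_entry[OF Y] T' mult_ac)
    also have "\<dots> = (\<Sum>(a, b)\<in>#comult H h. \<Sum>l'<fst Y. snd Y (antipode H b) $$ (l', l) * (\<Sum>q'<fst Z. snd Z a $$ (q, q') * T $$ (q', i * fst Y + l')))"
      unfolding sum_distrib_left by (subst sum.swap) (rule HOL.refl)
    also have "\<dots> = (\<Sum>(a, b)\<in>#comult H h. \<Sum>l'<fst Y. snd Y (antipode H b) $$ (l', l) * (\<Sum>(a1, a2)\<in>#comult H a.
        \<Sum>k<fst X. \<Sum>p<fst Y. T $$ (q, k * fst Y + p) * (snd X a1 $$ (k, i) * snd Y a2 $$ (p, l'))))"
      using i q by (simp add: hom_tensor_repD[OF X Y Z T])
    also have "\<dots> = (\<Sum>(a, b)\<in>#comult H h. \<Sum>(a1, a2)\<in>#comult H a. \<Sum>k<fst X. \<Sum>p<fst Y.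
        T $$ (q, k * fst Y + p) * (snd X a1 $$ (k, i) * (\<Sum>l'<fst Y. snd Y a2 $$ (p, l') * snd Y (antipode H b) $$ (l', l))))"
    proof (rule arg_cong[where f = sum_mset], rule image_mset_cong, clarify)
      fix a b
      have "(\<Sum>l'<fst Y. snd Y (antipode H b) $$ (l', l) * (\<Sum>(a1, a2)\<in>#comult H a.
          \<Sum>k<fst X. \<Sum>p<fst Y. T $$ (q, k * fst Y + p) * (snd X a1 $$ (k, i) * snd Y a2 $$ (p, l')))) =
        (\<Sum>x\<in>#comult H a. \<Sum>l'<fst Y. \<Sum>k<fst X. \<Sum>p<fst Y. snd Y (antipode H b) $$ (l', l) * (T $$ (q, k * fst Y + p) * (snd X (fst x) $$ (k, i) * snd Y (snd x) $$ (p, l'))))"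
        by (simp add: sum_mset_distrib_left sum_distrib_left case_prod_unfold sum_mset_sum_swap multiset.map_comp comp_def)
      also have "\<dots> = (\<Sum>x\<in>#comult H a. \<Sum>k<fst X. \<Sum>p<fst Y. \<Sum>l'<fst Y. snd Y (antipode H b) $$ (l', l) * (T $$ (q, k * fst Y + p) * (snd X (fst x) $$ (k, i) * snd Y (snd x) $$ (p, l'))))"
        by (subst sum.swap) (subst sum.swap[of _ "{..<fst Y}" "{..<fst Y}"], rule HOL.refl)
      finally show "(\<Sum>l'<fst Y. snd Y (antipode H b) $$ (l', l) * (\<Sum>(a1, a2)\<in>#comult H a.
          \<Sum>k<fst X. \<Sum>p<fst Y. T $$ (q, k * fst Y + p) * (snd X a1 $$ (k, i) * snd Y a2 $$ (p, l')))) =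
        (\<Sum>(a1, a2)\<in>#comult H a. \<Sum>k<fst X. \<Sum>p<fst Y.
          T $$ (q, k * fst Y + p) * (snd X a1 $$ (k, i) * (\<Sum>l'<fst Y. snd Y a2 $$ (p, l') * snd Y (antipode H b) $$ (l', l))))"
        by (simp add: sum_distrib_left case_prod_unfold mult_ac)
    qed
    also have "\<dots> = (\<Sum>(a, b)\<in>#comult H h. \<Sum>(a1, a2)\<in>#comult H a. \<Sum>k<fst X. \<Sum>p<fst Y.
        T $$ (q, k * fst Y + p) * (snd X a1 $$ (k, i) * snd Y (a2 * antipode H b) $$ (p, l)))"
      using l by (simp add: Rep_mult[OF Y] mult_entry[OF Rep_carrier[OF Y] Rep_carrier[OF Y]] del: index_mult_mat(1))
    also have "\<dots> = (\<Sum>k<fst X. \<Sum>p<fst Y. T $$ (q, k * fst Y + p) * (\<Sum>(a, b)\<in>#comult H h. \<Sum>(a1, a2)\<in>#comult H a.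
        snd X a1 $$ (k, i) * snd Y (a2 * antipode H b) $$ (p, l)))"
      by (simp add: sum_mset_sum_swap sum_mset_distrib_left case_prod_unfold multiset.map_comp comp_def)
    \<comment> \<open>Here h_2 S(h_3) acting on Y collapses to 1, which leaves a Kronecker delta on
      the Y index and the action of h on X.\<close>
    also have "\<dots> = (\<Sum>k<fst X. \<Sum>p<fst Y. T $$ (q, k * fst Y + p) * (snd X h $$ (k, i) * snd Y 1 $$ (p, l)))"
      using i l by (intro sum.cong HOL.refl arg_cong2[where f = "(*)"] antipode_right_forms linear_form_entry X Y) auto
    also have "\<dots> = (\<Sum>k<fst X. \<Sum>p<fst Y. if p = l then T $$ (q, k * fst Y + p) * snd X h $$ (k, i) else 0)"
      using l by (intro sum.cong) (auto simp: Rep_one[OF Y])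
    also have "\<dots> = (\<Sum>k<fst X. T' $$ (q * fst (dual_rep H Y) + l, k) * snd X h $$ (k, i))"
      using l q by (simp add: T')
    finally show "(\<Sum>k<fst X. T' $$ (q * fst (dual_rep H Y) + l, k) * snd X h $$ (k, i)) =
      (\<Sum>(a, b)\<in>#comult H h. \<Sum>q'<fst Z. \<Sum>l'<fst (dual_rep H Y). snd Z a $$ (q, q') * snd (dual_rep H Y) b $$ (l, l') * T' $$ (q' * fst (dual_rep H Y) + l', i))"
      by (rule HOL.sym)
  qed (simp add: T'c)
  moreover have "T' \<noteq> 0\<^sub>m (fst Z * fst Y) (fst X)"
  proof
    assume 0: "T' = 0\<^sub>m (fst Z * fst Y) (fst X)"
    have "T $$ (q, r) = 0" if "r < fst X * fst Y" "q < fst Z" for r q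
      using T'[OF that(2) div_mod_less(2)[OF that(1)] div_mod_less(1)[OF that(1)]] 0 div_mod_less[OF that(1)] that(2)
        pair_index_less[of q "fst Z" "r mod fst Y" "fst Y"]
      by (simp add: div_mult_mod_eq)
    then have "T = 0\<^sub>m (fst Z) (fst X * fst Y)" using Tc by (intro eq_matI) auto
    then show False using ne by simp
  qed
  ultimately show ?thesis by (rule that)
qed

text \<open>The matrix is the vector summing e_i \<otimes> e_i over the standard basis; its
  invariance is the right antipode axiom read in matrix entries.\<close>

lemma coevaluation:
  assumes X: "X \<in> Rep H" and "fst X \<noteq> 0"
  obtains T where "T \<in> rep_hom (unit_rep H) (tensor_rep H X (dual_rep H X))" "T \<noteq> 0\<^sub>m (fst X * fst X) 1"
proof -
  note DX = dual_rep_Rep[OF X]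
  define T :: "'k mat" where "T = mat (fst X * fst X) 1 (\<lambda>(r, q). if r div fst X = r mod fst X then 1 else 0)"
  have T: "T $$ (i * fst X + j, 0) = (if i = j then 1 else 0)" if "i < fst X" "j < fst X" for i j
    using that by (simp add: T_def pair_index_less)
  have "T \<in> rep_hom (unit_rep H) (tensor_rep H X (dual_rep H X))"
  proof (rule tensor_rep_homI[OF X DX unit_rep_Rep])
    fix h i j q assume i: "i < fst X" and "j < fst (dual_rep H X)" and q: "q < fst (unit_rep H)"
    then have j: "j < fst X" by simp
    have "(\<Sum>(a, b)\<in>#comult H h. \<Sum>k<fst X. \<Sum>l<fst (dual_rep H X). snd X a $$ (i, k) * snd (dual_rep H X) b $$ (j, l) * T $$ (k * fst (dual_rep H X) + l, q))
      = (\<Sum>(a, b)\<in>#comult H h. \<Sum>k<fst X. \<Sum>l<fst X. if l = k then snd X a $$ (i, k) * snd X (antipode H b) $$ (l, j) else 0)"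
      using i j q by (intro arg_cong[where f = sum_mset] image_mset_cong) (auto simp: dual_rep_entry[OF X] T if_distrib[of "\<lambda>x. _ * x"] cong: if_cong intro!: sum.cong)
    also have "\<dots> = (\<Sum>(a, b)\<in>#comult H h. snd X (a * antipode H b) $$ (i, j))"
      using i j by (simp add: Rep_mult[OF X] mult_entry[OF Rep_carrier[OF X] Rep_carrier[OF X]] del: index_mult_mat(1))
    also have "\<dots> = snd X (\<Sum>(a, b)\<in>#comult H h. a * antipode H b) $$ (i, j)"
      by (simp add: linear_form_sum_mset[OF linear_form_entry[OF X i j]] case_prod_unfold)
    also have "\<dots> = (if i = j then 1 else 0) * counit H h"
      using i j by (simp add: antipode_right Rep_scale[OF X] Rep_one[OF X])
    finally show "(\<Sum>q'<fst (unit_rep H). T $$ (i * fst (dual_rep H X) + j, q') * snd (unit_rep H) h $$ (q', q)) =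
      (\<Sum>(a, b)\<in>#comult H h. \<Sum>k<fst X. \<Sum>l<fst (dual_rep H X). snd X a $$ (i, k) * snd (dual_rep H X) b $$ (j, l) * T $$ (k * fst (dual_rep H X) + l, q))"
      using i j q by (simp add: T)
  qed (simp add: T_def)
  moreover have "T $$ (0 * fst X + 0, 0) = 1" using T[of 0 0] assms(2) by simp
  then have "T \<noteq> 0\<^sub>m (fst X * fst X) 1" using assms(2) by auto
  ultimately show ?thesis by (rule that)
qed

end

section \<open>Polygroups\<close>

text \<open>Products are sets, so associativity is an equality of unions. That products are nonempty
  is a consequence, derived in \<open>hp_nonempty\<close>.\<close>

locale polygroup =
  fixes B :: "'b set" and hp :: "'b \<Rightarrow> 'b \<Rightarrow> 'b set" and e :: 'b and iv :: "'b \<Rightarrow> 'b"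
  assumes hp_closed: "a \<in> B \<Longrightarrow> b \<in> B \<Longrightarrow> hp a b \<subseteq> B"
    and unit_mem: "e \<in> B"
    and iv_closed: "a \<in> B \<Longrightarrow> iv a \<in> B"
    and iv_iv: "a \<in> B \<Longrightarrow> iv (iv a) = a"
    and hp_assoc: "a \<in> B \<Longrightarrow> b \<in> B \<Longrightarrow> c \<in> B \<Longrightarrow> (\<Union>u\<in>hp a b. hp u c) = (\<Union>v\<in>hp b c. hp a v)"
    and hp_unit_left: "a \<in> B \<Longrightarrow> hp e a = {a}"
    and hp_unit_right: "a \<in> B \<Longrightarrow> hp a e = {a}"
    and rev_left: "b \<in> B \<Longrightarrow> c \<in> B \<Longrightarrow> d \<in> hp b c \<Longrightarrow> c \<in> hp (iv b) d"
    and rev_right: "b \<in> B \<Longrightarrow> c \<in> B \<Longrightarrow> d \<in> hp b c \<Longrightarrow> b \<in> hp d (iv c)"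
begin

lemma hp_mem: "a \<in> B \<Longrightarrow> b \<in> B \<Longrightarrow> c \<in> hp a b \<Longrightarrow> c \<in> B"
  using hp_closed by blast

lemma iv_anti: "b \<in> B \<Longrightarrow> c \<in> B \<Longrightarrow> d \<in> hp b c \<Longrightarrow> iv d \<in> hp (iv c) (iv b)"
  by (meson hp_mem iv_closed rev_left rev_right)

lemma assoc_right: "a \<in> B \<Longrightarrow> b \<in> B \<Longrightarrow> c \<in> B \<Longrightarrow> u \<in> hp a b \<Longrightarrow> d \<in> hp u c \<Longrightarrow> \<exists>v\<in>hp b c. d \<in> hp a v"
  using hp_assoc[of a b c] by blast

lemma assoc_left: "a \<in> B \<Longrightarrow> b \<in> B \<Longrightarrow> c \<in> B \<Longrightarrow> v \<in> hp b c \<Longrightarrow> d \<in> hp a v \<Longrightarrow> \<exists>u\<in>hp a b. d \<in> hp u c"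
  using hp_assoc[of a b c] by blast

text \<open>Reversibility applied to the unit laws, that is, to a as a member of e \<circ> a and of
  a \<circ> e.\<close>

lemma unit_in_hp_iv: "a \<in> B \<Longrightarrow> e \<in> hp a (iv a)" "a \<in> B \<Longrightarrow> e \<in> hp (iv a) a"
  using rev_right[of e a a] rev_left[of a e a] hp_unit_left hp_unit_right unit_mem by auto

text \<open>The element b lies in e \<circ> b, and e lies in the product of the inverse of a with a.
  Reassociating puts b into a product of the inverse of a with some element of a \<circ> b.\<close>

lemma hp_nonempty: "a \<in> B \<Longrightarrow> b \<in> B \<Longrightarrow> hp a b \<noteq> {}"
  using assoc_right[of "iv a" a b e b] unit_in_hp_iv(2)[of a] iv_closed[of a] hp_unit_left[of b] by blast

end

text \<open>Minimality is stated against all subsets with the same closure properties, so that it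
  acts as an induction principle. It mirrors the definition of the adjoint subcategory as an
  intersection of full tensor subcategories.\<close>

locale adjoint_subpolygroup = polygroup +
  fixes N
  assumes N_sub: "N \<subseteq> B" and N_unit: "e \<in> N"
    and N_hp: "a \<in> N \<Longrightarrow> b \<in> N \<Longrightarrow> hp a b \<subseteq> N"
    and N_iv: "a \<in> N \<Longrightarrow> iv a \<in> N"
    and N_adj: "x \<in> B \<Longrightarrow> hp x (iv x) \<subseteq> N"
    and N_minimal: "\<lbrakk>M \<subseteq> B; e \<in> M; \<And>a b. a \<in> M \<Longrightarrow> b \<in> M \<Longrightarrow> hp a b \<subseteq> M; \<And>a. a \<in> M \<Longrightarrow> iv a \<in> M;
      \<And>x. x \<in> B \<Longrightarrow> hp x (iv x) \<subseteq> M\<rbrakk> \<Longrightarrow> N \<subseteq> M"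
begin

definition coset :: "'a \<Rightarrow> 'a set" where
  "coset c = (\<Union>n\<in>N. hp n c)"

lemma N_B: "n \<in> N \<Longrightarrow> n \<in> B"
  using N_sub by blast

text \<open>Normality holds on the generators \<open>x \<circ> x\<^sup>*\<close>: if \<open>u \<in> z \<circ> x\<close> then \<open>x\<^sup>* \<in> u\<^sup>* \<circ> z\<close>, so that
  \<open>z \<circ> x \<circ> x\<^sup>*\<close> is covered by the sets \<open>(u \<circ> u\<^sup>*) \<circ> z\<close>.\<close>

lemma N_normal:
  assumes "n \<in> N" "z \<in> B"
  shows "hp z n \<subseteq> (\<Union>m\<in>N. hp m z)" "hp n z \<subseteq> (\<Union>m\<in>N. hp z m)"
proof -
  \<comment> \<open>The members of N that commute with every element up to factors from N.
    Minimality of N is applied to this set.\<close>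
  define M where "M = {n \<in> N. \<forall>z\<in>B. hp z n \<subseteq> (\<Union>m\<in>N. hp m z) \<and> hp n z \<subseteq> (\<Union>m\<in>N. hp z m)}"
  have M_left: "\<exists>m\<in>N. u \<in> hp m z" if "n \<in> M" "z \<in> B" "u \<in> hp z n" for n z u
    using that unfolding M_def by blast
  have M_right: "\<exists>m\<in>N. u \<in> hp z m" if "n \<in> M" "z \<in> B" "u \<in> hp n z" for n z u
    using that unfolding M_def by blast
  have sub: "N \<subseteq> M"
  proof (rule N_minimal)
    show "M \<subseteq> B" using N_sub by (auto simp: M_def)
    show "e \<in> M" using N_unit hp_unit_left hp_unit_right by (force simp: M_def)
  next
    fix a b assume ab: "a \<in> M" "b \<in> M"
    then have abN: "a \<in> N" "b \<in> N" and abB: "a \<in> B" "b \<in> B" using N_B by (auto simp: M_def)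
    show "hp a b \<subseteq> M"
    proof
      fix y assume y: "y \<in> hp a b"
      have "w \<in> (\<Union>m\<in>N. hp m z)" if z: "z \<in> B" and w: "w \<in> hp z y" for z w
      proof -
        obtain u where u: "u \<in> hp z a" "w \<in> hp u b" using assoc_left[OF z abB y w] by blast
        obtain m where m: "m \<in> N" "u \<in> hp m z" using M_left[OF ab(1) z u(1)] by blast
        obtain v where v: "v \<in> hp z b" "w \<in> hp m v" using assoc_right[OF N_B[OF m(1)] z abB(2) m(2) u(2)] by blast
        obtain m' where m': "m' \<in> N" "v \<in> hp m' z" using M_left[OF ab(2) z v(1)] by blast
        obtain t where "t \<in> hp m m'" "w \<in> hp t z" using assoc_left[OF N_B[OF m(1)] N_B[OF m'(1)] z m'(2) v(2)] by blast
        then show ?thesis using N_hp[OF m(1) m'(1)] by blast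
      qed
      moreover have "w \<in> (\<Union>m\<in>N. hp z m)" if z: "z \<in> B" and w: "w \<in> hp y z" for z w
      proof -
        obtain u where u: "u \<in> hp b z" "w \<in> hp a u" using assoc_right[OF abB z y w] by blast
        obtain m where m: "m \<in> N" "u \<in> hp z m" using M_right[OF ab(2) z u(1)] by blast
        obtain v where v: "v \<in> hp a z" "w \<in> hp v m" using assoc_left[OF abB(1) z N_B[OF m(1)] m(2) u(2)] by blast
        obtain m' where m': "m' \<in> N" "v \<in> hp z m'" using M_right[OF ab(1) z v(1)] by blast
        obtain t where "t \<in> hp m' m" "w \<in> hp z t" using assoc_right[OF z N_B[OF m'(1)] N_B[OF m(1)] m'(2) v(2)] by blast
        then show ?thesis using N_hp[OF m'(1) m(1)] by blast
      qed
      ultimately show "y \<in> M" using y N_hp[OF abN] by (auto simp: M_def)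
    qed
  next
    fix a assume a: "a \<in> M"
    then have aN: "a \<in> N" and aB: "a \<in> B" using N_B by (auto simp: M_def)
    note ia = iv_closed[OF aB]
    have "w \<in> (\<Union>m\<in>N. hp m z)" if z: "z \<in> B" and w: "w \<in> hp z (iv a)" for z w
    proof -
      have wB: "w \<in> B" using hp_mem[OF z ia w] .
      \<comment> \<open>Reversibility trades the inverse of \<open>a\<close> for \<open>a\<close>
        itself, with \<open>w\<close> now in the role of \<open>z\<close>, so the hypothesis on
        \<open>a\<close> applies; reversing once more brings back \<open>w\<close>.\<close>
      have "z \<in> hp w a" using rev_right[OF z ia w] iv_iv[OF aB] by simp
      then obtain m where m: "m \<in> N" "z \<in> hp m w" using M_left[OF a wB] by blast
      then show ?thesis using rev_left[OF N_B[OF m(1)] wB m(2)] N_iv by blast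
    qed
    moreover have "w \<in> (\<Union>m\<in>N. hp z m)" if z: "z \<in> B" and w: "w \<in> hp (iv a) z" for z w
    proof -
      have wB: "w \<in> B" using hp_mem[OF ia z w] .
      have "z \<in> hp a w" using rev_left[OF ia z w] iv_iv[OF aB] by simp
      then obtain m where m: "m \<in> N" "z \<in> hp w m" using M_right[OF a wB] by blast
      then show ?thesis using rev_right[OF wB N_B[OF m(1)] m(2)] N_iv by blast
    qed
    ultimately show "iv a \<in> M" using N_iv[OF aN] by (auto simp: M_def)
  next
    fix x assume x: "x \<in> B"
    note ix = iv_closed[OF x]
    show "hp x (iv x) \<subseteq> M"
    proof
      fix y assume y: "y \<in> hp x (iv x)"
      have "w \<in> (\<Union>m\<in>N. hp m z)" if z: "z \<in> B" and w: "w \<in> hp z y" for z w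
      proof -
        obtain u where u: "u \<in> hp z x" "w \<in> hp u (iv x)" using assoc_left[OF z x ix y w] by blast
        have uB: "u \<in> B" using hp_mem[OF z x u(1)] .
        have "iv x \<in> hp (iv u) z"
          using iv_anti[OF iv_closed[OF z] uB rev_left[OF z x u(1)]] iv_iv[OF z] by simp
        then obtain t where "t \<in> hp u (iv u)" "w \<in> hp t z"
          using assoc_left[OF uB iv_closed[OF uB] z _ u(2)] by blast
        then show ?thesis using N_adj[OF uB] by blast
      qed
      moreover have "w \<in> (\<Union>m\<in>N. hp z m)" if z: "z \<in> B" and w: "w \<in> hp y z" for z w
      proof -
        obtain u where u: "u \<in> hp (iv x) z" "w \<in> hp x u" using assoc_right[OF x ix z y w] by blast
        have uB: "u \<in> B" using hp_mem[OF ix z u(1)] .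
        have "x \<in> hp z (iv u)"
          using iv_anti[OF uB iv_closed[OF z] rev_right[OF ix z u(1)]] iv_iv[OF z] iv_iv[OF x] by simp
        then obtain t where "t \<in> hp (iv u) u" "w \<in> hp z t"
          using assoc_right[OF z iv_closed[OF uB] uB _ u(2)] by blast
        then show ?thesis using N_adj[OF iv_closed[OF uB]] iv_iv[OF uB] by auto
      qed
      ultimately show "y \<in> M" using y N_adj[OF x] by (auto simp: M_def)
    qed
  qed
  then show "hp z n \<subseteq> (\<Union>m\<in>N. hp m z)" "hp n z \<subseteq> (\<Union>m\<in>N. hp z m)"
    using M_left[OF subsetD[OF sub assms(1)] assms(2)] M_right[OF subsetD[OF sub assms(1)] assms(2)] by blast+
qed

lemma coset_sub: "c \<in> B \<Longrightarrow> coset c \<subseteq> B"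
  using hp_closed N_B by (fastforce simp: coset_def)

lemma coset_self: "c \<in> B \<Longrightarrow> c \<in> coset c"
  using hp_unit_left N_unit by (force simp: coset_def)

lemma coset_unit: "coset e = N"
  using hp_unit_right N_B by (force simp: coset_def)

lemma coset_eq:
  assumes c: "c \<in> B" and d: "d \<in> coset c"
  shows "coset d = coset c"
proof -
  have sub: "coset d \<subseteq> coset c" if c: "c \<in> B" and d: "d \<in> coset c" for c d
  proof
    fix w assume "w \<in> coset d"
    then obtain m where m: "m \<in> N" "w \<in> hp m d" by (auto simp: coset_def)
    obtain n where n: "n \<in> N" "d \<in> hp n c" using d by (auto simp: coset_def)
    obtain t where "t \<in> hp m n" "w \<in> hp t c" using assoc_left[OF N_B[OF m(1)] N_B[OF n(1)] c n(2) m(2)] by blast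
    then show "w \<in> coset c" using N_hp[OF m(1) n(1)] by (auto simp: coset_def)
  qed
  obtain n where n: "n \<in> N" "d \<in> hp n c" using d by (auto simp: coset_def)
  have "c \<in> coset d" using rev_left[OF N_B[OF n(1)] c n(2)] N_iv[OF n(1)] by (auto simp: coset_def)
  then show ?thesis using sub[OF c d] sub[of d c] coset_sub[OF c] d by blast
qed

lemma coset_left_stable: "c \<in> B \<Longrightarrow> n \<in> N \<Longrightarrow> hp n c \<subseteq> coset c"
  by (auto simp: coset_def)

lemma coset_right_stable: "c \<in> B \<Longrightarrow> n \<in> N \<Longrightarrow> hp c n \<subseteq> coset c"
  using N_normal(1) by (simp add: coset_def)

lemma hp_in_coset:
  assumes "a \<in> B" "b \<in> B" "u \<in> hp a b" "u' \<in> hp a b"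
  shows "u \<in> coset u'"
proof -
  obtain t where "t \<in> hp a (iv a)" "u \<in> hp t u'"
    using assoc_left[OF assms(1) iv_closed[OF assms(1)] hp_mem[OF assms(1,2,4)] rev_left[OF assms(1,2,4)] assms(3)] by blast
  then show ?thesis using N_adj[OF assms(1)] by (auto simp: coset_def)
qed

text \<open>The product of cosets is well defined: in n \<circ> a \<circ> m \<circ> b normality
  moves m past a, and then everything from N stands on the left of an element of a \<circ>
  b.\<close>

lemma coset_hp:
  assumes a: "a \<in> B" and b: "b \<in> B" and x: "x \<in> coset a" and y: "y \<in> coset b"
    and w: "w \<in> hp x y" and u: "u \<in> hp a b"
  shows "w \<in> coset u"
proof -
  obtain n where n: "n \<in> N" "x \<in> hp n a" using x by (auto simp: coset_def)
  obtain m where m: "m \<in> N" "y \<in> hp m b" using y by (auto simp: coset_def)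
  have yB: "y \<in> B" using coset_sub[OF b] y by blast
  obtain v where v: "v \<in> hp a y" "w \<in> hp n v" using assoc_right[OF N_B[OF n(1)] a yB n(2) w] by blast
  obtain t where t: "t \<in> hp a m" "v \<in> hp t b" using assoc_left[OF a N_B[OF m(1)] b m(2) v(1)] by blast
  obtain m' where m': "m' \<in> N" "t \<in> hp m' a" using N_normal(1)[OF m(1) a] t(1) by blast
  obtain s where s: "s \<in> hp a b" "v \<in> hp m' s" using assoc_right[OF N_B[OF m'(1)] a b m'(2) t(2)] by blast
  have sB: "s \<in> B" using hp_mem[OF a b s(1)] .
  have vs: "v \<in> coset s" using s(2) m'(1) by (auto simp: coset_def)
  then have "w \<in> coset s" using coset_eq[OF sB vs] v(2) n(1) by (auto simp: coset_def)
  also have "coset s = coset u" using coset_eq[OF hp_mem[OF a b u] hp_in_coset[OF a b s(1) u]] .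
  finally show ?thesis .
qed

text \<open>For the adjoint classes these are the sets of basis elements whose spans are the based
  subbimodules.\<close>

definition stable :: "'a set \<Rightarrow> bool" where
  "stable T \<longleftrightarrow> T \<subseteq> B \<and> (\<forall>n\<in>N. \<forall>t\<in>T. hp n t \<subseteq> T \<and> hp t n \<subseteq> T)"

lemma stable_coset: "c \<in> B \<Longrightarrow> stable (coset c)"
  unfolding stable_def using coset_sub coset_eq coset_left_stable coset_right_stable by blast

lemma stable_contains_coset: "stable T \<Longrightarrow> c \<in> T \<Longrightarrow> coset c \<subseteq> T"
  unfolding stable_def coset_def by blast

text \<open>Products with N stay within a coset and cosets are disjoint or equal. Hence a stable set
  containing a coset properly splits off that coset, which provides the decomposition in
  \<open>indecomposable_iff\<close>.\<close>

lemma stable_diff_coset: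
  assumes T: "stable T" and c: "c \<in> B"
  shows "stable (T - coset c)"
proof -
  have "w \<notin> coset c" if t: "t \<in> T - coset c" and w: "w \<in> coset t" for t w
  proof
    assume "w \<in> coset c"
    then have "coset t = coset c" using coset_eq[OF c] coset_eq[of t w] T t w by (auto simp: stable_def)
    then show False using t coset_self[of t] T by (auto simp: stable_def)
  qed
  then show ?thesis
    using T coset_left_stable coset_right_stable unfolding stable_def by blast
qed

end

section \<open>Classes of simple objects as a polygroup\<close>

context semisimple_hopf_algebra
begin

text \<open>The character of a tensor product is bilinear in the two characters. Expanding both over
  simple objects and evaluating at \<open>idem d\<close> gives an equation in the field, which
  characteristic 0 lifts to natural numbers.\<close>

lemma mult_tensor:
  assumes V: "V \<in> Rep H" and W: "W \<in> Rep H" and d: "d \<in> Irr H"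
  shows "rep_mult (tensor_rep H V W) d =
    (\<Sum>a\<in>Irr H. \<Sum>b\<in>Irr H. rep_mult V a * rep_mult W b * rep_mult (tensor_rep H (rp a) (rp b)) d)"
proof -
  have VW: "tensor_rep H V W \<in> Rep H" by (rule tensor_rep_Rep[OF V W])
  have "(of_nat (rep_mult (tensor_rep H V W) d * fst (rp d)) :: 'k) = character (tensor_rep H V W) (idem d)"
    by (rule character_idem[OF VW d, symmetric])
  also have "\<dots> = (\<Sum>x\<in>#comult H (idem d). (\<Sum>a\<in>Irr H. of_nat (rep_mult V a) * character (rp a) (fst x)) *
      (\<Sum>b\<in>Irr H. of_nat (rep_mult W b) * character (rp b) (snd x)))"
    unfolding character_tensor[OF V W] character_mult[OF V] character_mult[OF W] by (simp add: case_prod_unfold)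
  also have "\<dots> = (\<Sum>x\<in>#comult H (idem d). \<Sum>a\<in>Irr H. \<Sum>b\<in>Irr H. of_nat (rep_mult V a * rep_mult W b) *
      (character (rp a) (fst x) * character (rp b) (snd x)))"
    by (simp add: sum_product mult_ac)
  also have "\<dots> = (\<Sum>a\<in>Irr H. \<Sum>b\<in>Irr H. of_nat (rep_mult V a * rep_mult W b) *
      (\<Sum>x\<in>#comult H (idem d). character (rp a) (fst x) * character (rp b) (snd x)))"
    by (simp add: sum_mset_sum_swap sum_mset_distrib_left multiset.map_comp comp_def)
  also have "\<dots> = (\<Sum>a\<in>Irr H. \<Sum>b\<in>Irr H. of_nat (rep_mult V a * rep_mult W b) *
      of_nat (rep_mult (tensor_rep H (rp a) (rp b)) d * fst (rp d)))"
  proof (intro sum.cong HOL.refl arg_cong2[where f = "(*)"])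
    fix a b assume "a \<in> Irr H" "b \<in> Irr H"
    note R = rp(3)[OF this(1)] rp(3)[OF this(2)]
    show "(\<Sum>x\<in>#comult H (idem d). character (rp a) (fst x) * character (rp b) (snd x)) =
      of_nat (rep_mult (tensor_rep H (rp a) (rp b)) d * fst (rp d))"
      unfolding character_idem[OF tensor_rep_Rep[OF R] d, symmetric] character_tensor[OF R] by (simp add: case_prod_unfold)
  qed
  also have "\<dots> = of_nat ((\<Sum>a\<in>Irr H. \<Sum>b\<in>Irr H. rep_mult V a * rep_mult W b * rep_mult (tensor_rep H (rp a) (rp b)) d) * fst (rp d))"
    by (simp add: sum_distrib_right mult.assoc)
  finally have "rep_mult (tensor_rep H V W) d * fst (rp d) =
    (\<Sum>a\<in>Irr H. \<Sum>b\<in>Irr H. rep_mult V a * rep_mult W b * rep_mult (tensor_rep H (rp a) (rp b)) d) * fst (rp d)"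
    unfolding of_nat_eq_iff .
  then show ?thesis using rp(4)[OF d] by simp
qed

lemma mult_tensor_pos:
  assumes V: "V \<in> Rep H" and W: "W \<in> Rep H"
  shows "rep_mult (tensor_rep H V W) d > 0 \<longleftrightarrow>
    (\<exists>a\<in>Irr H. \<exists>b\<in>Irr H. rep_mult V a > 0 \<and> rep_mult W b > 0 \<and> rep_mult (tensor_rep H (rp a) (rp b)) d > 0)"
proof (cases "d \<in> Irr H")
  case True
  have "rep_mult (tensor_rep H V W) d = 0 \<longleftrightarrow>
    (\<forall>a\<in>Irr H. \<forall>b\<in>Irr H. rep_mult V a * rep_mult W b * rep_mult (tensor_rep H (rp a) (rp b)) d = 0)"
    unfolding mult_tensor[OF V W True] by (simp only: sum_eq_0_iff[OF finite_Irr])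
  then show ?thesis by (metis mult_is_0 neq0_conv)
next
  case False
  then show ?thesis
    using mult_notin_Irr[OF tensor_rep_Rep[OF V W] False] mult_notin_Irr[OF tensor_rep_Rep False] rp(3) by auto
qed

text \<open>V contains X because the characters agree, and the value of the character at 1 shows
  that the dimensions are equal.\<close>

lemma character_iso_simple:
  assumes V: "V \<in> Rep H" and X: "simple_rep H X" and ch: "\<And>h. character V h = character X h"
  shows "rep_iso X V"
proof -
  note XR = simple_repD(1)[OF X] and I = Irr_iff[OF X]
  have "rep_mult V (iso_class H X) > 0" using mult_cong[OF V XR ch] mult_simple[OF X] by simp
  then obtain A B where AB: "A \<in> rep_hom (rp (iso_class H X)) V" "B \<in> rep_hom V (rp (iso_class H X))"
    "B * A = 1\<^sub>m (fst (rp (iso_class H X)))" by (rule mult_pos_homs[OF V])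
  have "(of_nat (fst V) :: 'k) = of_nat (fst X)" using ch[of 1] by (simp add: character_one V XR)
  then have "fst (rp (iso_class H X)) = fst V" using rep_iso_dim_eq[OF rp_iso[OF X]] by simp
  then have "rep_iso (rp (iso_class H X)) V"
    using left_inverse_square_iso[OF rp(3)[OF I] V AB] unfolding rep_iso_def by blast
  then show ?thesis using rep_iso_trans[OF XR rp(3)[OF I] V rp_iso[OF X]] by blast
qed

lemma unit_rep_simple: "simple_rep H (unit_rep H)"
  unfolding simple_rep_def
proof (intro conjI ballI allI impI)
  fix W T assume W: "W \<in> Rep H" and T: "rep_mono W (unit_rep H) T"
  then have Th: "T \<in> rep_hom W (unit_rep H)" by (simp add: rep_mono_def)
  obtain Q where Q: "Q \<in> rep_hom (unit_rep H) W" "Q * T = 1\<^sub>m (fst W)"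
    by (rule mono_retraction[OF W unit_rep_Rep T])
  have "fst W \<le> 1" using left_inverse_dim[OF rep_hom_carrier[OF Th] rep_hom_carrier[OF Q(1)] Q(2)] by simp
  then consider "fst W = 0" | "fst W = fst (unit_rep H)" by fastforce
  then show "fst W = 0 \<or> rep_isomorphism W (unit_rep H) T"
    using left_inverse_square_iso[OF W unit_rep_Rep Th Q] by cases auto
qed (simp_all add: unit_rep_Rep)

definition hp :: "('k, 'h) rep set \<Rightarrow> ('k, 'h) rep set \<Rightarrow> ('k, 'h) rep set set" where
  "hp a b = {c. rep_mult (tensor_rep H (rp a) (rp b)) c > 0}"

definition unit_class :: "('k, 'h) rep set" where
  "unit_class = iso_class H (unit_rep H)"

definition dual_class :: "('k, 'h) rep set \<Rightarrow> ('k, 'h) rep set" where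
  "dual_class b = iso_class H (dual_rep H (rp b))"

lemma unit_class_Irr: "unit_class \<in> Irr H"
  unfolding unit_class_def by (rule Irr_iff[OF unit_rep_simple])

lemma character_rp: "simple_rep H X \<Longrightarrow> character (rp (iso_class H X)) h = character X h"
  using rep_iso_character[OF _ rp(3)[OF Irr_iff] rp_iso] simple_repD(1) by metis

lemma character_rp_unit: "character (rp unit_class) h = counit H h"
  unfolding unit_class_def by (simp add: character_rp[OF unit_rep_simple] character_unit)

lemma dual_left_mult:
  assumes X: "X \<in> Rep H" and c: "c \<in> Irr H" and d: "d \<in> Irr H"
    and pos: "rep_mult (tensor_rep H X (rp c)) d > 0"
  shows "rep_mult (tensor_rep H (dual_rep H X) (rp d)) c > 0"
proof -
  note R = rp(3)[OF c] rp(3)[OF d] and D = dual_rep_Rep[OF X]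
  note XY = tensor_rep_Rep[OF X R(1)]
  obtain A B where A: "A \<in> rep_hom (rp d) (tensor_rep H X (rp c))" "B \<in> rep_hom (tensor_rep H X (rp c)) (rp d)" "B * A = 1\<^sub>m (fst (rp d))"
    by (rule mult_pos_homs[OF XY pos])
  have "A \<noteq> 0\<^sub>m (fst X * fst (rp c)) (fst (rp d))"
  proof
    assume "A = 0\<^sub>m (fst X * fst (rp c)) (fst (rp d))"
    then have "(1\<^sub>m (fst (rp d)) :: 'k mat) $$ (0, 0) = 0\<^sub>m (fst (rp d)) (fst (rp d)) $$ (0, 0)"
      using A(3) rep_hom_carrier[OF A(2)] by simp
    then show False using rp(4)[OF d] by simp
  qed
  then obtain T where T: "T \<in> rep_hom (tensor_rep H (dual_rep H X) (rp d)) (rp c)" "T \<noteq> 0\<^sub>m (fst (rp c)) (fst X * fst (rp d))"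
    by (rule hom_dual_left[OF X R A(1)])
  have "rep_mult (tensor_rep H (dual_rep H X) (rp d)) (iso_class H (rp c)) > 0"
    by (rule mult_pos_to[OF rp(1)[OF c] tensor_rep_Rep[OF D R(2)] T(1)]) (use T in simp)
  then show ?thesis by (simp add: rp(2)[OF c])
qed

lemma dual_right_mult:
  assumes b: "b \<in> Irr H" and Y: "Y \<in> Rep H" and d: "d \<in> Irr H"
    and pos: "rep_mult (tensor_rep H (rp b) Y) d > 0"
  shows "rep_mult (tensor_rep H (rp d) (dual_rep H Y)) b > 0"
proof -
  note R = rp(3)[OF b] rp(3)[OF d] and D = dual_rep_Rep[OF Y]
  note XY = tensor_rep_Rep[OF R(1) Y]
  obtain A B where A: "A \<in> rep_hom (rp d) (tensor_rep H (rp b) Y)" "B \<in> rep_hom (tensor_rep H (rp b) Y) (rp d)" "B * A = 1\<^sub>m (fst (rp d))"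
    by (rule mult_pos_homs[OF XY pos])
  have "B \<noteq> 0\<^sub>m (fst (rp d)) (fst (rp b) * fst Y)"
  proof
    assume "B = 0\<^sub>m (fst (rp d)) (fst (rp b) * fst Y)"
    then have "(1\<^sub>m (fst (rp d)) :: 'k mat) $$ (0, 0) = 0\<^sub>m (fst (rp d)) (fst (rp d)) $$ (0, 0)"
      using A(3) rep_hom_carrier[OF A(1)] by simp
    then show False using rp(4)[OF d] by simp
  qed
  then obtain T where T: "T \<in> rep_hom (rp b) (tensor_rep H (rp d) (dual_rep H Y))" "T \<noteq> 0\<^sub>m (fst (rp d) * fst Y) (fst (rp b))"
    by (rule hom_dual_right[OF R(1) Y R(2) A(2)])
  have "rep_mult (tensor_rep H (rp d) (dual_rep H Y)) (iso_class H (rp b)) > 0"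
    by (rule mult_pos_from[OF rp(1)[OF b] tensor_rep_Rep[OF R(2) D] T(1)]) (use T in simp)
  then show ?thesis by (simp add: rp(2)[OF b])
qed

lemma mult_tensor_unit:
  assumes V: "V \<in> Rep H"
  shows "rep_mult (tensor_rep H (rp unit_class) V) d = rep_mult V d" "rep_mult (tensor_rep H V (rp unit_class)) d = rep_mult V d"
  using mult_cong[OF tensor_rep_Rep[OF rp(3)[OF unit_class_Irr] V] V]
    mult_cong[OF tensor_rep_Rep[OF V rp(3)[OF unit_class_Irr]] V]
    character_tensor_unit[OF V rp(3)[OF unit_class_Irr] character_rp_unit] by blast+

lemma mult_dim_le: "V \<in> Rep H \<Longrightarrow> rep_mult V b > 0 \<Longrightarrow> fst (rp b) \<le> fst V"
proof -
  assume V: "V \<in> Rep H" and b: "rep_mult V b > 0"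
  obtain A B where "A \<in> rep_hom (rp b) V" "B \<in> rep_hom V (rp b)" "B * A = 1\<^sub>m (fst (rp b))"
    by (rule mult_pos_homs[OF V b])
  then show "fst (rp b) \<le> fst V" using left_inverse_dim rep_hom_carrier by blast
qed

lemma mult_pos_iso:
  assumes V: "V \<in> Rep H" and b: "rep_mult V b > 0" and dim: "fst V \<le> fst (rp b)"
  shows "rep_iso (rp b) V"
proof -
  obtain A B where AB: "A \<in> rep_hom (rp b) V" "B \<in> rep_hom V (rp b)" "B * A = 1\<^sub>m (fst (rp b))"
    by (rule mult_pos_homs[OF V b])
  have "b \<in> Irr H" using b mult_notin_Irr[OF V] by force
  moreover have "fst (rp b) = fst V" using dim mult_dim_le[OF V b] by simp
  ultimately show ?thesis
    using left_inverse_square_iso[OF rp(3) V AB] unfolding rep_iso_def by blast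
qed

text \<open>Neither simplicity of the dual nor the double dual is taken from the formula for
  \<open>dual_rep\<close>. Coevaluation yields a constituent c of b* with the unit contained in b
  \<otimes> c; moving c to the other side makes b a constituent of c*. The two resulting dimension
  inequalities force b* to be c and c* to be b.\<close>

lemma dual_class:
  assumes b: "b \<in> Irr H"
  shows "dual_class b \<in> Irr H" "dual_class (dual_class b) = b" "rep_iso (rp (dual_class b)) (dual_rep H (rp b))"
proof -
  note X = rp(3)[OF b] and D = dual_rep_Rep[OF rp(3)[OF b]] and e = unit_class_Irr
  obtain T where T: "T \<in> rep_hom (unit_rep H) (tensor_rep H (rp b) (dual_rep H (rp b)))" "T \<noteq> 0\<^sub>m (fst (rp b) * fst (rp b)) 1"
    by (rule coevaluation[OF X rp(4)[OF b]])
  have "rep_mult (tensor_rep H (rp b) (dual_rep H (rp b))) unit_class > 0"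
    unfolding unit_class_def
    by (rule mult_pos_from[OF unit_rep_simple tensor_rep_Rep[OF X D] T(1)]) (use T(2) in simp)
  then obtain a c where c: "c \<in> Irr H" "rep_mult (dual_rep H (rp b)) c > 0" and a: "rep_mult (rp b) a > 0"
     "rep_mult (tensor_rep H (rp a) (rp c)) unit_class > 0"
    unfolding mult_tensor_pos[OF X D] by blast
  have "a = b" using a(1) mult_simple[OF rp(1)[OF b]] rp(2)[OF b] by (auto split: if_splits)
  then have pos: "rep_mult (tensor_rep H (rp b) (rp c)) unit_class > 0" using a(2) by simp
  note Y = rp(3)[OF c(1)] and DY = dual_rep_Rep[OF rp(3)[OF c(1)]]
  have b2: "rep_mult (dual_rep H (rp c)) b > 0"
    using dual_right_mult[OF b Y e pos] mult_tensor_unit(1)[OF DY] by simp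
  have le: "fst (rp c) \<le> fst (rp b)" "fst (rp b) \<le> fst (rp c)"
    using mult_dim_le[OF D c(2)] mult_dim_le[OF DY b2] by simp_all
  have i1: "rep_iso (rp c) (dual_rep H (rp b))" using mult_pos_iso[OF D c(2)] le by simp
  have i2: "rep_iso (rp b) (dual_rep H (rp c))" using mult_pos_iso[OF DY b2] le by simp
  have cb: "dual_class b = c"
    unfolding dual_class_def using iso_class_eq_iff[OF Y D] i1 rp(2)[OF c(1)] by simp
  then show "dual_class b \<in> Irr H" "rep_iso (rp (dual_class b)) (dual_rep H (rp b))" using c(1) i1 by simp_all
  show "dual_class (dual_class b) = b"
    unfolding cb unfolding dual_class_def using iso_class_eq_iff[OF X DY] i2 rp(2)[OF b] by simp
qed

lemma character_rp_dual:
  assumes "b \<in> Irr H"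
  shows "character (rp (dual_class b)) h = character (dual_rep H (rp b)) h"
  by (rule rep_iso_character[OF rp(3)[OF dual_class(1)[OF assms]] dual_rep_Rep[OF rp(3)[OF assms]] dual_class(3)[OF assms]])

lemma mult_tensor_cong:
  assumes "V \<in> Rep H" "V' \<in> Rep H" "W \<in> Rep H" "W' \<in> Rep H"
    "\<And>h. character V h = character V' h" "\<And>h. character W h = character W' h"
  shows "rep_mult (tensor_rep H V W) d = rep_mult (tensor_rep H V' W') d"
  using assms by (intro mult_cong tensor_rep_Rep) (simp_all add: character_tensor)

lemma simple_dual:
  assumes X: "simple_rep H X"
  shows "simple_rep H (dual_rep H X)" "iso_class H (dual_rep H X) = dual_class (iso_class H X)"
proof -
  let ?b = "iso_class H X"
  note b = Irr_iff[OF X] and XR = simple_repD(1)[OF X]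
  note c = dual_class(1)[OF b]
  have ch: "character (dual_rep H X) h = character (rp (dual_class ?b)) h" for h
    using character_rp_dual[OF b] character_rp[OF X] by (simp add: character_dual XR rp(3)[OF b])
  have i: "rep_iso (rp (dual_class ?b)) (dual_rep H X)"
    by (rule character_iso_simple[OF dual_rep_Rep[OF XR] rp(1)[OF c] ch])
  then show "simple_rep H (dual_rep H X)" by (rule simple_rep_iso[OF rp(1)[OF c] dual_rep_Rep[OF XR]])
  show "iso_class H (dual_rep H X) = dual_class ?b"
    using iso_class_eq_iff[OF rp(3)[OF c] dual_rep_Rep[OF XR]] i rp(2)[OF c] by simp
qed

lemma hp_Irr: "a \<in> Irr H \<Longrightarrow> b \<in> Irr H \<Longrightarrow> hp a b \<subseteq> Irr H"
  unfolding hp_def using mult_notin_Irr[OF tensor_rep_Rep] rp(3) by fastforce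

lemma hp_triple:
  assumes a: "a \<in> Irr H" and b: "b \<in> Irr H" and c: "c \<in> Irr H"
  shows "d \<in> (\<Union>u\<in>hp a b. hp u c) \<longleftrightarrow> rep_mult (tensor_rep H (tensor_rep H (rp a) (rp b)) (rp c)) d > 0"
    "d \<in> (\<Union>v\<in>hp b c. hp a v) \<longleftrightarrow> rep_mult (tensor_rep H (rp a) (tensor_rep H (rp b) (rp c))) d > 0"
proof -
  note R = rp(3)[OF a] rp(3)[OF b] rp(3)[OF c]
  have m: "rep_mult (rp c) x > 0 \<longleftrightarrow> x = c" if "c \<in> Irr H" for c x
    using mult_simple[OF rp(1)[OF that]] rp(2)[OF that] by auto
  show "d \<in> (\<Union>u\<in>hp a b. hp u c) \<longleftrightarrow> rep_mult (tensor_rep H (tensor_rep H (rp a) (rp b)) (rp c)) d > 0"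
    unfolding mult_tensor_pos[OF tensor_rep_Rep[OF R(1,2)] R(3)] using hp_Irr[OF a b] c
    by (auto simp: m hp_def)
  show "d \<in> (\<Union>v\<in>hp b c. hp a v) \<longleftrightarrow> rep_mult (tensor_rep H (rp a) (tensor_rep H (rp b) (rp c))) d > 0"
    unfolding mult_tensor_pos[OF R(1) tensor_rep_Rep[OF R(2,3)]] using hp_Irr[OF b c] a
    by (auto simp: m hp_def)
qed

text \<open>Reversibility is proved with the actual duals and then carried over to the chosen
  representatives of the dual classes, which have the same characters.\<close>

sublocale irr: polygroup "Irr H" hp unit_class dual_class
proof
  fix a b c d
  show "hp a b \<subseteq> Irr H" if "a \<in> Irr H" "b \<in> Irr H" by (rule hp_Irr[OF that])
  show "unit_class \<in> Irr H" by (rule unit_class_Irr)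
  show "dual_class a \<in> Irr H" "dual_class (dual_class a) = a" if "a \<in> Irr H" using dual_class[OF that] by auto
  show "(\<Union>u\<in>hp a b. hp u c) = (\<Union>v\<in>hp b c. hp a v)" if "a \<in> Irr H" "b \<in> Irr H" "c \<in> Irr H"
  proof (rule Set.set_eqI)
    fix d
    note R = that[THEN rp(3)]
    have "rep_mult (tensor_rep H (tensor_rep H (rp a) (rp b)) (rp c)) d = rep_mult (tensor_rep H (rp a) (tensor_rep H (rp b) (rp c))) d"
      by (rule mult_cong) (use R in \<open>auto intro: tensor_rep_Rep character_tensor_assoc\<close>)
    then show "d \<in> (\<Union>u\<in>hp a b. hp u c) \<longleftrightarrow> d \<in> (\<Union>v\<in>hp b c. hp a v)"
      unfolding hp_triple[OF that] by simp
  qed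
  show "hp unit_class a = {a}" "hp a unit_class = {a}" if "a \<in> Irr H"
    using mult_tensor_unit[OF rp(3)[OF that]] mult_simple[OF rp(1)[OF that]] rp(2)[OF that]
    by (auto simp: hp_def)
  show "c \<in> hp (dual_class b) d" if b: "b \<in> Irr H" and c: "c \<in> Irr H" and d: "d \<in> hp b c"
  proof -
    have dI: "d \<in> Irr H" using hp_Irr[OF b c] d by blast
    have "rep_mult (tensor_rep H (dual_rep H (rp b)) (rp d)) c > 0"
      using dual_left_mult[OF rp(3)[OF b] c dI] d by (simp add: hp_def)
    then show ?thesis
      unfolding hp_def using mult_tensor_cong[OF rp(3)[OF dual_class(1)[OF b]] dual_rep_Rep[OF rp(3)[OF b]] rp(3)[OF dI] rp(3)[OF dI]
        character_rp_dual[OF b] HOL.refl] by simp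
  qed
  show "b \<in> hp d (dual_class c)" if b: "b \<in> Irr H" and c: "c \<in> Irr H" and d: "d \<in> hp b c"
  proof -
    have dI: "d \<in> Irr H" using hp_Irr[OF b c] d by blast
    have "rep_mult (tensor_rep H (rp d) (dual_rep H (rp c))) b > 0"
      using dual_right_mult[OF b rp(3)[OF c] dI] d by (simp add: hp_def)
    then show ?thesis
      unfolding hp_def using mult_tensor_cong[OF rp(3)[OF dI] rp(3)[OF dI] rp(3)[OF dual_class(1)[OF c]] dual_rep_Rep[OF rp(3)[OF c]]
        HOL.refl character_rp_dual[OF c]] by simp
  qed
qed

end

section \<open>The adjoint subcategory and the universal grading\<close>

context semisimple_hopf_algebra
begin

lemma full_tensor_subcategory_Rep: "full_tensor_subcategory H (Rep H)"
  unfolding full_tensor_subcategory_def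
  using unit_rep_Rep tensor_rep_Rep dual_rep_Rep direct_sum_rep_Rep by auto

abbreviation adjoint_generators :: "('k, 'h) rep set" where
  "adjoint_generators \<equiv> {Y \<in> Rep H. \<exists>X. simple_rep H X \<and> subobject Y (tensor_rep H X (dual_rep H X))}"

text \<open>The closure conditions pass to intersections; \<open>Rep H\<close> belongs to the
  family, so the intersection consists of representations.\<close>

lemma full_tensor_subcategory_adjoint: "full_tensor_subcategory H (adjoint_subcategory H)"
proof -
  let ?F = "{D. full_tensor_subcategory H D \<and> adjoint_generators \<subseteq> D}"
  have R: "Rep H \<in> ?F" using full_tensor_subcategory_Rep by auto
  have F: "D \<subseteq> Rep H" "unit_rep H \<in> D" "\<And>V W. V \<in> D \<Longrightarrow> W \<in> D \<Longrightarrow> tensor_rep H V W \<in> D" "\<And>V. V \<in> D \<Longrightarrow> dual_rep H V \<in> D"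
    "\<And>Vs. set Vs \<subseteq> D \<Longrightarrow> direct_sum_rep Vs \<in> D" "\<And>V W. V \<in> D \<Longrightarrow> W \<in> Rep H \<Longrightarrow> subobject W V \<Longrightarrow> W \<in> D"
    if "D \<in> ?F" for D
    using that unfolding full_tensor_subcategory_def by blast+
  have eq: "adjoint_subcategory H = \<Inter>?F"
    by (simp add: adjoint_subcategory_def generated_subcategory_def)
  show ?thesis
    unfolding eq
  proof (subst full_tensor_subcategory_def, intro conjI ballI allI impI)
    show "\<Inter>?F \<subseteq> Rep H" using R by blast
    show "unit_rep H \<in> \<Inter>?F" using F(2) by blast
    show "tensor_rep H V W \<in> \<Inter>?F" if "V \<in> \<Inter>?F" "W \<in> \<Inter>?F" for V W
    proof (rule InterI)
      fix D assume "D \<in> ?F" then show "tensor_rep H V W \<in> D" using F(3) that by blast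
    qed
    show "dual_rep H V \<in> \<Inter>?F" if "V \<in> \<Inter>?F" for V
    proof (rule InterI)
      fix D assume "D \<in> ?F" then show "dual_rep H V \<in> D" using F(4) that by blast
    qed
    show "direct_sum_rep Vs \<in> \<Inter>?F" if "set Vs \<subseteq> \<Inter>?F" for Vs
    proof (rule InterI)
      fix D assume "D \<in> ?F" then show "direct_sum_rep Vs \<in> D" using F(5) that by blast
    qed
    show "W \<in> \<Inter>?F" if "V \<in> \<Inter>?F" "W \<in> Rep H" "subobject W V" for V W
    proof (rule InterI)
      fix D assume "D \<in> ?F" then show "W \<in> D" using F(6) that by blast
    qed
  qed
qed

lemma adjoint_subcategory_least:
  "full_tensor_subcategory H D \<Longrightarrow> adjoint_generators \<subseteq> D \<Longrightarrow> adjoint_subcategory H \<subseteq> D"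
  unfolding adjoint_subcategory_def generated_subcategory_def by blast

lemma adjoint_generators_subset: "adjoint_generators \<subseteq> adjoint_subcategory H"
  unfolding adjoint_subcategory_def generated_subcategory_def by blast

lemma full_tensor_subcategoryD:
  assumes "full_tensor_subcategory H D"
  shows "D \<subseteq> Rep H" "unit_rep H \<in> D" "V \<in> D \<Longrightarrow> W \<in> D \<Longrightarrow> tensor_rep H V W \<in> D" "V \<in> D \<Longrightarrow> dual_rep H V \<in> D"
    "set Vs \<subseteq> D \<Longrightarrow> direct_sum_rep Vs \<in> D" "V \<in> D \<Longrightarrow> W \<in> Rep H \<Longrightarrow> subobject W V \<Longrightarrow> W \<in> D"
  using assms unfolding full_tensor_subcategory_def by blast+

lemma left_inverse_subobject:
  assumes "V \<in> Rep H" "A \<in> rep_hom V W" "B \<in> rep_hom W V" "B * A = 1\<^sub>m (fst V)"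
  shows "subobject V W"
  unfolding subobject_def using left_inverse_mono[OF assms(2) rep_hom_carrier[OF assms(3)] assms(4)] by blast

lemma iso_subobject: "V \<in> Rep H \<Longrightarrow> rep_iso V W \<Longrightarrow> subobject V W"
  unfolding rep_iso_def rep_isomorphism_def using left_inverse_subobject by blast

lemma constituent_mem:
  assumes D: "full_tensor_subcategory H D" and V: "V \<in> D" and b: "rep_mult V b > 0"
  shows "rp b \<in> D"
proof -
  have VR: "V \<in> Rep H" using full_tensor_subcategoryD(1)[OF D] V by blast
  have "b \<in> Irr H" using b mult_notin_Irr[OF VR] by force
  note R = rp(3)[OF this]
  obtain A B where AB: "A \<in> rep_hom (rp b) V" "B \<in> rep_hom V (rp b)" "B * A = 1\<^sub>m (fst (rp b))"
    by (rule mult_pos_homs[OF VR b])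
  show ?thesis using full_tensor_subcategoryD(6)[OF D V R left_inverse_subobject[OF R AB]] .
qed

text \<open>If \<open>idem b\<close> acted as 0 on V, the inclusion of W together with its
  retraction would make it act as 0 on W.\<close>

lemma subobject_mult:
  assumes V: "V \<in> Rep H" and W: "W \<in> Rep H" and sub: "subobject W V" and b: "rep_mult W b > 0"
  shows "rep_mult V b > 0"
proof (rule ccontr)
  assume "\<not> ?thesis"
  then have z: "snd V (idem b) = 0\<^sub>m (fst V) (fst V)" using mult_zero_iff[OF V] by simp
  obtain T where T: "rep_mono W V T" using sub unfolding subobject_def by blast
  then have Th: "T \<in> rep_hom W V" by (simp add: rep_mono_def)
  obtain Q where Q: "Q \<in> rep_hom V W" "Q * T = 1\<^sub>m (fst W)" by (rule mono_retraction[OF W V T])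
  note c = rep_hom_carrier[OF Q(1)] rep_hom_carrier[OF Th]
  have "snd W (idem b) = Q * T * snd W (idem b)" using Q(2) W by simp
  also have "\<dots> = Q * (snd V (idem b) * T)"
    unfolding rep_hom_comm[OF Th, symmetric] by (rule assoc_mult_mat[OF c Rep_carrier[OF W]])
  also have "\<dots> = 0\<^sub>m (fst W) (fst W)" unfolding z using c by simp
  finally show False using mult_zero_iff[OF W, of b] b by simp
qed

text \<open>The passage from sets of classes to full subcategories. It translates closed sets of
  classes into competitors in the intersection that defines the adjoint subcategory.\<close>

definition subcategory_of :: "('k, 'h) rep set set \<Rightarrow> ('k, 'h) rep set" where
  "subcategory_of M = {V \<in> Rep H. \<forall>b. rep_mult V b > 0 \<longrightarrow> b \<in> M}"

lemma mult_dual_pos: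
  assumes V: "V \<in> Rep H" and pos: "rep_mult (dual_rep H V) b > 0"
  shows "\<exists>a\<in>Irr H. rep_mult V a > 0 \<and> b = dual_class a"
proof (rule ccontr)
  assume c: "\<not> ?thesis"
  note D = dual_rep_Rep[OF V]
  have b: "b \<in> Irr H" using pos mult_notin_Irr[OF D] by force
  have "of_nat (rep_mult (dual_rep H V) b * fst (rp b)) = character (dual_rep H V) (idem b)"
    by (rule character_idem[OF D b, symmetric])
  also have "\<dots> = (\<Sum>a\<in>Irr H. of_nat (rep_mult V a) * character (rp (dual_class a)) (idem b))"
    unfolding character_dual[OF V] character_mult[OF V]
    by (rule sum.cong) (simp_all add: character_rp_dual character_dual rp)
  also have "\<dots> = 0"
  proof (rule sum.neutral, rule ballI)
    fix a assume a: "a \<in> Irr H"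
    show "of_nat (rep_mult V a) * character (rp (dual_class a)) (idem b) = 0"
      using c a dual_class(1)[OF a] by (cases "rep_mult V a = 0") (auto simp: character_idem_simple rp)
  qed
  finally have "rep_mult (dual_rep H V) b * fst (rp b) = 0" unfolding of_nat_eq_0_iff .
  then show False using pos rp(4)[OF b] by simp
qed

lemma mult_direct_sum_pos:
  assumes Vs: "set Vs \<subseteq> Rep H" and pos: "rep_mult (direct_sum_rep Vs) b > 0"
  shows "\<exists>V\<in>set Vs. rep_mult V b > 0"
proof (rule ccontr)
  assume c: "\<not> ?thesis"
  note D = direct_sum_rep_Rep[OF Vs]
  have b: "b \<in> Irr H" using pos mult_notin_Irr[OF D] by force
  have "of_nat (rep_mult (direct_sum_rep Vs) b * fst (rp b)) = (\<Sum>V\<leftarrow>Vs. character V (idem b))"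
    unfolding character_idem[OF D b, symmetric] by (rule direct_sum_character[OF Vs])
  also have "\<dots> = (\<Sum>V\<leftarrow>Vs. 0)"
    by (rule arg_cong[where f = sum_list], rule map_cong[OF HOL.refl]) (use c Vs character_idem[OF _ b] in auto)
  finally have "(of_nat (rep_mult (direct_sum_rep Vs) b * fst (rp b)) :: 'k) = 0" by simp
  then have "rep_mult (direct_sum_rep Vs) b * fst (rp b) = 0" unfolding of_nat_eq_0_iff .
  then show False using pos rp(4)[OF b] by simp
qed

lemma full_tensor_subcategory_of:
  assumes unit: "unit_class \<in> M" and hpM: "\<And>a b. a \<in> M \<Longrightarrow> b \<in> M \<Longrightarrow> hp a b \<subseteq> M"
    and dualM: "\<And>a. a \<in> M \<Longrightarrow> dual_class a \<in> M"
  shows "full_tensor_subcategory H (subcategory_of M)"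
  unfolding full_tensor_subcategory_def
proof (intro conjI ballI allI impI)
  show "subcategory_of M \<subseteq> Rep H" by (auto simp: subcategory_of_def)
  show "unit_rep H \<in> subcategory_of M"
    using unit by (auto simp: subcategory_of_def unit_rep_Rep mult_simple[OF unit_rep_simple] unit_class_def split: if_splits)
  show "tensor_rep H V W \<in> subcategory_of M" if "V \<in> subcategory_of M" "W \<in> subcategory_of M" for V W
    using that hpM unfolding subcategory_of_def by (auto simp: tensor_rep_Rep mult_tensor_pos hp_def)
  show "dual_rep H V \<in> subcategory_of M" if "V \<in> subcategory_of M" for V
  proof -
    have V: "V \<in> Rep H" and VM: "\<And>a. rep_mult V a > 0 \<Longrightarrow> a \<in> M" using that by (auto simp: subcategory_of_def)
    have "b \<in> M" if "rep_mult (dual_rep H V) b > 0" for b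
      using mult_dual_pos[OF V that] VM dualM by blast
    then show ?thesis using dual_rep_Rep[OF V] by (simp add: subcategory_of_def)
  qed
  show "direct_sum_rep Vs \<in> subcategory_of M" if "set Vs \<subseteq> subcategory_of M" for Vs
  proof -
    have "set Vs \<subseteq> Rep H" using that by (auto simp: subcategory_of_def)
    then show ?thesis
      using that mult_direct_sum_pos[of Vs] direct_sum_rep_Rep[of Vs] unfolding subcategory_of_def by blast
  qed
  show "W \<in> subcategory_of M" if "V \<in> subcategory_of M" "W \<in> Rep H" "subobject W V" for V W
    using that subobject_mult unfolding subcategory_of_def by blast
qed

definition adjoint_classes :: "('k, 'h) rep set set" where
  "adjoint_classes = iso_class H ` {X \<in> adjoint_subcategory H. simple_rep H X}"

lemma adjoint_classes_Irr: "adjoint_classes \<subseteq> Irr H"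
  by (auto simp: adjoint_classes_def Irr_iff)

lemma adjoint_constituent: "V \<in> adjoint_subcategory H \<Longrightarrow> rep_mult V b > 0 \<Longrightarrow> b \<in> adjoint_classes"
proof -
  assume V: "V \<in> adjoint_subcategory H" and b: "rep_mult V b > 0"
  have VR: "V \<in> Rep H" using full_tensor_subcategoryD(1)[OF full_tensor_subcategory_adjoint] V by blast
  have bI: "b \<in> Irr H" using b mult_notin_Irr[OF VR] by force
  have "rp b \<in> adjoint_subcategory H" by (rule constituent_mem[OF full_tensor_subcategory_adjoint V b])
  then show "b \<in> adjoint_classes" unfolding adjoint_classes_def using rp(1,2)[OF bI] by force
qed

lemma adjoint_class_rp: "b \<in> adjoint_classes \<Longrightarrow> rp b \<in> adjoint_subcategory H"
proof -
  assume "b \<in> adjoint_classes"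
  then obtain X where X: "X \<in> adjoint_subcategory H" "simple_rep H X" "b = iso_class H X"
    by (auto simp: adjoint_classes_def)
  show "rp b \<in> adjoint_subcategory H"
    by (rule constituent_mem[OF full_tensor_subcategory_adjoint X(1)]) (simp add: mult_simple[OF X(2)] X(3))
qed

text \<open>A full tensor subcategory is determined by its simple members: constituents are
  subobjects, and conversely an object is isomorphic to the direct sum of its constituents.\<close>

lemma adjoint_subcategory_iff:
  assumes V: "V \<in> Rep H"
  shows "V \<in> adjoint_subcategory H \<longleftrightarrow> (\<forall>b. rep_mult V b > 0 \<longrightarrow> b \<in> adjoint_classes)"
proof
  assume "V \<in> adjoint_subcategory H"
  then show "\<forall>b. rep_mult V b > 0 \<longrightarrow> b \<in> adjoint_classes" using adjoint_constituent by blast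
next
  note full = full_tensor_subcategoryD[OF full_tensor_subcategory_adjoint]
  assume c: "\<forall>b. rep_mult V b > 0 \<longrightarrow> b \<in> adjoint_classes"
  obtain Ds where D: "decomposition V Ds" "rep_iso V (direct_sum_rep (map fst Ds))"
    using exists_decomposition[OF V] by blast
  have "X \<in> adjoint_subcategory H" if X: "X \<in> set (map fst Ds)" for X
  proof -
    have s: "simple_rep H X" by (rule decomposition_simple[OF D(1) X])
    have "rep_mult V (iso_class H X) > 0"
      unfolding mult_decomposition[OF V D(1)] using X by (force simp: filter_empty_conv)
    then have "rp (iso_class H X) \<in> adjoint_subcategory H" using c adjoint_class_rp by blast
    then show ?thesis
      using full(6)[OF _ simple_repD(1)[OF s] iso_subobject[OF simple_repD(1)[OF s] rp_iso[OF s]]] by blast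
  qed
  then have "direct_sum_rep (map fst Ds) \<in> adjoint_subcategory H" by (intro full(5)) blast
  then show "V \<in> adjoint_subcategory H" using full(6)[OF _ V iso_subobject[OF V D(2)]] by blast
qed

lemma mult_adjoint_object:
  assumes X: "simple_rep H X"
  shows "rep_mult (tensor_rep H X (dual_rep H X)) b > 0 \<longleftrightarrow> b \<in> hp (iso_class H X) (dual_class (iso_class H X))"
proof -
  note XR = simple_repD(1)[OF X] and I = Irr_iff[OF X]
  have "rep_mult (tensor_rep H X (dual_rep H X)) b = rep_mult (tensor_rep H (rp (iso_class H X)) (rp (dual_class (iso_class H X)))) b"
    using simple_dual[OF X] character_rp[OF X] character_rp[OF simple_dual(1)[OF X]]
    by (intro mult_tensor_cong XR dual_rep_Rep rp(3) I dual_class(1)) simp_all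
  then show ?thesis by (simp add: hp_def)
qed

sublocale adj: adjoint_subpolygroup "Irr H" hp unit_class dual_class adjoint_classes
proof
  note full = full_tensor_subcategoryD[OF full_tensor_subcategory_adjoint]
  show "adjoint_classes \<subseteq> Irr H" by (rule adjoint_classes_Irr)
  show "unit_class \<in> adjoint_classes"
    by (rule adjoint_constituent[OF full(2)]) (simp add: mult_simple[OF unit_rep_simple] unit_class_def)
  show "hp a b \<subseteq> adjoint_classes" if "a \<in> adjoint_classes" "b \<in> adjoint_classes" for a b
    using adjoint_constituent[OF full(3)[OF that[THEN adjoint_class_rp]]] by (auto simp: hp_def)
  show "dual_class a \<in> adjoint_classes" if "a \<in> adjoint_classes" for a
  proof -
    have a: "a \<in> Irr H" using that adjoint_classes_Irr by blast
    show ?thesis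
      by (rule adjoint_constituent[OF full(4)[OF adjoint_class_rp[OF that]]])
        (simp add: mult_simple[OF simple_dual(1)[OF rp(1)[OF a]]] dual_class_def)
  qed
  show "hp x (dual_class x) \<subseteq> adjoint_classes" if x: "x \<in> Irr H" for x
  proof
    fix c assume c: "c \<in> hp x (dual_class x)"
    have cI: "c \<in> Irr H" using irr.hp_mem[OF x dual_class(1)[OF x] c] .
    let ?V = "tensor_rep H (rp x) (dual_rep H (rp x))"
    have V: "?V \<in> Rep H" by (intro tensor_rep_Rep dual_rep_Rep rp x)
    have "rep_mult ?V c > 0" using mult_adjoint_object[OF rp(1)[OF x]] c rp(2)[OF x] by simp
    then obtain A B where "A \<in> rep_hom (rp c) ?V" "B \<in> rep_hom ?V (rp c)" "B * A = 1\<^sub>m (fst (rp c))"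
      by (rule mult_pos_homs[OF V])
    then have "subobject (rp c) ?V" using left_inverse_subobject[OF rp(3)[OF cI]] by blast
    then have "rp c \<in> adjoint_generators" using rp(3)[OF cI] rp(1)[OF x] by blast
    then have "rp c \<in> adjoint_subcategory H" using adjoint_generators_subset by blast
    then show "c \<in> adjoint_classes"
      by (rule adjoint_constituent) (simp add: mult_simple[OF rp(1)[OF cI]] rp(2)[OF cI])
  qed
  fix M :: "('k, 'h) rep set set"
  assume M: "M \<subseteq> Irr H" "unit_class \<in> M" "\<And>a b. a \<in> M \<Longrightarrow> b \<in> M \<Longrightarrow> hp a b \<subseteq> M"
    "\<And>a. a \<in> M \<Longrightarrow> dual_class a \<in> M" "\<And>x. x \<in> Irr H \<Longrightarrow> hp x (dual_class x) \<subseteq> M"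
  \<comment> \<open>Minimality on the level of classes is inherited from minimality of the
    subcategory, since the objects with all constituents in \<open>M\<close> form a full tensor
    subcategory containing the generators.\<close>
  have "adjoint_subcategory H \<subseteq> subcategory_of M"
  proof (rule adjoint_subcategory_least[OF full_tensor_subcategory_of[OF M(2-4)]])
    show "adjoint_generators \<subseteq> subcategory_of M"
    proof
      fix Y assume "Y \<in> adjoint_generators"
      then obtain X where Y: "Y \<in> Rep H" and X: "simple_rep H X" "subobject Y (tensor_rep H X (dual_rep H X))" by blast
      have V: "tensor_rep H X (dual_rep H X) \<in> Rep H" by (intro tensor_rep_Rep dual_rep_Rep simple_repD(1)[OF X(1)])
      have "b \<in> M" if "rep_mult Y b > 0" for b
        using subobject_mult[OF V Y X(2) that] mult_adjoint_object[OF X(1)] M(5)[OF Irr_iff[OF X(1)]] by blast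
      then show "Y \<in> subcategory_of M" using Y by (simp add: subcategory_of_def)
    qed
  qed
  then have sub: "rp b \<in> subcategory_of M" if "b \<in> adjoint_classes" for b using adjoint_class_rp[OF that] by blast
  show "adjoint_classes \<subseteq> M"
  proof
    fix b assume b: "b \<in> adjoint_classes"
    then have bI: "b \<in> Irr H" using adjoint_classes_Irr by blast
    have "rep_mult (rp b) b > 0" by (simp add: mult_simple[OF rp(1)[OF bI]] rp(2)[OF bI])
    then show "b \<in> M" using sub[OF b] by (simp add: subcategory_of_def)
  qed
qed

section \<open>Supports in the Grothendieck ring and based subbimodules\<close>

lemma mem_based_span: "r \<in> based_span T \<longleftrightarrow> Poly_Mapping.keys r \<subseteq> T"
  by (simp add: based_span_def)

lemma frag_of_based_span: "frag_of b \<in> based_span T \<longleftrightarrow> b \<in> T"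
  by (simp add: mem_based_span)

lemma based_span_inject: "based_span T = based_span T' \<longleftrightarrow> T = T'"
proof
  assume "based_span T = based_span T'"
  then have "frag_of b \<in> based_span T \<longleftrightarrow> frag_of b \<in> based_span T'" for b by simp
  then show "T = T'" unfolding frag_of_based_span by blast
qed simp

lemma based_span_zero_iff:
  fixes T :: "('k, 'h) rep set set"
  shows "based_span T = {0} \<longleftrightarrow> T = {}"
proof -
  have "based_span {} = ({0} :: (('k, 'h) rep set \<Rightarrow>\<^sub>0 int) set)" by (auto simp: mem_based_span)
  then show ?thesis using based_span_inject[of T "{}"] by auto
qed

lemma based_span_Int: "based_span T \<inter> based_span T' = based_span (T \<inter> T')"
  by (auto simp: mem_based_span)

lemma based_span_Un: "based_span (T \<union> T') = based_span T + based_span T'"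
proof
  show "based_span (T \<union> T') \<subseteq> based_span T + based_span T'"
  proof
    fix r assume "r \<in> based_span (T \<union> T')"
    then have "Poly_Mapping.keys r \<subseteq> T \<union> T'" by (simp add: mem_based_span)
    then obtain d e where "Poly_Mapping.keys d \<subseteq> T" "Poly_Mapping.keys e \<subseteq> T'" "d + e = r" by (rule frag_split)
    then show "r \<in> based_span T + based_span T'" by (auto simp: mem_based_span intro!: set_plus_intro)
  qed
  show "based_span T + based_span T' \<subseteq> based_span (T \<union> T')"
    using keys_add by (fastforce simp: mem_based_span elim!: set_plus_elim)
qed

lemma keys_K0_class: "V \<in> Rep H \<Longrightarrow> Poly_Mapping.keys (K0_class H V) = {b. rep_mult V b > 0}"
  by (auto simp: in_keys_iff lookup_K0_class)

lemma K0_mult_of: "K0_mult H (frag_of b) (frag_of c) = K0_class H (tensor_rep H (rp b) (rp c))"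
  by (simp add: K0_mult_def rp_def)

text \<open>For basis elements the support is exact, because the coefficients of the product are
  multiplicities.\<close>

lemma keys_K0_mult_of:
  assumes "b \<in> Irr H" "c \<in> Irr H"
  shows "Poly_Mapping.keys (K0_mult H (frag_of b) (frag_of c)) = hp b c"
  using assms by (simp add: K0_mult_of keys_K0_class tensor_rep_Rep rp hp_def)

text \<open>Only an inclusion, since coefficients of opposite sign may cancel.\<close>

lemma keys_K0_mult:
  assumes "Poly_Mapping.keys r \<subseteq> Irr H" "Poly_Mapping.keys s \<subseteq> Irr H"
  shows "Poly_Mapping.keys (K0_mult H r s) \<subseteq> (\<Union>b\<in>Poly_Mapping.keys r. \<Union>c\<in>Poly_Mapping.keys s. hp b c)"
proof -
  have "Poly_Mapping.keys (K0_mult H r s) \<subseteq>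
    (\<Union>b\<in>Poly_Mapping.keys r. \<Union>c\<in>Poly_Mapping.keys s. Poly_Mapping.keys (K0_class H (tensor_rep H (rp b) (rp c))))"
    unfolding K0_mult_def rp_def
    by (rule order_trans[OF keys_frag_extend], rule UN_mono[OF order_refl], rule keys_frag_extend)
  also have "\<dots> = (\<Union>b\<in>Poly_Mapping.keys r. \<Union>c\<in>Poly_Mapping.keys s. hp b c)"
    using assms by (intro SUP_cong HOL.refl) (auto simp: keys_K0_class tensor_rep_Rep rp hp_def subset_iff)
  finally show ?thesis .
qed

lemma K0_ad_eq: "K0_ad H = based_span adjoint_classes"
  by (simp add: K0_ad_def adjoint_classes_def)

text \<open>From left to right the module condition is tested on basis elements, where supports of
  products are exact; from right to left the inclusion of supports for general products
  suffices.\<close>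

lemma based_subbimodule_iff: "based_subbimodule H M \<longleftrightarrow> (\<exists>T. adj.stable T \<and> M = based_span T)"
proof
  assume "based_subbimodule H M"
  then obtain T where T: "T \<subseteq> Irr H" "M = based_span T"
    and st: "\<And>a r. a \<in> K0_ad H \<Longrightarrow> r \<in> M \<Longrightarrow> K0_mult H a r \<in> M \<and> K0_mult H r a \<in> M"
    unfolding based_subbimodule_def by blast
  have "hp n t \<subseteq> T \<and> hp t n \<subseteq> T" if n: "n \<in> adjoint_classes" and t: "t \<in> T" for n t
  proof -
    have I: "n \<in> Irr H" "t \<in> Irr H" using n t T adjoint_classes_Irr by auto
    have "K0_mult H (frag_of n) (frag_of t) \<in> M \<and> K0_mult H (frag_of t) (frag_of n) \<in> M"
      by (rule st) (use n t in \<open>auto simp: K0_ad_eq T(2) frag_of_based_span\<close>)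
    then show ?thesis unfolding T(2) mem_based_span keys_K0_mult_of[OF I] keys_K0_mult_of[OF I(2,1)] .
  qed
  then have "adj.stable T" unfolding adj.stable_def using T(1) by simp
  then show "\<exists>T. adj.stable T \<and> M = based_span T" using T(2) by blast
next
  assume "\<exists>T. adj.stable T \<and> M = based_span T"
  then obtain T where T: "adj.stable T" "M = based_span T" by blast
  then have TI: "T \<subseteq> Irr H" and st: "\<And>n t. n \<in> adjoint_classes \<Longrightarrow> t \<in> T \<Longrightarrow> hp n t \<subseteq> T \<and> hp t n \<subseteq> T"
    unfolding adj.stable_def by auto
  have "K0_mult H a r \<in> M \<and> K0_mult H r a \<in> M" if "a \<in> K0_ad H" "r \<in> M" for a r
  proof -
    have k: "Poly_Mapping.keys a \<subseteq> adjoint_classes" "Poly_Mapping.keys r \<subseteq> T"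
      using that by (auto simp: K0_ad_eq T(2) mem_based_span)
    then have kI: "Poly_Mapping.keys a \<subseteq> Irr H" "Poly_Mapping.keys r \<subseteq> Irr H" using adjoint_classes_Irr TI by auto
    show ?thesis
      unfolding T(2) mem_based_span using keys_K0_mult[OF kI] keys_K0_mult[OF kI(2,1)] st k by blast
  qed
  then show "based_subbimodule H M" unfolding based_subbimodule_def using TI T(2) by blast
qed

text \<open>A nonempty stable set contains the coset of each of its members, and removing a coset
  leaves a stable set. So the indecomposable stable sets are single cosets, and two disjoint
  nonempty stable sets cannot fill one coset.\<close>

lemma indecomposable_iff: "indecomposable_subbimodule H M \<longleftrightarrow> (\<exists>c\<in>Irr H. M = based_span (adj.coset c))"
proof
  assume M: "indecomposable_subbimodule H M"
  then have bs: "based_subbimodule H M" and M0: "M \<noteq> {0}" by (simp_all add: indecomposable_subbimodule_def)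
  obtain T where T: "adj.stable T" "M = based_span T" using bs unfolding based_subbimodule_iff by blast
  have ne: "T \<noteq> {}" using M0 unfolding T(2) based_span_zero_iff .
  then obtain c where c: "c \<in> T" by blast
  have cI: "c \<in> Irr H" using c T(1) by (auto simp: adj.stable_def)
  have sub: "adj.coset c \<subseteq> T" by (rule adj.stable_contains_coset[OF T(1) c])
  have "T - adj.coset c = {}"
  proof (rule ccontr)
    assume ne2: "T - adj.coset c \<noteq> {}"
    have "based_subbimodule H (based_span (adj.coset c))" "based_subbimodule H (based_span (T - adj.coset c))"
      unfolding based_subbimodule_iff using adj.stable_coset[OF cI] adj.stable_diff_coset[OF T(1) cI] by blast+
    moreover have "based_span (adj.coset c) \<noteq> {0}" "based_span (T - adj.coset c) \<noteq> {0}"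
      unfolding based_span_zero_iff using adj.coset_self[OF cI] ne2 by blast+
    moreover have "based_span (adj.coset c) \<inter> based_span (T - adj.coset c) = {0}"
      unfolding based_span_Int based_span_zero_iff by blast
    moreover have "M = based_span (adj.coset c) + based_span (T - adj.coset c)"
      unfolding based_span_Un[symmetric] T(2) using sub by (simp add: Un_absorb1)
    moreover have "\<not> (\<exists>M\<^sub>1 M\<^sub>2. based_subbimodule H M\<^sub>1 \<and> based_subbimodule H M\<^sub>2 \<and> M\<^sub>1 \<noteq> {0} \<and> M\<^sub>2 \<noteq> {0} \<and>
          M\<^sub>1 \<inter> M\<^sub>2 = {0} \<and> M = M\<^sub>1 + M\<^sub>2)"
      using M unfolding indecomposable_subbimodule_def by (elim conjE)
    ultimately show False by blast
  qed
  then have "T = adj.coset c" using sub by blast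
  then show "\<exists>c\<in>Irr H. M = based_span (adj.coset c)" using T(2) cI by blast
next
  assume "\<exists>c\<in>Irr H. M = based_span (adj.coset c)"
  then obtain c where c: "c \<in> Irr H" and M: "M = based_span (adj.coset c)" by blast
  show "indecomposable_subbimodule H M"
    unfolding indecomposable_subbimodule_def
  proof (intro conjI notI)
    show "based_subbimodule H M" unfolding based_subbimodule_iff using adj.stable_coset[OF c] M by blast
    show False if "M = {0}"
    proof -
      have "adj.coset c = {}" using that unfolding M based_span_zero_iff .
      then show False using adj.coset_self[OF c] by simp
    qed
    assume "\<exists>M\<^sub>1 M\<^sub>2. based_subbimodule H M\<^sub>1 \<and> based_subbimodule H M\<^sub>2 \<and> M\<^sub>1 \<noteq> {0} \<and> M\<^sub>2 \<noteq> {0} \<and>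
          M\<^sub>1 \<inter> M\<^sub>2 = {0} \<and> M = M\<^sub>1 + M\<^sub>2"
    then obtain M1 M2 where MM: "based_subbimodule H M1" "based_subbimodule H M2" "M1 \<noteq> {0}" "M2 \<noteq> {0}"
      "M1 \<inter> M2 = {0}" "M = M1 + M2" by (elim exE conjE)
    obtain T1 where T1: "adj.stable T1" "M1 = based_span T1" using MM(1) unfolding based_subbimodule_iff by blast
    obtain T2 where T2: "adj.stable T2" "M2 = based_span T2" using MM(2) unfolding based_subbimodule_iff by blast
    have st: "adj.stable T1" "adj.stable T2" and ne: "T1 \<noteq> {}" "T2 \<noteq> {}"
      and int: "T1 \<inter> T2 = {}" and M': "M = based_span (T1 \<union> T2)"
      using T1(1) T2(1) MM(3-6) unfolding T1(2) T2(2) based_span_zero_iff based_span_Int based_span_Un by auto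
    have TT: "adj.coset c = T1 \<union> T2" using M' unfolding M based_span_inject .
    have "adj.coset c \<subseteq> T" if "adj.stable T" "T \<noteq> {}" "T \<subseteq> adj.coset c" for T
    proof -
      obtain a where a: "a \<in> T" using \<open>T \<noteq> {}\<close> by blast
      then have "adj.coset a = adj.coset c" using adj.coset_eq[OF c] that(3) by blast
      then show ?thesis using adj.stable_contains_coset[OF that(1) a] by simp
    qed
    then have "adj.coset c \<subseteq> T1" "adj.coset c \<subseteq> T2" using st ne TT by simp_all
    then have "adj.coset c \<subseteq> {}" using int by blast
    then show False using adj.coset_self[OF c] by blast
  qed
qed

end

section \<open>The maximal central Hopf subalgebra\<close>

context semisimple_hopf_algebra
begin

section \<open>Components of the grading and their group\<close>

definition component :: "('k, 'h) rep set \<Rightarrow> ('k, 'h) k0 set" where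
  "component c = based_span (adj.coset c)"

lemma component_eq_iff: "a \<in> Irr H \<Longrightarrow> b \<in> Irr H \<Longrightarrow> component a = component b \<longleftrightarrow> a \<in> adj.coset b"
  unfolding component_def based_span_inject using adj.coset_eq adj.coset_self by metis

lemma component_lookup:
  assumes c: "c \<in> Irr H" and r: "r \<in> component c" and b: "Poly_Mapping.lookup r b \<noteq> 0"
  shows "b \<in> Irr H" "component b = component c"
proof -
  have "b \<in> adj.coset c" using r b unfolding component_def mem_based_span by (auto simp: in_keys_iff)
  then show bI: "b \<in> Irr H" using adj.coset_sub[OF c] by blast
  then show "component b = component c" using component_eq_iff[OF bI c] \<open>b \<in> adj.coset c\<close> by simp
qed

lemma internal_direct_sum_components: "internal_direct_sum (component ` Irr H) (K0 H)"
  unfolding internal_direct_sum_def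
proof (intro conjI ballI)
  let ?A = "component ` Irr H"
  show "N \<subseteq> K0 H" if "N \<in> ?A" for N
    using that adj.coset_sub unfolding K0_def component_def mem_based_span by (fastforce simp: mem_based_span)
  fix r assume r: "r \<in> K0 H"
  \<comment> \<open>The terms of \<open>r\<close> whose basis element lies in the coset of the
    component \<open>N\<close>.\<close>
  define part where "part N = (\<Sum>b\<in>{b \<in> Irr H. component b = N}. frag_cmul (Poly_Mapping.lookup r b) (frag_of b))" for N
  have lp: "Poly_Mapping.lookup (part N) b = (if b \<in> Irr H \<and> component b = N then Poly_Mapping.lookup r b else 0)" for N b
  proof -
    have "Poly_Mapping.lookup (part N) b = (\<Sum>c\<in>{b \<in> Irr H. component b = N}. if c = b then Poly_Mapping.lookup r b else 0)"
      unfolding part_def lookup_sum by (rule sum.cong) auto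
    then show ?thesis using finite_Irr by simp
  qed
  have lsum: "Poly_Mapping.lookup (\<Sum>N\<in>{N \<in> ?A. f N \<noteq> 0}. f N) b = (\<Sum>N\<in>?A. Poly_Mapping.lookup (f N) b)"
    for f :: "('k, 'h) k0 set \<Rightarrow> ('k, 'h) k0" and b
    unfolding lookup_sum by (rule sum.mono_neutral_left) (use finite_Irr in auto)
  show "\<exists>!f. f \<in> (\<Pi>\<^sub>E N\<in>?A. N) \<and> finite {N \<in> ?A. f N \<noteq> 0} \<and> r = (\<Sum>N\<in>{N \<in> ?A. f N \<noteq> 0}. f N)"
  proof (rule ex1I[of _ "restrict part ?A"], intro conjI)
    show "restrict part ?A \<in> (\<Pi>\<^sub>E N\<in>?A. N)"
    proof (rule PiE_I)
      fix N assume "N \<in> ?A"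
      then obtain c where c: "c \<in> Irr H" "N = component c" by blast
      have "part N \<in> component c"
        unfolding component_def mem_based_span
      proof
        fix b assume "b \<in> Poly_Mapping.keys (part N)"
        then have "b \<in> Irr H" "component b = component c" using c by (auto simp: in_keys_iff lp split: if_splits)
        then show "b \<in> adj.coset c" using component_eq_iff c(1) by simp
      qed
      then show "restrict part ?A N \<in> N" using c by simp
    qed auto
    show "finite {N \<in> ?A. restrict part ?A N \<noteq> 0}" using finite_Irr by simp
    show "r = (\<Sum>N\<in>{N \<in> ?A. restrict part ?A N \<noteq> 0}. restrict part ?A N)"
    proof (rule poly_mapping_eqI)
      fix b
      have "Poly_Mapping.lookup (\<Sum>N\<in>{N \<in> ?A. restrict part ?A N \<noteq> 0}. restrict part ?A N) b =
        (\<Sum>N\<in>?A. if component b = N then (if b \<in> Irr H then Poly_Mapping.lookup r b else 0) else 0)"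
        unfolding lsum by (rule sum.cong) (auto simp: lp)
      also have "\<dots> = Poly_Mapping.lookup r b"
        using finite_Irr r unfolding K0_def mem_based_span by (auto simp: in_keys_iff)
      finally show "Poly_Mapping.lookup r b = Poly_Mapping.lookup (\<Sum>N\<in>{N \<in> ?A. restrict part ?A N \<noteq> 0}. restrict part ?A N) b"
        by simp
    qed
  next
    fix f assume f: "f \<in> (\<Pi>\<^sub>E N\<in>?A. N) \<and> finite {N \<in> ?A. f N \<noteq> 0} \<and> r = (\<Sum>N\<in>{N \<in> ?A. f N \<noteq> 0}. f N)"
    \<comment> \<open>Each \<open>f N\<close> is supported in the coset belonging to
      \<open>N\<close>, so at a given basis element only one summand contributes. This yields
      uniqueness.\<close>
    have zero: "Poly_Mapping.lookup (f N) b = 0" if "N \<in> ?A" "\<not> (b \<in> Irr H \<and> component b = N)" for N b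
      using that f component_lookup[of _ "f N" b] by (fastforce simp: PiE_iff)
    show "f = restrict part ?A"
    proof (rule ext)
      fix N
      show "f N = restrict part ?A N"
      proof (cases "N \<in> ?A")
        case True
        have "f N = part N"
        proof (rule poly_mapping_eqI)
          fix b
          have "Poly_Mapping.lookup r b = (\<Sum>N\<in>?A. Poly_Mapping.lookup (f N) b)" using f lsum[of f b] by simp
          also have "\<dots> = (\<Sum>N\<in>?A. if component b = N then Poly_Mapping.lookup (f (component b)) b else 0)"
            by (rule sum.cong) (use zero in auto)
          finally have "Poly_Mapping.lookup r b = Poly_Mapping.lookup (f (component b)) b" if "b \<in> Irr H"
            using that finite_Irr by simp
          then show "Poly_Mapping.lookup (f N) b = Poly_Mapping.lookup (part N) b"
            using zero[OF True, of b] by (auto simp: lp)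
        qed
        then show ?thesis using True by simp
      next
        case False
        then show ?thesis using PiE_arb[OF conjunct1[OF f] False] by simp
      qed
    qed
  qed
qed

text \<open>A competing family consists of components by \<open>indecomposable_iff\<close>. It
  contains all of them, since the basis element of c needs a summand with nonzero coefficient at c,
  and the only component with such elements is that of c.\<close>

lemma grading_components_eq: "grading_components H = component ` Irr H"
  unfolding grading_components_def
proof (rule the_equality)
  have ind: "indecomposable_subbimodule H M \<longleftrightarrow> M \<in> component ` Irr H" for M
    unfolding indecomposable_iff image_iff component_def ..
  show "(\<forall>M\<in>component ` Irr H. indecomposable_subbimodule H M) \<and> internal_direct_sum (component ` Irr H) (K0 H)"
    by (simp only: ind internal_direct_sum_components ball_simps) simp
  fix \<A> assume A: "(\<forall>M\<in>\<A>. indecomposable_subbimodule H M) \<and> internal_direct_sum \<A> (K0 H)"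
  have sub: "\<A> \<subseteq> component ` Irr H" using A ind by blast
  have "component c \<in> \<A>" if c: "c \<in> Irr H" for c
  proof -
    have "frag_of c \<in> K0 H" using c unfolding K0_def frag_of_based_span .
    then have "\<exists>!f. f \<in> (\<Pi>\<^sub>E N\<in>\<A>. N) \<and> finite {N \<in> \<A>. f N \<noteq> 0} \<and> frag_of c = (\<Sum>N\<in>{N \<in> \<A>. f N \<noteq> 0}. f N)"
      using A unfolding internal_direct_sum_def by simp
    then obtain f where f: "f \<in> (\<Pi>\<^sub>E N\<in>\<A>. N)" "frag_of c = (\<Sum>N\<in>{N \<in> \<A>. f N \<noteq> 0}. f N)"
      by (elim ex1E conjE)
    have "(\<Sum>N\<in>{N \<in> \<A>. f N \<noteq> 0}. Poly_Mapping.lookup (f N) c) = Poly_Mapping.lookup (frag_of c) c"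
      unfolding f(2) by (rule lookup_sum[symmetric])
    then have "(\<Sum>N\<in>{N \<in> \<A>. f N \<noteq> 0}. Poly_Mapping.lookup (f N) c) \<noteq> 0" by simp
    then obtain N where "N \<in> {N \<in> \<A>. f N \<noteq> 0}" and Nc: "Poly_Mapping.lookup (f N) c \<noteq> 0"
      by (rule sum.not_neutral_contains_not_neutral)
    then have N: "N \<in> \<A>" "Poly_Mapping.lookup (f N) c \<noteq> 0" by simp_all
    obtain d where d: "d \<in> Irr H" "N = component d" using sub N(1) by blast
    have "f N \<in> component d" using f(1) N(1) d(2) by (auto simp: PiE_iff)
    then show ?thesis using component_lookup(2)[OF d(1) _ N(2)] d(2) N(1) by simp
  qed
  then show "\<A> = component ` Irr H" using sub by blast
qed

abbreviation U :: "('k, 'h) k0 set monoid" where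
  "U \<equiv> universal_grading_group H"

lemma U_carrier: "carrier U = component ` Irr H"
  by (simp add: universal_grading_group_def grading_components_eq)

lemma U_one: "\<one>\<^bsub>U\<^esub> = component unit_class"
  by (simp add: universal_grading_group_def K0_ad_eq component_def adj.coset_unit)

lemma U_finite: "finite (carrier U)"
  using finite_Irr by (simp add: U_carrier)

lemma component_carrier: "b \<in> Irr H \<Longrightarrow> component b \<in> carrier U"
  by (simp add: U_carrier)

text \<open>Products of the two components stay in the component of u by \<open>coset_hp\<close>.
  Any other candidate contains the product of the basis elements of a and b, whose support contains
  u, so it is the same component.\<close>

lemma U_mult:
  assumes a: "a \<in> Irr H" and b: "b \<in> Irr H" and u: "u \<in> hp a b"
  shows "component a \<otimes>\<^bsub>U\<^esub> component b = component u"
proof -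
  have uI: "u \<in> Irr H" by (rule irr.hp_mem[OF a b u])
  have "(THE C. C \<in> grading_components H \<and> (\<forall>x\<in>component a. \<forall>y\<in>component b. K0_mult H x y \<in> C)) = component u"
  proof (rule the_equality)
    have "K0_mult H x y \<in> component u" if x: "x \<in> component a" and y: "y \<in> component b" for x y
    proof -
      have k: "Poly_Mapping.keys x \<subseteq> adj.coset a" "Poly_Mapping.keys y \<subseteq> adj.coset b"
        using x y by (simp_all add: component_def mem_based_span)
      then have kI: "Poly_Mapping.keys x \<subseteq> Irr H" "Poly_Mapping.keys y \<subseteq> Irr H"
        using adj.coset_sub a b by blast+
      show ?thesis
        unfolding component_def mem_based_span
      proof
        fix w assume "w \<in> Poly_Mapping.keys (K0_mult H x y)"
        then obtain p q where "p \<in> adj.coset a" "q \<in> adj.coset b" "w \<in> hp p q"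
          using keys_K0_mult[OF kI] k by blast
        then show "w \<in> adj.coset u" using adj.coset_hp[OF a b _ _ _ u] by blast
      qed
    qed
    then show "component u \<in> grading_components H \<and> (\<forall>x\<in>component a. \<forall>y\<in>component b. K0_mult H x y \<in> component u)"
      using uI by (simp add: grading_components_eq)
    fix C assume C: "C \<in> grading_components H \<and> (\<forall>x\<in>component a. \<forall>y\<in>component b. K0_mult H x y \<in> C)"
    then obtain d where d: "d \<in> Irr H" "C = component d" by (auto simp: grading_components_eq)
    have "frag_of a \<in> component a" "frag_of b \<in> component b"
      using a b adj.coset_self by (simp_all add: component_def frag_of_based_span)
    then have "K0_mult H (frag_of a) (frag_of b) \<in> component d" using C d(2) by blast
    then have "u \<in> adj.coset d" using u unfolding component_def mem_based_span keys_K0_mult_of[OF a b] by blast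
    then show "C = component u" using component_eq_iff[OF uI d(1)] d(2) by simp
  qed
  then show ?thesis by (simp add: universal_grading_group_def)
qed

lemma U_group: "group U"
proof (rule groupI)
  show "\<one>\<^bsub>U\<^esub> \<in> carrier U" unfolding U_one using component_carrier[OF unit_class_Irr] .
  fix x assume "x \<in> carrier U"
  then obtain a where a: "a \<in> Irr H" "x = component a" by (auto simp: U_carrier)
  show "\<one>\<^bsub>U\<^esub> \<otimes>\<^bsub>U\<^esub> x = x"
    unfolding U_one a(2) by (rule U_mult[OF unit_class_Irr a(1)]) (simp add: irr.hp_unit_left[OF a(1)])
  show "\<exists>y\<in>carrier U. y \<otimes>\<^bsub>U\<^esub> x = \<one>\<^bsub>U\<^esub>"
    unfolding U_one a(2)
    using U_mult[OF dual_class(1)[OF a(1)] a(1) irr.unit_in_hp_iv(2)[OF a(1)]] component_carrier[OF dual_class(1)[OF a(1)]]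
    by blast
  fix y assume "y \<in> carrier U"
  then obtain b where b: "b \<in> Irr H" "y = component b" by (auto simp: U_carrier)
  obtain u where u: "u \<in> hp a b" using irr.hp_nonempty[OF a(1) b(1)] by blast
  have uI: "u \<in> Irr H" by (rule irr.hp_mem[OF a(1) b(1) u])
  show "x \<otimes>\<^bsub>U\<^esub> y \<in> carrier U"
    unfolding a(2) b(2) U_mult[OF a(1) b(1) u] by (rule component_carrier[OF uI])
  fix z assume "z \<in> carrier U"
  then obtain c where c: "c \<in> Irr H" "z = component c" by (auto simp: U_carrier)
  obtain w where w: "w \<in> hp u c" using irr.hp_nonempty[OF uI c(1)] by blast
  obtain v where v: "v \<in> hp b c" "w \<in> hp a v" using irr.assoc_right[OF a(1) b(1) c(1) u w] by blast
  show "x \<otimes>\<^bsub>U\<^esub> y \<otimes>\<^bsub>U\<^esub> z = x \<otimes>\<^bsub>U\<^esub> (y \<otimes>\<^bsub>U\<^esub> z)"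
    unfolding a(2) b(2) c(2) U_mult[OF a(1) b(1) u] U_mult[OF uI c(1) w] U_mult[OF b(1) c(1) v(1)]
      U_mult[OF a(1) irr.hp_mem[OF b(1) c(1) v(1)] v(2)] ..
qed

lemma U_inv: "a \<in> Irr H \<Longrightarrow> inv\<^bsub>U\<^esub> (component a) = component (dual_class a)"
proof (rule group.inv_equality[OF U_group])
  assume a: "a \<in> Irr H"
  show "component (dual_class a) \<otimes>\<^bsub>U\<^esub> component a = \<one>\<^bsub>U\<^esub>"
    unfolding U_one by (rule U_mult[OF dual_class(1)[OF a] a irr.unit_in_hp_iv(2)[OF a]])
qed (simp_all add: component_carrier dual_class)

section \<open>Functions on the grading group as a central Hopf subalgebra\<close>

definition \<Phi> :: "(('k, 'h) k0 set \<Rightarrow> 'k) \<Rightarrow> 'h" where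
  "\<Phi> f = (\<Sum>b\<in>Irr H. scale H (f (component b)) (idem b))"

lemma \<Phi>_action:
  assumes X: "simple_rep H X"
  shows "snd X (\<Phi> f) = f (component (iso_class H X)) \<cdot>\<^sub>m 1\<^sub>m (fst X)"
proof -
  note XR = simple_repD(1)[OF X] and I = Irr_iff[OF X]
  have "\<Phi> f = scale H (f (component (iso_class H X))) (idem (iso_class H X)) +
    (\<Sum>b\<in>Irr H - {iso_class H X}. scale H (f (component b)) (idem b))"
    unfolding \<Phi>_def by (rule sum.remove[OF finite_Irr I])
  moreover have "snd X (\<Sum>b\<in>Irr H - {iso_class H X}. scale H (f (component b)) (idem b)) = 0\<^sub>m (fst X) (fst X)"
    by (rule Rep_sum_zero[OF XR]) (auto simp: Rep_scale[OF XR] idem_action[OF X])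
  ultimately show ?thesis
    by (simp add: Rep_add[OF XR] Rep_scale[OF XR] idem_action[OF X])
qed

text \<open>Simple objects act faithfully, so an identity for \<open>\<Phi>\<close> need only be
  checked for the scalars on simple objects; the algebra structure thereby becomes pointwise
  arithmetic of functions.\<close>

lemma \<Phi>_eqI:
  assumes "\<And>X. simple_rep H X \<Longrightarrow> snd X z = f (component (iso_class H X)) \<cdot>\<^sub>m 1\<^sub>m (fst X)"
  shows "z = \<Phi> f"
  by (rule simple_faithful) (simp add: assms \<Phi>_action)

lemma scalar_mat_add: "c \<cdot>\<^sub>m 1\<^sub>m n + d \<cdot>\<^sub>m 1\<^sub>m n = (c + d) \<cdot>\<^sub>m (1\<^sub>m n :: 'k mat)"
  by (intro eq_matI) (auto simp: algebra_simps)

lemma scalar_mat_mult: "A \<in> carrier_mat n n \<Longrightarrow> (c \<cdot>\<^sub>m 1\<^sub>m n) * A = c \<cdot>\<^sub>m (A :: 'k mat)"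
  "A \<in> carrier_mat n n \<Longrightarrow> A * (c \<cdot>\<^sub>m 1\<^sub>m n) = c \<cdot>\<^sub>m (A :: 'k mat)"
  using mult_smult_assoc_mat[OF one_carrier_mat, of A n n c] mult_smult_distrib[of A n n "1\<^sub>m n" n c] by auto

lemma scalar_mat_inject: "n \<noteq> 0 \<Longrightarrow> c \<cdot>\<^sub>m 1\<^sub>m n = d \<cdot>\<^sub>m (1\<^sub>m n :: 'k mat) \<Longrightarrow> c = d"
proof -
  assume n: "n \<noteq> 0" and eq: "c \<cdot>\<^sub>m 1\<^sub>m n = d \<cdot>\<^sub>m (1\<^sub>m n :: 'k mat)"
  have "(c \<cdot>\<^sub>m 1\<^sub>m n) $$ (0, 0) = (d \<cdot>\<^sub>m (1\<^sub>m n :: 'k mat)) $$ (0, 0)" unfolding eq ..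
  then show "c = d" using n by simp
qed

lemma smult_smult_mat: "c \<cdot>\<^sub>m (d \<cdot>\<^sub>m A) = (c * d) \<cdot>\<^sub>m (A :: 'k mat)"
  by (intro eq_matI) auto

lemma component_simple: "simple_rep H X \<Longrightarrow> component (iso_class H X) \<in> carrier U"
  by (simp add: component_carrier Irr_iff)

lemma \<Phi>_add: "\<Phi> (\<lambda>x\<in>carrier U. f x + g x) = \<Phi> f + \<Phi> g"
  by (rule \<Phi>_eqI[symmetric]) (simp add: \<Phi>_action Rep_add simple_repD component_simple scalar_mat_add)

lemma \<Phi>_scale: "\<Phi> (\<lambda>x\<in>carrier U. c * f x) = scale H c (\<Phi> f)"
  by (rule \<Phi>_eqI[symmetric]) (simp add: \<Phi>_action Rep_scale simple_repD component_simple smult_smult_mat)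

lemma \<Phi>_mult: "\<Phi> (\<lambda>x\<in>carrier U. f x * g x) = \<Phi> f * \<Phi> g"
  by (rule \<Phi>_eqI[symmetric]) (simp add: \<Phi>_action Rep_mult simple_repD component_simple scalar_mat_mult smult_smult_mat mult.commute)

lemma \<Phi>_one: "\<Phi> (\<lambda>x\<in>carrier U. 1) = 1"
  by (rule \<Phi>_eqI[symmetric]) (auto simp: Rep_one simple_repD component_simple intro!: eq_matI)

lemma \<Phi>_inj: "inj_on \<Phi> (Fun U)"
proof (rule inj_onI)
  fix f g assume f: "f \<in> Fun U" and g: "g \<in> Fun U" and eq: "\<Phi> f = \<Phi> g"
  show "f = g"
  proof (rule extensionalityI[of _ "carrier U"])
    show "f \<in> extensional (carrier U)" "g \<in> extensional (carrier U)" using f g by (auto simp: Fun_def PiE_def)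
    fix x assume "x \<in> carrier U"
    then obtain b where b: "b \<in> Irr H" "x = component b" by (auto simp: U_carrier)
    have "f x \<cdot>\<^sub>m 1\<^sub>m (fst (rp b)) = g x \<cdot>\<^sub>m 1\<^sub>m (fst (rp b))"
      using \<Phi>_action[OF rp(1)[OF b(1)], of f] \<Phi>_action[OF rp(1)[OF b(1)], of g] eq b rp(2)[OF b(1)] by simp
    then show "f x = g x" by (rule scalar_mat_inject[OF rp(4)[OF b(1)]])
  qed
qed

lemma pair_index_eq_iff: "(j::nat) < n \<Longrightarrow> l < n \<Longrightarrow> i * n + j = k * n + l \<longleftrightarrow> i = k \<and> j = l"
  by (metis div_mult_self3 mod_mult_self3 add.right_neutral div_less gr_implies_not0 mod_less)

lemma mult_tensor_simple:
  assumes X: "simple_rep H X" and Y: "simple_rep H Y"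
  shows "rep_mult (tensor_rep H X Y) b > 0 \<longleftrightarrow> b \<in> hp (iso_class H X) (iso_class H Y)"
proof -
  have "rep_mult (tensor_rep H X Y) b = rep_mult (tensor_rep H (rp (iso_class H X)) (rp (iso_class H Y))) b"
    using character_rp[OF X] character_rp[OF Y]
    by (intro mult_tensor_cong simple_repD(1) X Y rp(3) Irr_iff) simp_all
  then show ?thesis by (simp add: hp_def)
qed

text \<open>Tested on matrix coefficients of simple X and Y, the left side is the action of
  \<open>\<Phi> f\<close> on X \<otimes> Y. All constituents of X \<otimes> Y lie in the product of
  the two components x and y, so this action is the scalar f(xy), which
  \<open>Fun_comult_eval\<close> gives for the right side.\<close>

lemma \<Phi>_comult: "teq H (pure2 (comult H (\<Phi> f))) {#[\<Phi> p, \<Phi> q]. (p, q) \<in># Fun_comult U f#}"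
proof -
  have eq: "{#[\<Phi> p, \<Phi> q]. (p, q) \<in># Fun_comult U f#} = pure2 {#(\<Phi> p, \<Phi> q). (p, q) \<in># Fun_comult U f#}"
    by (simp add: multiset.map_comp comp_def case_prod_unfold)
  show ?thesis
    unfolding eq
  proof (rule teq_simpleI)
    fix X Y i j k l
    assume X: "simple_rep H X" and Y: "simple_rep H Y" and ij: "i < fst X" "j < fst X" and kl: "k < fst Y" "l < fst Y"
    let ?x = "component (iso_class H X)" and ?y = "component (iso_class H Y)"
    note R = simple_repD(1)[OF X] simple_repD(1)[OF Y] and I = Irr_iff[OF X] Irr_iff[OF Y]
    have "snd (tensor_rep H X Y) (\<Phi> f) = f (?x \<otimes>\<^bsub>U\<^esub> ?y) \<cdot>\<^sub>m 1\<^sub>m (fst (tensor_rep H X Y))"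
    proof (rule action_scalar[OF tensor_rep_Rep[OF R]])
      fix Z assume Z: "simple_rep H Z" "rep_mult (tensor_rep H X Y) (iso_class H Z) > 0"
      then have "?x \<otimes>\<^bsub>U\<^esub> ?y = component (iso_class H Z)"
        using U_mult[OF I] mult_tensor_simple[OF X Y] by simp
      then show "snd Z (\<Phi> f) = f (?x \<otimes>\<^bsub>U\<^esub> ?y) \<cdot>\<^sub>m 1\<^sub>m (fst Z)" using \<Phi>_action[OF Z(1)] by simp
    qed
    then have "(\<Sum>(a, b)\<in>#comult H (\<Phi> f). snd X a $$ (i, j) * snd Y b $$ (k, l)) =
      f (?x \<otimes>\<^bsub>U\<^esub> ?y) * (if i = j then 1 else 0) * (if k = l then 1 else 0)"
      using tensor_rep_entry[OF ij(1) kl(1) ij(2) kl(2), where h = "\<Phi> f"] ij kl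
      by (cases "i = j"; cases "k = l") (simp_all add: pair_index_less pair_index_eq_iff)
    also have "\<dots> = (\<Sum>(p, q)\<in>#Fun_comult U f. p ?x * q ?y) * (if i = j then 1 else 0) * (if k = l then 1 else 0)"
      using Fun_comult_eval[OF U_finite component_simple[OF X] component_simple[OF Y], of f] by simp
    also have "\<dots> = (\<Sum>(a, b)\<in>#{#(\<Phi> p, \<Phi> q). (p, q) \<in># Fun_comult U f#}. snd X a $$ (i, j) * snd Y b $$ (k, l))"
      using ij kl by (simp add: multiset.map_comp comp_def case_prod_unfold \<Phi>_action[OF X] \<Phi>_action[OF Y]
        sum_mset_distrib_right mult_ac)
    finally show "(\<Sum>(a, b)\<in>#comult H (\<Phi> f). snd X a $$ (i, j) * snd Y b $$ (k, l)) =
      (\<Sum>(a, b)\<in>#{#(\<Phi> p, \<Phi> q). (p, q) \<in># Fun_comult U f#}. snd X a $$ (i, j) * snd Y b $$ (k, l))" .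
  qed
qed

lemma \<Phi>_counit: "counit H (\<Phi> f) = f \<one>\<^bsub>U\<^esub>"
proof -
  have "counit H (\<Phi> f) = snd (unit_rep H) (\<Phi> f) $$ (0, 0)" by simp
  also have "\<dots> = f \<one>\<^bsub>U\<^esub>"
    unfolding \<Phi>_action[OF unit_rep_simple] U_one unit_class_def by simp
  finally show ?thesis .
qed

text \<open>The antipode acts on X as the transpose of the action on the dual, and the component of
  the dual class is the inverse of that of X.\<close>

lemma \<Phi>_antipode: "antipode H (\<Phi> f) = \<Phi> (\<lambda>x\<in>carrier U. f (inv\<^bsub>U\<^esub> x))"
proof (rule \<Phi>_eqI)
  fix X assume X: "simple_rep H X"
  note XR = simple_repD(1)[OF X] and I = Irr_iff[OF X]
  have "snd X (antipode H (\<Phi> f)) = transpose_mat (snd (dual_rep H X) (\<Phi> f))"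
    by (simp add: dual_rep_def)
  also have "\<dots> = f (component (dual_class (iso_class H X))) \<cdot>\<^sub>m 1\<^sub>m (fst X)"
    unfolding \<Phi>_action[OF simple_dual(1)[OF X]] simple_dual(2)[OF X] by (intro eq_matI) auto
  finally show "snd X (antipode H (\<Phi> f)) = (\<lambda>x\<in>carrier U. f (inv\<^bsub>U\<^esub> x)) (component (iso_class H X)) \<cdot>\<^sub>m 1\<^sub>m (fst X)"
    by (simp add: component_carrier I U_inv)
qed

lemma hopf_iso_\<Phi>: "hopf_iso_Fun U H (\<Phi> ` Fun U) \<Phi>"
  unfolding hopf_iso_Fun_def
  using \<Phi>_inj \<Phi>_add \<Phi>_scale \<Phi>_mult \<Phi>_one \<Phi>_comult \<Phi>_counit \<Phi>_antipode by (auto simp: bij_betw_def)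

text \<open>Members of \<open>Fun\<close> are extensional, while \<open>\<Phi>\<close> reads a
  function only at components; hence its values on arbitrary functions are also values on
  \<open>Fun\<close>.\<close>

lemma \<Phi>_restrict: "\<Phi> (\<lambda>x\<in>carrier U. f x) = \<Phi> f"
  by (rule \<Phi>_eqI) (simp add: \<Phi>_action component_simple)

lemma \<Phi>_mem: "\<Phi> f \<in> \<Phi> ` Fun U"
  by (rule image_eqI[of _ \<Phi> "restrict f (carrier U)"]) (simp_all add: Fun_def \<Phi>_restrict)

lemma hopf_subalgebra_\<Phi>: "hopf_subalgebra H (\<Phi> ` Fun U)"
  unfolding hopf_subalgebra_def
proof (intro conjI ballI)
  have "\<Phi> (\<lambda>_. 0) = 0" by (simp add: \<Phi>_def)
  then have "0 \<in> \<Phi> ` Fun U" using \<Phi>_mem[of "\<lambda>_. 0"] by simp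
  then show "subspace (\<Phi> ` Fun U)"
    unfolding subspace_def using \<Phi>_mem by (auto simp flip: \<Phi>_add \<Phi>_scale)
  show "1 \<in> \<Phi> ` Fun U" unfolding \<Phi>_one[symmetric] by (rule \<Phi>_mem)
  show "x * y \<in> \<Phi> ` Fun U" if "x \<in> \<Phi> ` Fun U" "y \<in> \<Phi> ` Fun U" for x y
    using that \<Phi>_mem by (auto simp flip: \<Phi>_mult)
  show "antipode H x \<in> \<Phi> ` Fun U" if "x \<in> \<Phi> ` Fun U" for x
    using that \<Phi>_mem by (auto simp: \<Phi>_antipode)
  show "\<exists>M. set_mset M \<subseteq> \<Phi> ` Fun U \<times> \<Phi> ` Fun U \<and> teq H (pure2 (comult H x)) (pure2 M)" if x: "x \<in> \<Phi> ` Fun U" for x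
  proof -
    obtain f where f: "x = \<Phi> f" using x by blast
    let ?M = "{#(\<Phi> p, \<Phi> q). (p, q) \<in># Fun_comult U f#}"
    have "teq H (pure2 (comult H x)) (pure2 ?M)"
      using \<Phi>_comult[of f] by (simp add: f multiset.map_comp comp_def case_prod_unfold)
    moreover have "set_mset ?M \<subseteq> \<Phi> ` Fun U \<times> \<Phi> ` Fun U" using \<Phi>_mem by auto
    ultimately show ?thesis by blast
  qed
qed

lemma \<Phi>_central: "\<Phi> ` Fun U \<subseteq> center"
proof -
  have "\<Phi> f * x = x * \<Phi> f" for f x
    by (rule simple_faithful) (simp add: Rep_mult simple_repD \<Phi>_action scalar_mat_mult)
  then show ?thesis by (auto simp: center_def)
qed

lemma scalar_subobject:
  assumes V: "V \<in> Rep H" and z: "snd V z = c \<cdot>\<^sub>m 1\<^sub>m (fst V)" and W: "W \<in> Rep H" and sub: "subobject W V"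
  shows "snd W z = c \<cdot>\<^sub>m 1\<^sub>m (fst W)"
proof -
  obtain T where T: "rep_mono W V T" using sub unfolding subobject_def by blast
  then have Th: "T \<in> rep_hom W V" by (simp add: rep_mono_def)
  obtain Q where Q: "Q \<in> rep_hom V W" "Q * T = 1\<^sub>m (fst W)" by (rule mono_retraction[OF W V T])
  note cc = rep_hom_carrier[OF Q(1)] rep_hom_carrier[OF Th]
  have "snd W z = Q * T * snd W z" using Q(2) W by simp
  also have "\<dots> = Q * (snd V z * T)"
    unfolding rep_hom_comm[OF Th, symmetric] by (rule assoc_mult_mat[OF cc Rep_carrier[OF W]])
  also have "snd V z * T = c \<cdot>\<^sub>m T"
    unfolding z using mult_smult_assoc_mat[OF one_carrier_mat cc(2)] cc(2) by simp
  also have "Q * (c \<cdot>\<^sub>m T) = c \<cdot>\<^sub>m 1\<^sub>m (fst W)" using mult_smult_distrib[OF cc] Q(2) by simp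
  finally show ?thesis .
qed

lemma scalar_constituent:
  assumes V: "V \<in> Rep H" and z: "snd V z = c \<cdot>\<^sub>m 1\<^sub>m (fst V)" and X: "simple_rep H X" and pos: "rep_mult V (iso_class H X) > 0"
  shows "snd X z = c \<cdot>\<^sub>m 1\<^sub>m (fst X)"
proof -
  note R = rp(3)[OF Irr_iff[OF X]]
  obtain A B where AB: "A \<in> rep_hom (rp (iso_class H X)) V" "B \<in> rep_hom V (rp (iso_class H X))"
    "B * A = 1\<^sub>m (fst (rp (iso_class H X)))" by (rule mult_pos_homs[OF V pos])
  show ?thesis
    by (rule scalar_subobject[OF R scalar_subobject[OF V z R left_inverse_subobject[OF R AB]]])
      (simp_all add: simple_repD(1)[OF X] iso_subobject rp_iso[OF X])
qed

lemma central_scalar: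
  assumes z: "z \<in> center" and X: "simple_rep H X"
  obtains c where "snd X z = c \<cdot>\<^sub>m 1\<^sub>m (fst X)"
proof (rule schur_scalar[OF X])
  note XR = simple_repD(1)[OF X]
  show "snd X z \<in> rep_hom X X"
  proof (rule rep_homI)
    fix h
    show "snd X z * snd X h = snd X h * snd X z"
      unfolding Rep_mult[OF XR, symmetric] using z by (simp add: center_def)
  qed (simp add: XR)
qed

section \<open>Constraints on an arbitrary central Hopf subalgebra\<close>

context
  fixes L
  assumes L: "hopf_subalgebra H L" and Lc: "L \<subseteq> center"
begin

text \<open>The representative \<open>comult H l\<close> itself may have components outside
  \<open>L\<close>. For evaluating balanced maps it can be exchanged for one with both components in
  \<open>L\<close>.\<close>

lemma sub_comult:
  assumes l: "l \<in> L"
  obtains M where "set_mset M \<subseteq> L \<times> L"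
    "\<forall>F::'h \<Rightarrow> 'h \<Rightarrow> 'k. biadditive_balanced (scale H) F \<longrightarrow> (\<Sum>(a, b)\<in>#comult H l. F a b) = (\<Sum>(a, b)\<in>#M. F a b)"
proof -
  obtain M where M: "set_mset M \<subseteq> L \<times> L" "teq H (pure2 (comult H l)) (pure2 M)"
    using L l unfolding hopf_subalgebra_def by blast
  have "\<forall>F::'h \<Rightarrow> 'h \<Rightarrow> 'k. biadditive_balanced (scale H) F \<longrightarrow> (\<Sum>(a, b)\<in>#comult H l. F a b) = (\<Sum>(a, b)\<in>#M. F a b)"
  proof (intro allI impI)
    fix F :: "'h \<Rightarrow> 'h \<Rightarrow> 'k" assume "biadditive_balanced (scale H) F"
    from tensor_eq_sum2[OF M(2) this] show "(\<Sum>(a, b)\<in>#comult H l. F a b) = (\<Sum>(a, b)\<in>#M. F a b)" by simp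
  qed
  with M(1) show ?thesis by (rule that)
qed

text \<open>Where L acts on V through the counit, l acts on V \<otimes> W as \<epsilon>(l_1) l_2 = l
  acts on W. The scalar c is arbitrary, which covers both closure of the trivially acted objects
  under tensor products and constancy of scalars along cosets.\<close>

lemma tensor_left_trivial:
  assumes V: "V \<in> Rep H" and W: "W \<in> Rep H" and triv: "\<And>l. l \<in> L \<Longrightarrow> snd V l = counit H l \<cdot>\<^sub>m 1\<^sub>m (fst V)"
    and l: "l \<in> L" and w: "snd W l = c \<cdot>\<^sub>m 1\<^sub>m (fst W)"
  shows "snd (tensor_rep H V W) l = c \<cdot>\<^sub>m 1\<^sub>m (fst (tensor_rep H V W))"
proof (rule tensor_mat_eqI[of _ "fst V" "fst W" "fst V" "fst W"])
  fix i j k m assume ij: "i < fst V" "j < fst W" "k < fst V" "m < fst W"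
  obtain M where M: "set_mset M \<subseteq> L \<times> L"
    "\<forall>F::'h \<Rightarrow> 'h \<Rightarrow> 'k. biadditive_balanced (scale H) F \<longrightarrow> (\<Sum>(a, b)\<in>#comult H l. F a b) = (\<Sum>(a, b)\<in>#M. F a b)"
    by (rule sub_comult[OF l])
  note lf = linear_form_entry[OF W ij(2,4)]
  have bi: "biadditive_balanced (scale H) (\<lambda>a b. counit H a * snd W b $$ (j, m))"
    by (intro biadditive_product lf counit_linear)
  have "snd (tensor_rep H V W) l $$ (i * fst W + j, k * fst W + m) = (\<Sum>(a, b)\<in>#M. snd V a $$ (i, k) * snd W b $$ (j, m))"
    unfolding tensor_rep_entry[OF ij] using M(2) tensor_rep_bilin[OF V W ij] by blast
  \<comment> \<open>Triviality on V is available only for components in \<open>L\<close>, hence the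
    passage to \<open>M\<close>; afterwards the sum returns to \<open>comult H l\<close>, where the
    counit axiom applies.\<close>
  also have "\<dots> = (\<Sum>(a, b)\<in>#M. (if i = k then 1 else 0) * (counit H a * snd W b $$ (j, m)))"
    by (rule arg_cong[where f = sum_mset], rule image_mset_cong) (use M(1) triv ij in auto)
  also have "\<dots> = (if i = k then 1 else 0) * (\<Sum>(a, b)\<in>#M. counit H a * snd W b $$ (j, m))"
    by (simp add: case_prod_unfold sum_mset_distrib_left)
  also have "(\<Sum>(a, b)\<in>#M. counit H a * snd W b $$ (j, m)) = (\<Sum>(a, b)\<in>#comult H l. counit H a * snd W b $$ (j, m))"
    using M(2) bi by simp
  also have "\<dots> = snd W (\<Sum>(a, b)\<in>#comult H l. scale H (counit H a) b) $$ (j, m)"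
    by (simp add: linear_form_sum_mset[OF lf] linear_formD[OF lf] case_prod_unfold)
  also have "(if i = k then 1 else 0) * \<dots> = (c \<cdot>\<^sub>m 1\<^sub>m (fst (tensor_rep H V W))) $$ (i * fst W + j, k * fst W + m)"
    using ij by (simp add: counit_left w pair_index_less pair_index_eq_iff)
  finally show "snd (tensor_rep H V W) l $$ (i * fst W + j, k * fst W + m) =
    (c \<cdot>\<^sub>m 1\<^sub>m (fst (tensor_rep H V W))) $$ (i * fst W + j, k * fst W + m)" .
qed auto

text \<open>By Schur's lemma the central component l_1 acts on X by a scalar, which may be shifted
  to the dual factor. There l_1 and S(l_2) combine to the antipode axiom and give
  \<epsilon>(l).\<close>

lemma adjoint_object_trivial:
  assumes X: "simple_rep H X" and l: "l \<in> L"
  shows "snd (tensor_rep H X (dual_rep H X)) l = counit H l \<cdot>\<^sub>m 1\<^sub>m (fst (tensor_rep H X (dual_rep H X)))"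
proof (rule tensor_mat_eqI[of _ "fst X" "fst X" "fst X" "fst X"])
  note XR = simple_repD(1)[OF X]
  note DX = dual_rep_Rep[OF XR]
  fix i j k m assume ij: "i < fst X" "j < fst X" "k < fst X" "m < fst X"
  then have ij': "i < fst X" "j < fst (dual_rep H X)" "k < fst X" "m < fst (dual_rep H X)" by simp_all
  obtain M where M: "set_mset M \<subseteq> L \<times> L"
    "\<forall>F::'h \<Rightarrow> 'h \<Rightarrow> 'k. biadditive_balanced (scale H) F \<longrightarrow> (\<Sum>(a, b)\<in>#comult H l. F a b) = (\<Sum>(a, b)\<in>#M. F a b)"
    by (rule sub_comult[OF l])
  note lf = linear_form_entry[OF XR ij(4,2)]
  have bi: "biadditive_balanced (scale H) (\<lambda>a b. snd X (a * antipode H b) $$ (m, j))"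
    by (simp add: bilin_simps linear_formD[OF lf])
  have "snd (tensor_rep H X (dual_rep H X)) l $$ (i * fst X + j, k * fst X + m) =
      (\<Sum>(a, b)\<in>#comult H l. snd X a $$ (i, k) * snd (dual_rep H X) b $$ (j, m))"
    using tensor_rep_entry[OF ij', where h = l] by simp
  also have "\<dots> = (\<Sum>(a, b)\<in>#M. snd X a $$ (i, k) * snd (dual_rep H X) b $$ (j, m))"
    using M(2) tensor_rep_bilin[OF XR DX ij'] by blast
  also have "\<dots> = (\<Sum>(a, b)\<in>#M. (if i = k then 1 else 0) * snd X (a * antipode H b) $$ (m, j))"
  proof (rule arg_cong[where f = sum_mset], rule image_mset_cong, clarify)
    fix a b assume "(a, b) \<in># M"
    then have "a \<in> center" using M(1) Lc by auto
    then obtain c where c: "snd X a = c \<cdot>\<^sub>m 1\<^sub>m (fst X)" by (rule central_scalar[OF _ X])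
    show "snd X a $$ (i, k) * snd (dual_rep H X) b $$ (j, m) = (if i = k then 1 else 0) * snd X (a * antipode H b) $$ (m, j)"
      using ij XR by (simp add: Rep_mult[OF XR] c scalar_mat_mult dual_rep_entry)
  qed
  also have "\<dots> = (if i = k then 1 else 0) * (\<Sum>(a, b)\<in>#M. snd X (a * antipode H b) $$ (m, j))"
    by (simp add: case_prod_unfold sum_mset_distrib_left)
  also have "(\<Sum>(a, b)\<in>#M. snd X (a * antipode H b) $$ (m, j)) = (\<Sum>(a, b)\<in>#comult H l. snd X (a * antipode H b) $$ (m, j))"
    using M(2) bi by simp
  also have "\<dots> = snd X (\<Sum>(a, b)\<in>#comult H l. a * antipode H b) $$ (m, j)"
    by (simp add: linear_form_sum_mset[OF lf] case_prod_unfold)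
  also have "(if i = k then 1 else 0) * \<dots> = (counit H l \<cdot>\<^sub>m 1\<^sub>m (fst (tensor_rep H X (dual_rep H X)))) $$ (i * fst X + j, k * fst X + m)"
    using ij XR by (auto simp: antipode_right Rep_scale Rep_one pair_index_less pair_index_eq_iff)
  finally show "snd (tensor_rep H X (dual_rep H X)) l $$ (i * fst X + j, k * fst X + m) =
    (counit H l \<cdot>\<^sub>m 1\<^sub>m (fst (tensor_rep H X (dual_rep H X)))) $$ (i * fst X + j, k * fst X + m)" .
qed (use tensor_rep_carrier[of X "dual_rep H X"] in auto)

text \<open>The objects on which L acts through the counit form a full tensor subcategory that
  contains the generators. Closure under duals uses that L is stable under the antipode and that the
  antipode preserves the counit.\<close>

lemma adjoint_trivial:
  assumes "V \<in> adjoint_subcategory H" "l \<in> L"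
  shows "snd V l = counit H l \<cdot>\<^sub>m 1\<^sub>m (fst V)"
proof -
  let ?D = "{V \<in> Rep H. \<forall>l\<in>L. snd V l = counit H l \<cdot>\<^sub>m 1\<^sub>m (fst V)}"
  have "full_tensor_subcategory H ?D"
    unfolding full_tensor_subcategory_def
  proof (intro conjI ballI allI impI)
    show "?D \<subseteq> Rep H" by blast
    have "snd (unit_rep H) l = counit H l \<cdot>\<^sub>m 1\<^sub>m (fst (unit_rep H))" for l
      by (auto simp: unit_rep_def intro!: eq_matI)
    then show "unit_rep H \<in> ?D" using unit_rep_Rep by simp
    show "tensor_rep H V W \<in> ?D" if "V \<in> ?D" "W \<in> ?D" for V W
      using that tensor_left_trivial by (simp add: tensor_rep_Rep)
    show "dual_rep H V \<in> ?D" if "V \<in> ?D" for V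
    proof -
      have "antipode H l \<in> L" if "l \<in> L" for l using L that unfolding hopf_subalgebra_def by blast
      then have "snd (dual_rep H V) l = counit H l \<cdot>\<^sub>m 1\<^sub>m (fst V)" if "l \<in> L" for l
        using \<open>V \<in> ?D\<close> that by (auto simp: dual_rep_def counit_antipode intro!: eq_matI)
      then show ?thesis using that dual_rep_Rep by simp
    qed
    show "direct_sum_rep Vs \<in> ?D" if Vs: "set Vs \<subseteq> ?D" for Vs
    proof -
      have VR: "set Vs \<subseteq> Rep H" using Vs by blast
      note R = direct_sum_rep_Rep[OF VR]
      have "snd (direct_sum_rep Vs) l = counit H l \<cdot>\<^sub>m 1\<^sub>m (fst (direct_sum_rep Vs))" if l: "l \<in> L" for l
      proof (rule action_scalar[OF R])
        fix X assume X: "simple_rep H X" "rep_mult (direct_sum_rep Vs) (iso_class H X) > 0"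
        then obtain V where V: "V \<in> set Vs" "rep_mult V (iso_class H X) > 0"
          using mult_direct_sum_pos[OF VR] by blast
        then show "snd X l = counit H l \<cdot>\<^sub>m 1\<^sub>m (fst X)"
          using scalar_constituent[OF _ _ X(1) V(2)] Vs l by blast
      qed
      then show ?thesis using R by simp
    qed
    show "W \<in> ?D" if "V \<in> ?D" "W \<in> Rep H" "subobject W V" for V W
      using that scalar_subobject[of V _ _ W] by simp
  qed
  moreover have "adjoint_generators \<subseteq> ?D"
  proof
    fix Y assume "Y \<in> adjoint_generators"
    then obtain X where Y: "Y \<in> Rep H" and X: "simple_rep H X" "subobject Y (tensor_rep H X (dual_rep H X))" by blast
    have V: "tensor_rep H X (dual_rep H X) \<in> Rep H" by (intro tensor_rep_Rep dual_rep_Rep simple_repD(1)[OF X(1)])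
    show "Y \<in> ?D" using scalar_subobject[OF V adjoint_object_trivial[OF X(1)] Y X(2)] Y by simp
  qed
  ultimately have "adjoint_subcategory H \<subseteq> ?D" by (rule adjoint_subcategory_least)
  then show ?thesis using assms by blast
qed

lemma central_hopf_subalgebra_subset: "L \<subseteq> \<Phi> ` Fun U"
proof
  fix l assume l: "l \<in> L"
  then have lc: "l \<in> center" using Lc by blast
  have "\<exists>c. snd (rp b) l = c \<cdot>\<^sub>m 1\<^sub>m (fst (rp b))" if "b \<in> Irr H" for b
    using central_scalar[OF lc rp(1)[OF that]] by blast
  then obtain g where g: "snd (rp b) l = g b \<cdot>\<^sub>m 1\<^sub>m (fst (rp b))" if "b \<in> Irr H" for b by metis
  \<comment> \<open>Tensoring with an adjoint object does not change the scalar of \<open>l\<close>,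
    so every constituent of such a product inherits it. Going through a whole coset gives constancy
    there.\<close>
  have g_hp: "g d = g c" if n: "n \<in> adjoint_classes" and c: "c \<in> Irr H" and d: "d \<in> hp n c" for n c d
  proof -
    have nI: "n \<in> Irr H" using n adjoint_classes_Irr by blast
    have dI: "d \<in> Irr H" by (rule irr.hp_mem[OF nI c d])
    note R = rp(3)[OF nI] rp(3)[OF c]
    have "snd (tensor_rep H (rp n) (rp c)) l = g c \<cdot>\<^sub>m 1\<^sub>m (fst (tensor_rep H (rp n) (rp c)))"
      by (rule tensor_left_trivial[OF R adjoint_trivial[OF adjoint_class_rp[OF n]] l g[OF c]])
    then have "snd (rp d) l = g c \<cdot>\<^sub>m 1\<^sub>m (fst (rp d))"
      by (rule scalar_constituent[OF tensor_rep_Rep[OF R] _ rp(1)[OF dI]]) (use d in \<open>simp add: rp(2)[OF dI] hp_def\<close>)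
    then show ?thesis using g[OF dI] scalar_mat_inject[OF rp(4)[OF dI]] by simp
  qed
  have g_coset: "g d = g c" if "c \<in> Irr H" "d \<in> Irr H" "component d = component c" for c d
  proof -
    have "d \<in> adj.coset c" using that component_eq_iff by simp
    then show ?thesis using g_hp[OF _ that(1)] by (auto simp: adj.coset_def)
  qed
  \<comment> \<open>The value on a component is the scalar at a chosen class in it; constancy on
    cosets makes the choice harmless.\<close>
  define f where "f A = g (SOME b. b \<in> Irr H \<and> component b = A)" for A
  have f: "f (component c) = g c" if c: "c \<in> Irr H" for c
  proof -
    have "(SOME b. b \<in> Irr H \<and> component b = component c) \<in> Irr H \<and> component (SOME b. b \<in> Irr H \<and> component b = component c) = component c"
      by (rule someI[of _ c]) (use c in simp)
    then show ?thesis unfolding f_def using g_coset[OF c] by blast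
  qed
  have "l = \<Phi> f"
  proof (rule \<Phi>_eqI)
    fix X assume X: "simple_rep H X"
    note I = Irr_iff[OF X]
    show "snd X l = f (component (iso_class H X)) \<cdot>\<^sub>m 1\<^sub>m (fst X)"
      unfolding f[OF I]
      by (rule scalar_subobject[OF rp(3)[OF I] g[OF I] simple_repD(1)[OF X] iso_subobject[OF simple_repD(1)[OF X] rp_iso[OF X]]])
  qed
  then show "l \<in> \<Phi> ` Fun U" using \<Phi>_mem by simp
qed

end

text \<open>The image of \<open>\<Phi>\<close> is not just maximal but contains every central Hopf
  subalgebra, which gives uniqueness.\<close>

lemma maximal_iff: "maximal_central_hopf_subalgebra H K \<longleftrightarrow> K = \<Phi> ` Fun U"
proof
  assume K: "maximal_central_hopf_subalgebra H K"
  then have "K \<subseteq> \<Phi> ` Fun U"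
    unfolding maximal_central_hopf_subalgebra_def by (intro central_hopf_subalgebra_subset) simp_all
  moreover have "\<forall>L. hopf_subalgebra H L \<and> L \<subseteq> center \<and> K \<subseteq> L \<longrightarrow> L = K"
    using K unfolding maximal_central_hopf_subalgebra_def by simp
  then have "hopf_subalgebra H (\<Phi> ` Fun U) \<and> \<Phi> ` Fun U \<subseteq> center \<and> K \<subseteq> \<Phi> ` Fun U \<longrightarrow> \<Phi> ` Fun U = K" by (rule spec)
  ultimately show "K = \<Phi> ` Fun U"
    using hopf_subalgebra_\<Phi> \<Phi>_central by simp
next
  assume K: "K = \<Phi> ` Fun U"
  show "maximal_central_hopf_subalgebra H K"
    unfolding maximal_central_hopf_subalgebra_def K
  proof (intro conjI allI impI)
    fix L assume "hopf_subalgebra H L \<and> L \<subseteq> center \<and> \<Phi> ` Fun U \<subseteq> L"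
    then show "L = \<Phi> ` Fun U" using central_hopf_subalgebra_subset[of L] by (intro equalityI) simp_all
  qed (rule hopf_subalgebra_\<Phi>, rule \<Phi>_central)
qed

text \<open>Factoring through cosets amounts to killing I. Stated for subspaces, because
  multiplicativity is already demanded of the pullback as a representation of H.\<close>

lemma Rep_quotient_iff:
  assumes I: "subspace I"
  shows "V \<in> Rep_quotient H I \<longleftrightarrow> V \<in> Rep H \<and> (\<forall>x\<in>I. snd V x = 0\<^sub>m (fst V) (fst V))"
proof
  assume "V \<in> Rep_quotient H I"
  then obtain n \<sigma> where V: "V = (n, \<sigma> \<circ> quotient_map I)" "V \<in> Rep H" unfolding Rep_quotient_def by blast
  have "snd V x = 0\<^sub>m (fst V) (fst V)" if x: "x \<in> I" for x
  proof -
    have "x +o I = 0 +o I"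
    proof
      show "x +o I \<subseteq> 0 +o I" using x subspace_add[OF I] by (auto simp: elt_set_plus_def)
      show "0 +o I \<subseteq> x +o I"
      proof
        fix y assume "y \<in> 0 +o I"
        then have "y - x \<in> I" "y = x + (y - x)" using x subspace_diff[OF I] by (auto simp: elt_set_plus_def)
        then show "y \<in> x +o I" unfolding elt_set_plus_def by blast
      qed
    qed
    then have "snd V x = snd V 0" by (simp add: V(1) quotient_map_def)
    then show ?thesis by (simp add: Rep_zero[OF V(2)])
  qed
  with V(2) show "V \<in> Rep H \<and> (\<forall>x\<in>I. snd V x = 0\<^sub>m (fst V) (fst V))" by blast
next
  assume "V \<in> Rep H \<and> (\<forall>x\<in>I. snd V x = 0\<^sub>m (fst V) (fst V))"
  then have V: "V \<in> Rep H" and z: "\<And>x. x \<in> I \<Longrightarrow> snd V x = 0\<^sub>m (fst V) (fst V)" by auto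
  \<comment> \<open>The action of a coset is that of any member; two members differ by an element of
    I, which acts as zero.\<close>
  define \<sigma> where "\<sigma> C = snd V (SOME x. x +o I = C)" for C
  have "\<sigma> (quotient_map I x) = snd V x" for x
  proof -
    define y where "y = (SOME y. y +o I = x +o I)"
    have y: "y +o I = x +o I" unfolding y_def by (rule someI[of "\<lambda>y. y +o I = x +o I" x]) simp
    have "y \<in> x +o I" using subspace_0[OF I] unfolding y[symmetric] by (force simp: elt_set_plus_def)
    then obtain i where "i \<in> I" "y = x + i" by (auto simp: elt_set_plus_def)
    then have "snd V y = snd V x" using z V by (simp add: Rep_add)
    then show ?thesis by (simp add: \<sigma>_def quotient_map_def y_def)
  qed
  then have "V = (fst V, \<sigma> \<circ> quotient_map I)" by (simp add: prod_eq_iff fun_eq_iff)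
  then show "V \<in> Rep_quotient H I" unfolding Rep_quotient_def using V by (metis (mono_tags, lifting) mem_Collect_eq)
qed

text \<open>Elements of the augmentation ideal of K correspond to functions vanishing at the
  identity component, so they kill adjoint constituents. Conversely a constituent in another
  component is detected by the indicator function of that component.\<close>

lemma adjoint_subcategory_eq: "adjoint_subcategory H = Rep_quotient H (quotient_ideal H (\<Phi> ` Fun U))"
proof -
  let ?K = "\<Phi> ` Fun U" and ?I = "quotient_ideal H (\<Phi> ` Fun U)"
  have I: "subspace ?I" unfolding quotient_ideal_def by (rule subspace_span)
  have aug: "x \<in> augmentation_ideal H ?K \<Longrightarrow> \<exists>f. x = \<Phi> f \<and> f \<one>\<^bsub>U\<^esub> = 0" for x
    by (auto simp: augmentation_ideal_def \<Phi>_counit)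
  have zero: "0 \<cdot>\<^sub>m 1\<^sub>m n = (0\<^sub>m n n :: 'k mat)" for n by (intro eq_matI) auto
  have "V \<in> adjoint_subcategory H \<longleftrightarrow> (\<forall>x\<in>?I. snd V x = 0\<^sub>m (fst V) (fst V))" if V: "V \<in> Rep H" for V
  proof
    assume adj: "V \<in> adjoint_subcategory H"
    have "subspace {x. snd V x = 0\<^sub>m (fst V) (fst V)}"
      using V by (auto simp: subspace_def Rep_zero Rep_add Rep_scale)
    moreover have "{h * x |h x. x \<in> augmentation_ideal H ?K} \<subseteq> {x. snd V x = 0\<^sub>m (fst V) (fst V)}"
    proof clarify
      fix h x assume "x \<in> augmentation_ideal H ?K"
      then obtain f where f: "x = \<Phi> f" "f \<one>\<^bsub>U\<^esub> = 0" using aug by blast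
      have "snd V x = 0 \<cdot>\<^sub>m 1\<^sub>m (fst V)"
      proof (rule action_scalar[OF V])
        fix X assume X: "simple_rep H X" "rep_mult V (iso_class H X) > 0"
        then have "iso_class H X \<in> adj.coset unit_class"
          unfolding adj.coset_unit by (intro adjoint_constituent[OF adj])
        then have "component (iso_class H X) = \<one>\<^bsub>U\<^esub>"
          using component_eq_iff[OF Irr_iff[OF X(1)] unit_class_Irr] by (simp add: U_one)
        then show "snd X x = 0 \<cdot>\<^sub>m 1\<^sub>m (fst X)" using \<Phi>_action[OF X(1)] f by simp
      qed
      then show "snd V (h * x) = 0\<^sub>m (fst V) (fst V)" using V by (simp add: Rep_mult zero)
    qed
    ultimately have "?I \<subseteq> {x. snd V x = 0\<^sub>m (fst V) (fst V)}"
      unfolding quotient_ideal_def by (intro span_minimal)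
    then show "\<forall>x\<in>?I. snd V x = 0\<^sub>m (fst V) (fst V)" by blast
  next
    assume kill: "\<forall>x\<in>?I. snd V x = 0\<^sub>m (fst V) (fst V)"
    have "b \<in> adjoint_classes" if b: "rep_mult V b > 0" for b
    proof (rule ccontr)
      assume nb: "b \<notin> adjoint_classes"
      have bI: "b \<in> Irr H" using b mult_notin_Irr[OF V] by force
      have ne: "component b \<noteq> \<one>\<^bsub>U\<^esub>"
        using nb component_eq_iff[OF bI unit_class_Irr] by (simp add: U_one adj.coset_unit)
      \<comment> \<open>This indicator function has counit 0, since the component of
        \<open>b\<close> is not the identity, yet it acts as 1 on \<open>b\<close>.\<close>
      define f where "f A = (if A = component b then 1 else 0 :: 'k)" for A
      have "f \<one>\<^bsub>U\<^esub> = 0" using ne by (auto simp: f_def)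
      then have "\<Phi> f \<in> augmentation_ideal H ?K" by (simp add: augmentation_ideal_def \<Phi>_mem \<Phi>_counit)
      then have "\<exists>h x. \<Phi> f = h * x \<and> x \<in> augmentation_ideal H ?K" by (intro exI[of _ 1] exI[of _ "\<Phi> f"]) simp
      then have "\<Phi> f \<in> ?I" unfolding quotient_ideal_def by (intro span_base) blast
      then have "snd V (\<Phi> f) = 0 \<cdot>\<^sub>m 1\<^sub>m (fst V)" using kill zero by simp
      then have "snd (rp b) (\<Phi> f) = 0 \<cdot>\<^sub>m 1\<^sub>m (fst (rp b))"
        by (rule scalar_constituent[OF V _ rp(1)[OF bI]]) (simp add: rp(2)[OF bI] b)
      moreover have "snd (rp b) (\<Phi> f) = 1 \<cdot>\<^sub>m 1\<^sub>m (fst (rp b))"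
        by (simp add: \<Phi>_action[OF rp(1)[OF bI]] rp(2)[OF bI] f_def)
      ultimately show False using scalar_mat_inject[OF rp(4)[OF bI], of 0 1] by simp
    qed
    then show "V \<in> adjoint_subcategory H" unfolding adjoint_subcategory_iff[OF V] by blast
  qed
  then have "V \<in> adjoint_subcategory H \<longleftrightarrow> V \<in> Rep_quotient H ?I" for V
    unfolding Rep_quotient_iff[OF I] using full_tensor_subcategoryD(1)[OF full_tensor_subcategory_adjoint] by blast
  then show ?thesis by (rule Set.set_eqI)
qed

end

theorem theorem3p8:
  fixes H :: "('k::{alg_closed_field, field_char_0}, 'h::ring_1) hopf_structure"
  assumes "hopf_algebra H" and "semisimple_algebra H"
  shows "(\<exists>!K. maximal_central_hopf_subalgebra H K) \<and>
    (\<forall>K. maximal_central_hopf_subalgebra H K \<longrightarrow>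
       adjoint_subcategory H = Rep_quotient H (quotient_ideal H K) \<and>
       group (universal_grading_group H) \<and> finite (carrier (universal_grading_group H)) \<and>
       (\<exists>\<Phi>. hopf_iso_Fun (universal_grading_group H) H K \<Phi>))"
proof -
  interpret semisimple_hopf_algebra H
    using assms by (intro semisimple_hopf_algebra.intro semisimple_hopf_algebra_axioms.intro)
  have "\<exists>f. hopf_iso_Fun U H (\<Phi> ` Fun U) f" by (rule exI, rule hopf_iso_\<Phi>)
  then show ?thesis
    by (simp add: maximal_iff adjoint_subcategory_eq[symmetric] U_group U_finite)
qed


end
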